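(* Let $J,K\in\mathbb{R}\cup\{\infty\}$ with $J\le K$. Let $\mu\times\nu$ be one of the following product measures (each satisfies $F^{(J,K)}_{udK}(\mu\times\nu)=\mu\times\nu$): $\mathrm{stExp}(\lambda,c,J-c)\times\mathrm{stExp}(\lambda,c,K-c)$ with finite $c<J/2$ and $\lambda\in\mathbb{R}$ if $K<\infty$, $\lambda>0$ if $K=\infty$; $\mathrm{sstbGeo}(1-\theta,\frac{c}{m},\frac{J-c}{m},\kappa,m)\times\mathrm{sstbGeo}(1-\theta,\frac{c}{m},\frac{K-c}{m},\kappa,m)$ with $c<J/2$ finite, $m>0$, $c,J,K\in m\mathbb{Z}\cup\{\infty\}$ and one of: ($J-2c,K-2c\in m\mathbb{Z}\cup\{\infty\}$, $\theta\in(0,1)$, $\kappa=1$), ($J-2c,K-2c\in2m\mathbb{Z}\cup\{\infty\}$, $\theta\in(0,1)$, $\kappa\ne1$), ($J-2c,K-2c\in m\mathbb{Z}$, $\theta\ge1$, $\kappa=1$), ($J-2c,K-2c\in2m\mathbb{Z}\cup\{\infty\}$, $\theta\ge1$, $\kappa\ne1$), with $\kappa\in(0,\infty)$; if $J=K$, $m\times m$ for any probability measure $m$ on $\mathbb{R}$; if $J<K$, $m\times m$ with $m$ supported on $(-\infty,J/2]$, or $\delta_{J/2}\times m$ with $m$ supported on $[J/2,K-J/2]$, or (if $K<\infty$) $m\times(m+(K-J))$ with $m$ supported on $[J/2,\infty)$, where $(m+L)(A):=m(\{x-L:x\in A\})$. Suppose moreover $\mu\ne\delta_{J/2}$ and $\nu((-\infty,J/2]\cup[K-J/2,\infty))>0$.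 Then $\mu^{\mathbb{Z}}$ is ergodic under $\mathcal{T}^{(J,K)}_{udK}$, and $\nu^{\mathbb{Z}}$ is ergodic under $\mathcal{T}^{(K,J)}_{udK}$.
   Context: $F^{(J,K)}_{udK}(x,u):=\big(u-\max\{x+u-J,0\}+\max\{x+u-K,0\},\;x-\max\{x+u-K,0\}+\max\{x+u-J,0\}\big)$ on $\mathbb{R}^2$ (with $\max\{x+u-\infty,0\}:=0$). For parameters $(A,B)\in\{(J,K),(K,J)\}$, the dynamics $\mathcal{T}^{(A,B)}_{udK}$ on $\mathbb{R}^{\mathbb{Z}}$ is defined, for configurations $x=(x_n)$ for which either there is a unique family $(x_n^t,u_n^t)_{n,t\in\mathbb{Z}}$ with $F^{(A,B)}_{udK}(x_n^t,u_{n-1}^t)=(x_n^{t+1},u_n^t)$ for all $n,t$ and $x_n^0=x_n$, or there is a unique sequence $(U_n)$ with $(F^{(A,B)}_{udK})^{(2)}(x_n,U_{n-1})=U_n$ for all $n$, by $\mathcal{T}(x)_n:=(F^{(A,B)}_{udK})^{(1)}(x_n,U_{n-1})$ (with $U_n=u_n^0$). Ergodicity of $\mu^{\mathbb{Z}}$ includes that it is invariant and $\mathcal{T}$ is a.s. defined. $\mathrm{stExp}(\lambda,c_1,c_2)$ has density proportional to $e^{-\lambda x}\mathbf{1}_{[c_1,c_2]}(x)$ ($c_2=\infty$ allowed if $\lambda>0$); $X\sim\mathrm{sstbGeo}(1-\theta,M,N,\kappa,m)$ means $\mathbf{P}(X=mx)\propto\theta^x\kappa^{\iota(x)}$, $x\in\{M,\dots,N\}$,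 $\iota(x)=0$ ($x$ even), $1$ ($x$ odd). $\delta_x$ is the Dirac mass. *)

theory Defs
  imports "HOL-Probability.Probability"
begin

text \<open>max(s - A, 0), with the convention max(s - infinity, 0) = 0.
  Parameters J, K range over the reals together with +infinity (type ereal,
  the value -infinity is excluded by the hypotheses of the theorem).\<close>
definition mx :: "ereal \<Rightarrow> real \<Rightarrow> real" where
  "mx A s = (case A of ereal a \<Rightarrow> max (s - a) 0 | _ \<Rightarrow> 0)"

definition F_udK :: "ereal \<Rightarrow> ereal \<Rightarrow> real \<times> real \<Rightarrow> real \<times> real" where
  "F_udK A B p = (case p of (x, u) \<Rightarrow>
      (u - mx A (x + u) + mx B (x + u), x - mx B (x + u) + mx A (x + u)))"

definition fam_ok :: "ereal \<Rightarrow> ereal \<Rightarrow> (int \<Rightarrow> real) \<Rightarrow>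
    (int \<Rightarrow> int \<Rightarrow> real) \<times> (int \<Rightarrow> int \<Rightarrow> real) \<Rightarrow> bool" where
  "fam_ok A B x XU = (case XU of (X, U) \<Rightarrow>
      (\<forall>n t. F_udK A B (X n t, U (n - 1) t) = (X n (t + 1), U n t)) \<and> (\<forall>n. X n 0 = x n))"

definition uniq_fam :: "ereal \<Rightarrow> ereal \<Rightarrow> (int \<Rightarrow> real) \<Rightarrow> bool" where
  "uniq_fam A B x = (\<exists>!XU. fam_ok A B x XU)"

definition carrier_ok :: "ereal \<Rightarrow> ereal \<Rightarrow> (int \<Rightarrow> real) \<Rightarrow> (int \<Rightarrow> real) \<Rightarrow> bool" where
  "carrier_ok A B x U = (\<forall>n. snd (F_udK A B (x n, U (n - 1))) = U n)"

definition uniq_carrier :: "ereal \<Rightarrow> ereal \<Rightarrow> (int \<Rightarrow> real) \<Rightarrow> bool" where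
  "uniq_carrier A B x = (\<exists>!U. carrier_ok A B x U)"

definition T_defined :: "ereal \<Rightarrow> ereal \<Rightarrow> (int \<Rightarrow> real) \<Rightarrow> bool" where
  "T_defined A B x = (uniq_fam A B x \<or> uniq_carrier A B x)"

definition T_carrier :: "ereal \<Rightarrow> ereal \<Rightarrow> (int \<Rightarrow> real) \<Rightarrow> int \<Rightarrow> real" where
  "T_carrier A B x = (if uniq_fam A B x
      then (\<lambda>n. snd (THE XU. fam_ok A B x XU) n 0)
      else (THE U. carrier_ok A B x U))"

text \<open>Off its domain of definition, T is (arbitrarily) extended by the identity.\<close>
definition T_udK :: "ereal \<Rightarrow> ereal \<Rightarrow> (int \<Rightarrow> real) \<Rightarrow> (int \<Rightarrow> real)" where
  "T_udK A B x = (if T_defined A B x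
      then (\<lambda>n. fst (F_udK A B (x n, T_carrier A B x (n - 1))))
      else x)"

text \<open>Ergodicity of M under T (defined on the set of configurations satisfying D):
  M is a probability measure, T is a.s. defined, T is measurable (w.r.t. the
  completion, since T is only a.s. defined), M is T-invariant, and every
  T-invariant measurable set has measure 0 or 1.\<close>
definition ergodic_under :: "'a measure \<Rightarrow> ('a \<Rightarrow> 'a) \<Rightarrow> ('a \<Rightarrow> bool) \<Rightarrow> bool" where
  "ergodic_under M T D =
     (prob_space M \<and>
      (AE x in M. D x) \<and>
      T \<in> measurable (completion M) M \<and>
      (\<forall>A\<in>sets M. emeasure (completion M) (T -` A \<inter> space M) = emeasure M A) \<and>
      (\<forall>A\<in>sets M. T -` A \<inter> space M = A \<longrightarrow> emeasure M A = 0 \<or> emeasure M A = 1))"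

definition is_stExp :: "real measure \<Rightarrow> real \<Rightarrow> real \<Rightarrow> ereal \<Rightarrow> bool" where
  "is_stExp M lam c1 c2 =
     (prob_space M \<and> (\<exists>Z>0. M = density lborel
        (\<lambda>x. ennreal (Z * exp (- lam * x)) * indicator {x. c1 \<le> x \<and> ereal x \<le> c2} x)))"

definition iota :: "int \<Rightarrow> nat" where
  "iota x = (if even x then 0 else 1)"

text \<open>X ~ sstbGeo(1-theta, lo, hi, kappa, m): P(X = m x) proportional to
  theta^x kappa^iota(x), for integers x with lo <= x <= hi (hi may be infinity).\<close>
definition is_sstbGeo :: "real measure \<Rightarrow> real \<Rightarrow> real \<Rightarrow> ereal \<Rightarrow> real \<Rightarrow> real \<Rightarrow> bool" where
  "is_sstbGeo M theta lo hi kappa m =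
     (prob_space M \<and> sets M = sets borel \<and>
      (\<exists>Z>0. \<forall>A\<in>sets borel. emeasure M A =
         nn_integral (count_space {x::int. lo \<le> of_int x \<and> ereal (of_int x) \<le> hi \<and> m * of_int x \<in> A})
             (\<lambda>x. ennreal (Z * theta powi x * kappa ^ iota x))))"

definition in_mZ_inf :: "real \<Rightarrow> ereal \<Rightarrow> bool" where
  "in_mZ_inf m a = (a = \<infinity> \<or> (\<exists>k::int. a = ereal (m * of_int k)))"

definition in_mZ :: "real \<Rightarrow> ereal \<Rightarrow> bool" where
  "in_mZ m a = (\<exists>k::int. a = ereal (m * of_int k))"

definition admissible_pair :: "ereal \<Rightarrow> ereal \<Rightarrow> real measure \<Rightarrow> real measure \<Rightarrow> bool" where
  "admissible_pair J K \<mu> \<nu> =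
   ( \<comment> \<open>truncated exponential\<close>
     (\<exists>lam c. ereal c < J / 2 \<and> (K = \<infinity> \<longrightarrow> lam > 0) \<and>
        is_stExp \<mu> lam c (J - ereal c) \<and> is_stExp \<nu> lam c (K - ereal c))
   \<or> \<comment> \<open>truncated (signed) geometric\<close>
     (\<exists>theta kappa c m. ereal c < J / 2 \<and> m > 0 \<and> kappa > 0 \<and>
        in_mZ m (ereal c) \<and> in_mZ_inf m J \<and> in_mZ_inf m K \<and>
        ( (in_mZ_inf m (J - 2 * ereal c) \<and> in_mZ_inf m (K - 2 * ereal c)
              \<and> 0 < theta \<and> theta < 1 \<and> kappa = 1)
        \<or> (in_mZ_inf (2 * m) (J - 2 * ereal c) \<and> in_mZ_inf (2 * m) (K - 2 * ereal c)
              \<and> 0 < theta \<and> theta < 1 \<and> kappa \<noteq> 1)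
        \<or> (in_mZ m (J - 2 * ereal c) \<and> in_mZ m (K - 2 * ereal c)
              \<and> theta \<ge> 1 \<and> kappa = 1)
        \<or> (in_mZ_inf (2 * m) (J - 2 * ereal c) \<and> in_mZ_inf (2 * m) (K - 2 * ereal c)
              \<and> theta \<ge> 1 \<and> kappa \<noteq> 1) ) \<and>
        is_sstbGeo \<mu> theta (c / m) ((J - ereal c) / ereal m) kappa m \<and>
        is_sstbGeo \<nu> theta (c / m) ((K - ereal c) / ereal m) kappa m)
   \<or> \<comment> \<open>J = K: m x m for any probability measure m\<close>
     (J = K \<and> prob_space \<mu> \<and> sets \<mu> = sets borel \<and> \<nu> = \<mu>)
   \<or> \<comment> \<open>J < K: m x m with m supported on (-infinity, J/2]\<close>
     (J < K \<and> prob_space \<mu> \<and> sets \<mu> = sets borel \<and> \<nu> = \<mu> \<and>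
        emeasure \<mu> {x. J / 2 < ereal x} = 0)
   \<or> \<comment> \<open>J < K: delta_{J/2} x m with m supported on [J/2, K - J/2]\<close>
     (J < K \<and> (\<exists>j. J = ereal j \<and> \<mu> = return borel (j / 2)) \<and>
        prob_space \<nu> \<and> sets \<nu> = sets borel \<and>
        emeasure \<nu> {x. \<not> (J / 2 \<le> ereal x \<and> ereal x \<le> K - J / 2)} = 0)
   \<or> \<comment> \<open>J < K < infinity: m x (m + (K - J)) with m supported on [J/2, infinity)\<close>
     (J < K \<and> K \<noteq> \<infinity> \<and> prob_space \<mu> \<and> sets \<mu> = sets borel \<and>
        emeasure \<mu> {x. ereal x < J / 2} = 0 \<and>
        \<nu> = distr \<mu> borel (\<lambda>x. x + real_of_ereal (K - J))))"

end

theory Submission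
  imports Defs
begin

text \<open>Write \<open>P = \<mu>\<^sup>\<int>\<close>. Moving the carrier past one site is a measure preserving map of \<open>\<nu> \<times> P\<close>, because
  the local map preserves \<open>\<mu> \<times> \<nu>\<close>. If carriers started far to the left coalesce almost surely, the limit
  yields a Burke property: the output of the dynamics to the left of a site is distributed as the input and
  independent of the carrier at that site, which has law \<open>\<nu>\<close>. Hence \<open>P\<close> is invariant, and the successive
  carriers at a fixed site are i.i.d. with law \<open>\<nu>\<close>. Read in the time direction, they drive the state of the
  next site by the dual map, in which \<open>J\<close> and \<open>K\<close> are exchanged. So if carriers of the dual
  map coalesce as well, resampling one coordinate of the configuration is forgotten at every site after a finite
  time. An invariant event is therefore insensitive to resampling any coordinate, which makes it independent of
  all cylinders and hence of itself.

  Coalescence follows from finite blocks of sites that erase the incoming carrier, except for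
  \<open>\<mu>\<close> with \<open>J < K = \<infinity>\<close>. In that case the drift \<open>2 x - J\<close> has an exponential moment below one, so its sums
  tend to \<open>-\<infinity>\<close>; there are many carriers, but every one except the limiting one is transported to a
  configuration without a carrier. This, applied forwards and, by reflection, backwards in time, gives the
  uniqueness of the family.\<close>

section \<open>Carriers on product measures\<close>

abbreviation iid :: "real measure \<Rightarrow> (int \<Rightarrow> real) measure" where
  "iid \<mu> \<equiv> PiM UNIV (\<lambda>_. \<mu>)"

lemma prob_space_iid: "prob_space \<mu> \<Longrightarrow> prob_space (iid \<mu>)"
  by (intro prob_space_PiM)

lemma sets_iid: "sets \<mu> = sets borel \<Longrightarrow> sets (iid \<mu>) = sets (iid borel)"
  by (intro sets_PiM_cong) auto

lemma space_iid: "sets \<mu> = sets borel \<Longrightarrow> space (iid \<mu>) = UNIV"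
  using sets_eq_imp_space_eq[of \<mu> borel] by (simp add: space_PiM PiE_def extensional_def)

lemma distr_pair_snd:
  assumes "prob_space M" "prob_space N"
  shows "distr (M \<Otimes>\<^sub>M N) N snd = N"
proof -
  interpret M: prob_space M by fact
  interpret N: prob_space N by fact
  show ?thesis
  proof (rule measure_eqI)
    fix A assume "A \<in> sets (distr (M \<Otimes>\<^sub>M N) N snd)"
    then have A: "A \<in> sets N" by simp
    have "snd -` A \<inter> space (M \<Otimes>\<^sub>M N) = space M \<times> A"
      using sets.sets_into_space[OF A] by (auto simp: space_pair_measure)
    then show "emeasure (distr (M \<Otimes>\<^sub>M N) N snd) A = emeasure N A"
      using A by (simp add: emeasure_distr N.emeasure_pair_measure_Times M.emeasure_space_1)
  qed simp
qed

lemma AE_pair_snd: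
  assumes "prob_space M" "prob_space N" "AE y in N. Q y"
  shows "AE z in M \<Otimes>\<^sub>M N. Q (snd z)"
  by (rule AE_distrD[of snd "M \<Otimes>\<^sub>M N" N Q], rule measurable_snd)
    (subst distr_pair_snd, use assms in auto)

lemma iid_eqI:
  fixes \<mu> :: "real measure"
  assumes "sets \<mu> = sets borel" "prob_space \<mu>"
    and Q: "sets Q = sets (iid \<mu>)" "finite_measure Q"
    and eq: "\<And>D J. finite J \<Longrightarrow> (\<And>j. j \<in> J \<Longrightarrow> D j \<in> sets borel) \<Longrightarrow>
      emeasure Q {x. \<forall>j\<in>J. x j \<in> D j} = c * (\<Prod>j\<in>J. emeasure \<mu> (D j))"
  shows "Q = scale_measure c (iid \<mu>)"
proof (rule measure_eqI_PiM_infinite[of _ UNIV "\<lambda>_. \<mu>"])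
  interpret prob_space \<mu> by fact
  interpret product_prob_space "\<lambda>_. \<mu>" "UNIV :: int set" by unfold_locales
  have sp: "space \<mu> = UNIV" using sets_eq_imp_space_eq[OF assms(1)] by simp
  fix D :: "int \<Rightarrow> real set" and J :: "int set"
  assume J: "finite J" and D: "\<And>i. i \<in> J \<Longrightarrow> D i \<in> sets \<mu>"
  have e: "prod_emb UNIV (\<lambda>_. \<mu>) J (Pi\<^sub>E J D) = {x. \<forall>j\<in>J. x j \<in> D j}"
    by (auto simp: prod_emb_def sp PiE_def Pi_def extensional_def)
  show "emeasure Q (prod_emb UNIV (\<lambda>_. \<mu>) J (Pi\<^sub>E J D)) =
      emeasure (scale_measure c (iid \<mu>)) (prod_emb UNIV (\<lambda>_. \<mu>) J (Pi\<^sub>E J D))"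
    unfolding emeasure_scale_measure
    by (subst emeasure_PiM_emb) (use J D eq[of J D] e assms(1) in auto)
qed (use Q in simp_all)

lemma emeasure_iid_cylinder:
  assumes "sets \<mu> = sets borel" "prob_space \<mu>" "finite J" "\<And>j. j \<in> J \<Longrightarrow> D j \<in> sets borel"
  shows "emeasure (iid \<mu>) {x. \<forall>j\<in>J. x j \<in> D j} = (\<Prod>j\<in>J. emeasure \<mu> (D j))"
proof -
  interpret prob_space \<mu> by fact
  interpret product_prob_space "\<lambda>_. \<mu>" "UNIV :: int set" by unfold_locales
  have sp: "space \<mu> = UNIV" using sets_eq_imp_space_eq[OF assms(1)] by simp
  have e: "prod_emb UNIV (\<lambda>_. \<mu>) J (Pi\<^sub>E J D) = {x. \<forall>j\<in>J. x j \<in> D j}"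
    by (auto simp: prod_emb_def sp PiE_def Pi_def extensional_def)
  show ?thesis
    by (subst e[symmetric], subst emeasure_PiM_emb) (use assms in auto)
qed

lemma measurable_fun_upd_UNIV:
  fixes f :: "'a \<Rightarrow> real" and g :: "'a \<Rightarrow> int \<Rightarrow> real"
  assumes [measurable]: "f \<in> borel_measurable M" "g \<in> M \<rightarrow>\<^sub>M iid borel"
  shows "(\<lambda>x. (g x)(p := f x)) \<in> M \<rightarrow>\<^sub>M iid borel"
  by (rule measurable_fun_upd[where J = UNIV]) auto

primrec run :: "(real \<times> real \<Rightarrow> real \<times> real) \<Rightarrow> nat \<Rightarrow> (int \<Rightarrow> real) \<Rightarrow> int \<Rightarrow> real \<Rightarrow> real" where
  "run F 0 x n w = w"
| "run F (Suc k) x n w = snd (F (x n, run F k x (n - 1) w))"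

text \<open>Meaningful only where the sequence converges, e.g. on configurations that satisfy \<open>coalesces\<close> below;
  there the starting value \<open>0\<close> is irrelevant.\<close>
definition carrier_lim :: "(real \<times> real \<Rightarrow> real \<times> real) \<Rightarrow> (int \<Rightarrow> real) \<Rightarrow> int \<Rightarrow> real" where
  "carrier_lim F x n = lim (\<lambda>k. run F k x n 0)"

definition evolve :: "(real \<times> real \<Rightarrow> real \<times> real) \<Rightarrow> (int \<Rightarrow> real) \<Rightarrow> int \<Rightarrow> real" where
  "evolve F x n = fst (F (x n, carrier_lim F x (n - 1)))"

definition coalesces :: "(real \<times> real \<Rightarrow> real \<times> real) \<Rightarrow> (int \<Rightarrow> real) \<Rightarrow> bool" where
  "coalesces F x \<longleftrightarrow> (\<forall>n w. \<forall>\<^sub>F k in sequentially. run F k x n w = carrier_lim F x n)"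

definition site_update ::
    "(real \<times> real \<Rightarrow> real \<times> real) \<Rightarrow> int \<Rightarrow> real \<times> (int \<Rightarrow> real) \<Rightarrow> real \<times> (int \<Rightarrow> real)" where
  "site_update F p = (\<lambda>(w, x). (snd (F (x p, w)), x(p := fst (F (x p, w)))))"

primrec sweep ::
    "(real \<times> real \<Rightarrow> real \<times> real) \<Rightarrow> nat \<Rightarrow> int \<Rightarrow> real \<times> (int \<Rightarrow> real) \<Rightarrow> real \<times> (int \<Rightarrow> real)" where
  "sweep F 0 n z = z"
| "sweep F (Suc k) n z = site_update F n (sweep F k (n - 1) z)"

lemma run_cong: "(\<And>j. j \<le> n \<Longrightarrow> x j = y j) \<Longrightarrow> run F k x n w = run F k y n w"
  by (induction k arbitrary: n) auto

lemma carrier_lim_cong: "(\<And>j. j \<le> n \<Longrightarrow> x j = y j) \<Longrightarrow> carrier_lim F x n = carrier_lim F y n"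
  unfolding carrier_lim_def using run_cong[of n x y F] by simp

lemma evolve_cong: "(\<And>j. j \<le> n \<Longrightarrow> x j = y j) \<Longrightarrow> evolve F x n = evolve F y n"
  unfolding evolve_def using carrier_lim_cong[of "n-1" x y F] by simp

lemma sweep_outside: "j > n \<or> j \<le> n - int k \<Longrightarrow> snd (sweep F k n (w, x)) j = x j"
  by (induction k arbitrary: n) (auto simp: site_update_def split_beta)

lemma fst_sweep: "fst (sweep F k n (w, x)) = run F k x n w"
  by (induction k arbitrary: n) (auto simp: site_update_def split_beta sweep_outside)

lemma snd_sweep:
  "i < k \<Longrightarrow> snd (sweep F k n (w, x)) (n - int i) =
    fst (F (x (n - int i), run F (k - 1 - i) x (n - int i - 1) w))"
proof (induction k arbitrary: n i)
  case (Suc k)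
  show ?case
  proof (cases i)
    case 0
    then show ?thesis by (simp add: site_update_def split_beta sweep_outside fst_sweep)
  next
    case (Suc i')
    then have "n - int i = n - 1 - int i'" by simp
    then show ?thesis using Suc.IH[of i' "n - 1"] Suc.prems Suc
      by (simp add: site_update_def split_beta algebra_simps)
  qed
qed simp

lemma carrier_lim_step:
  assumes "coalesces F x"
  shows "carrier_lim F x n = snd (F (x n, carrier_lim F x (n - 1)))"
proof -
  have "\<forall>\<^sub>F k in sequentially. run F k x (n - 1) 0 = carrier_lim F x (n - 1)"
    using assms by (simp add: coalesces_def)
  moreover have "\<forall>\<^sub>F k in sequentially. run F (Suc k) x n 0 = carrier_lim F x n"
    using assms by (subst eventually_sequentially_Suc) (simp add: coalesces_def)
  ultimately have "\<forall>\<^sub>F k in sequentially. carrier_lim F x n = snd (F (x n, carrier_lim F x (n - 1)))"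
    by eventually_elim auto
  then show ?thesis by simp
qed

lemma measurable_run[measurable]:
  assumes [measurable]: "F \<in> borel \<Otimes>\<^sub>M borel \<rightarrow>\<^sub>M borel \<Otimes>\<^sub>M borel"
  shows "(\<lambda>x. run F k x n w) \<in> borel_measurable (iid borel)"
  by (induction k arbitrary: n) simp_all

lemma measurable_carrier_lim[measurable]:
  assumes [measurable]: "F \<in> borel \<Otimes>\<^sub>M borel \<rightarrow>\<^sub>M borel \<Otimes>\<^sub>M borel"
  shows "(\<lambda>x. carrier_lim F x n) \<in> borel_measurable (iid borel)"
  unfolding carrier_lim_def by measurable

lemma measurable_evolve[measurable]:
  assumes [measurable]: "F \<in> borel \<Otimes>\<^sub>M borel \<rightarrow>\<^sub>M borel \<Otimes>\<^sub>M borel"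
  shows "evolve F \<in> iid borel \<rightarrow>\<^sub>M iid borel"
proof (rule measurable_PiM_single')
  show "\<And>i. (\<lambda>x. evolve F x i) \<in> borel_measurable (iid borel)"
    unfolding evolve_def by measurable
qed auto

lemma measurable_site_update[measurable]:
  assumes [measurable]: "F \<in> borel \<Otimes>\<^sub>M borel \<rightarrow>\<^sub>M borel \<Otimes>\<^sub>M borel"
  shows "site_update F p \<in> borel \<Otimes>\<^sub>M iid borel \<rightarrow>\<^sub>M borel \<Otimes>\<^sub>M iid borel"
  unfolding site_update_def split_beta'
  by (intro measurable_Pair measurable_fun_upd_UNIV) measurable

lemma measurable_sweep[measurable]:
  assumes [measurable]: "F \<in> borel \<Otimes>\<^sub>M borel \<rightarrow>\<^sub>M borel \<Otimes>\<^sub>M borel"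
  shows "sweep F k n \<in> borel \<Otimes>\<^sub>M iid borel \<rightarrow>\<^sub>M borel \<Otimes>\<^sub>M iid borel"
proof (induction k arbitrary: n)
  case 0
  then show ?case by (simp add: sweep.simps(1)[abs_def])
next
  case (Suc k)
  note [measurable] = Suc
  show ?case by (simp add: sweep.simps(2)[abs_def])
qed

locale exchange =
  fixes F :: "real \<times> real \<Rightarrow> real \<times> real" and \<mu> \<nu> :: "real measure"
  assumes prob: "prob_space \<mu>" "prob_space \<nu>"
    and sets_eq[measurable_cong]: "sets \<mu> = sets borel" "sets \<nu> = sets borel"
    and F_meas[measurable]: "F \<in> borel \<Otimes>\<^sub>M borel \<rightarrow>\<^sub>M borel \<Otimes>\<^sub>M borel"
    and preserves: "distr (\<mu> \<Otimes>\<^sub>M \<nu>) (borel \<Otimes>\<^sub>M borel) F = \<mu> \<Otimes>\<^sub>M \<nu>"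
begin

lemma sets_iids[measurable_cong]:
  "sets (iid \<mu>) = sets (iid borel)" "sets (iid \<nu>) = sets (iid borel)"
  by (fact sets_iid[OF sets_eq(1)] sets_iid[OF sets_eq(2)])+

lemma space_iids[simp]: "space (iid \<mu>) = UNIV" "space (iid \<nu>) = UNIV" "space \<mu> = UNIV" "space \<nu> = UNIV"
  using sets_eq[THEN space_iid] sets_eq[THEN sets_eq_imp_space_eq] by simp_all

sublocale mu: prob_space \<mu> by (fact prob)
sublocale nu: prob_space \<nu> by (fact prob)
sublocale P: prob_space "iid \<mu>" by (intro prob_space_iid prob)
sublocale nuP: pair_prob_space \<nu> "iid \<mu>" ..

lemma resample_preserves: "distr (\<mu> \<Otimes>\<^sub>M iid \<mu>) (iid \<mu>) (\<lambda>(a, x). x(p := a)) = iid \<mu>"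
  using distr_pair_PiM_eq_PiM[of "UNIV" "\<lambda>_. \<mu>" p] prob(1) by simp

lemma site_update_preserves:
  "distr (\<nu> \<Otimes>\<^sub>M iid \<mu>) (\<nu> \<Otimes>\<^sub>M iid \<mu>) (site_update F p) = \<nu> \<Otimes>\<^sub>M iid \<mu>"
proof (rule measure_eqI)
  interpret munu: pair_prob_space \<mu> \<nu> ..
  interpret MR: pair_prob_space "\<mu> \<Otimes>\<^sub>M \<nu>" "iid \<mu>" ..
  have fub: "(\<integral>\<^sup>+z. g z \<partial>(\<nu> \<Otimes>\<^sub>M iid \<mu>)) =
      (\<integral>\<^sup>+x. (\<integral>\<^sup>+q. g (snd q, x(p := fst q)) \<partial>(\<mu> \<Otimes>\<^sub>M \<nu>)) \<partial>iid \<mu>)"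
    if [measurable]: "g \<in> borel_measurable (borel \<Otimes>\<^sub>M iid borel)" for g :: "real \<times> (int \<Rightarrow> real) \<Rightarrow> ennreal"
  proof -
    have [measurable]: "(\<lambda>z. g (fst z, (snd (snd z)) (p := fst (snd z)))) \<in>
        borel_measurable (borel \<Otimes>\<^sub>M (borel \<Otimes>\<^sub>M iid borel))"
      "(\<lambda>z. g (snd (fst z), (snd z) (p := fst (fst z)))) \<in>
        borel_measurable ((borel \<Otimes>\<^sub>M borel) \<Otimes>\<^sub>M iid borel)"
      "(\<lambda>z. (snd z) (p := fst z)) \<in> borel \<Otimes>\<^sub>M iid borel \<rightarrow>\<^sub>M iid borel"
      by (intro measurable_compose[OF _ that] measurable_Pair measurable_fun_upd_UNIV; measurable)+
    have [measurable]: "(\<lambda>q. g (w, (snd q) (p := fst q))) \<in> borel_measurable (borel \<Otimes>\<^sub>M iid borel)" for w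
      by (intro measurable_compose[OF _ that] measurable_Pair measurable_fun_upd_UNIV; measurable)
    have "(\<integral>\<^sup>+z. g z \<partial>(\<nu> \<Otimes>\<^sub>M iid \<mu>)) = (\<integral>\<^sup>+w. \<integral>\<^sup>+x. g (w, x) \<partial>iid \<mu> \<partial>\<nu>)"
      by (subst P.nn_integral_fst[symmetric]) auto
    also have "\<dots> = (\<integral>\<^sup>+w. \<integral>\<^sup>+q. g (w, (snd q)(p := fst q)) \<partial>(\<mu> \<Otimes>\<^sub>M iid \<mu>) \<partial>\<nu>)"
      by (subst resample_preserves[symmetric, of p], subst nn_integral_distr) (auto simp: split_beta')
    also have "\<dots> = (\<integral>\<^sup>+w. \<integral>\<^sup>+a. \<integral>\<^sup>+x. g (w, x(p := a)) \<partial>iid \<mu> \<partial>\<mu> \<partial>\<nu>)"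
      by (subst P.nn_integral_fst[symmetric]) auto
    also have "\<dots> = (\<integral>\<^sup>+q. \<integral>\<^sup>+x. g (snd q, x(p := fst q)) \<partial>iid \<mu> \<partial>(\<mu> \<Otimes>\<^sub>M \<nu>))"
      by (subst munu.nn_integral_snd[symmetric]) (auto simp: split_beta')
    also have "\<dots> = (\<integral>\<^sup>+x. \<integral>\<^sup>+q. g (snd q, x(p := fst q)) \<partial>(\<mu> \<Otimes>\<^sub>M \<nu>) \<partial>iid \<mu>)"
      by (rule MR.Fubini'[symmetric]) (auto simp: split_beta')
    finally show ?thesis .
  qed
  fix A assume A': "A \<in> sets (distr (\<nu> \<Otimes>\<^sub>M iid \<mu>) (\<nu> \<Otimes>\<^sub>M iid \<mu>) (site_update F p))"
  then have A[measurable]: "A \<in> sets (borel \<Otimes>\<^sub>M iid borel)"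
    by (simp cong: sets_pair_measure_cong add: sets_eq sets_iids)
  have "emeasure (distr (\<nu> \<Otimes>\<^sub>M iid \<mu>) (\<nu> \<Otimes>\<^sub>M iid \<mu>) (site_update F p)) A
      = (\<integral>\<^sup>+z. indicator A (site_update F p z) \<partial>(\<nu> \<Otimes>\<^sub>M iid \<mu>))"
    using A' by (subst nn_integral_indicator[symmetric], simp, subst nn_integral_distr) auto
  also have "\<dots> = (\<integral>\<^sup>+x. (\<integral>\<^sup>+q. indicator A (site_update F p (snd q, x(p := fst q))) \<partial>(\<mu> \<Otimes>\<^sub>M \<nu>)) \<partial>iid \<mu>)"
    by (rule fub) measurable
  also have "\<dots> = (\<integral>\<^sup>+x. (\<integral>\<^sup>+q. indicator A (snd (F q), x(p := fst (F q))) \<partial>(\<mu> \<Otimes>\<^sub>M \<nu>)) \<partial>iid \<mu>)"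
    by (simp add: site_update_def)
  also have "\<dots> = (\<integral>\<^sup>+x. (\<integral>\<^sup>+q. indicator A (snd q, x(p := fst q)) \<partial>distr (\<mu> \<Otimes>\<^sub>M \<nu>) (borel \<Otimes>\<^sub>M borel) F) \<partial>iid \<mu>)"
  proof (rule nn_integral_cong)
    fix x :: "int \<Rightarrow> real"
    have "(\<lambda>q. (snd q, x(p := fst q))) \<in> borel \<Otimes>\<^sub>M borel \<rightarrow>\<^sub>M borel \<Otimes>\<^sub>M iid borel"
      by (intro measurable_Pair measurable_PiM_single') auto
    then have [measurable]: "(\<lambda>q. indicator A (snd q, x(p := fst q)) :: ennreal) \<in> borel_measurable (borel \<Otimes>\<^sub>M borel)"
      by (rule measurable_compose) measurable
    show "(\<integral>\<^sup>+q. indicator A (snd (F q), x(p := fst (F q))) \<partial>(\<mu> \<Otimes>\<^sub>M \<nu>)) =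
        (\<integral>\<^sup>+q. indicator A (snd q, x(p := fst q)) \<partial>distr (\<mu> \<Otimes>\<^sub>M \<nu>) (borel \<Otimes>\<^sub>M borel) F)"
      by (subst nn_integral_distr) auto
  qed
  also have "\<dots> = (\<integral>\<^sup>+z. indicator A z \<partial>(\<nu> \<Otimes>\<^sub>M iid \<mu>))"
    unfolding preserves by (rule fub[symmetric]) measurable
  also have "\<dots> = emeasure (\<nu> \<Otimes>\<^sub>M iid \<mu>) A"
    using A' by (intro nn_integral_indicator) simp
  finally show "emeasure (distr (\<nu> \<Otimes>\<^sub>M iid \<mu>) (\<nu> \<Otimes>\<^sub>M iid \<mu>) (site_update F p)) A = emeasure (\<nu> \<Otimes>\<^sub>M iid \<mu>) A" .
qed simp

lemma sweep_preserves: "distr (\<nu> \<Otimes>\<^sub>M iid \<mu>) (\<nu> \<Otimes>\<^sub>M iid \<mu>) (sweep F k n) = \<nu> \<Otimes>\<^sub>M iid \<mu>"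
proof (induction k arbitrary: n)
  case 0
  then show ?case by (simp add: distr_id2 sweep.simps(1)[abs_def])
next
  case (Suc k)
  have "distr (distr (\<nu> \<Otimes>\<^sub>M iid \<mu>) (\<nu> \<Otimes>\<^sub>M iid \<mu>) (sweep F k (n - 1))) (\<nu> \<Otimes>\<^sub>M iid \<mu>) (site_update F n) =
      distr (\<nu> \<Otimes>\<^sub>M iid \<mu>) (\<nu> \<Otimes>\<^sub>M iid \<mu>) (site_update F n \<circ> sweep F k (n - 1))"
    by (rule distr_distr) measurable
  also have "site_update F n \<circ> sweep F k (n - 1) = sweep F (Suc k) n"
    by (simp add: fun_eq_iff)
  finally show ?case unfolding Suc site_update_preserves by (rule sym)
qed

end

section \<open>The Burke property\<close>

lemma tendsto_emeasure_of_eventually_eq: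
  assumes "finite_measure M" and [measurable]: "\<And>k. A k \<in> sets M" "B \<in> sets M"
    and ev: "AE z in M. \<forall>\<^sub>F k in sequentially. z \<in> A k \<longleftrightarrow> z \<in> B"
  shows "(\<lambda>k::nat. emeasure M (A k)) \<longlonglongrightarrow> emeasure M B"
proof -
  interpret finite_measure M by fact
  have "(\<lambda>k. \<integral>\<^sup>+z. indicator (A k) z \<partial>M) \<longlonglongrightarrow> (\<integral>\<^sup>+z. indicator B z \<partial>M)"
  proof (rule nn_integral_dominated_convergence[where w = "\<lambda>_. 1"])
    show "AE z in M. (\<lambda>k. indicator (A k) z :: ennreal) \<longlonglongrightarrow> indicator B z"
      using ev
    proof eventually_elim
      case (elim z)
      then show ?case
        by (intro tendsto_eventually) (auto elim!: eventually_mono simp: indicator_def)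
    qed
  qed (auto simp: indicator_def emeasure_eq_measure intro!: AE_I2)
  then show ?thesis by simp
qed

lemma iid_reindex:
  assumes "prob_space \<mu>" "sets \<mu> = sets borel" "inj f"
  shows "distr (iid \<mu>) (iid \<mu>) (\<lambda>x j. x (f j)) = iid \<mu>"
  using distr_PiM_reindex[of UNIV "\<lambda>_. \<mu>" f UNIV] assms by (simp add: restrict_UNIV)

lemma space_iid_borel[simp]: "space (iid borel) = UNIV"
  by (simp add: space_PiM)

lemma sets_cylinder:
  assumes "finite J" "\<And>j. j \<in> J \<Longrightarrow> D j \<in> sets borel"
  shows "{x. \<forall>j\<in>J. x j \<in> D j} \<in> sets (iid borel)"
proof -
  have "{x \<in> space (iid borel). x j \<in> D j} \<in> sets (iid borel)" if "j \<in> J" for j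
    using assms(2)[OF that] by measurable
  from sets.sets_Collect_finite_All'[OF this assms(1)] show ?thesis
    using sets.top[of "iid borel"] by (cases "J = {}") simp_all
qed

lemma run_cong_range:
  "(\<And>j. j \<le> n \<Longrightarrow> n - int k < j \<Longrightarrow> x j = y j) \<Longrightarrow> run F k x n w = run F k y n w"
proof (induction k arbitrary: n)
  case (Suc k)
  have "run F k x (n - 1) w = run F k y (n - 1) w"
    by (rule Suc.IH) (use Suc.prems in auto)
  then show ?case using Suc.prems[of n] by simp
qed simp

lemma run_reindex: "run F k (\<lambda>j. x (j + c)) n w = run F k x (n + c) w"
  by (induction k arbitrary: n) (auto simp: algebra_simps)

lemma eventually_sweep:
  assumes "coalesces F x" "finite J"
  shows "\<forall>\<^sub>F k in sequentially. fst (sweep F k n (w, x)) = carrier_lim F x n \<and>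
    (\<forall>j\<in>J. snd (sweep F k n (w, x)) j = (if j \<le> n then evolve F x j else x j))"
proof (intro eventually_conj eventually_ball_finite ballI)
  show "\<forall>\<^sub>F k in sequentially. fst (sweep F k n (w, x)) = carrier_lim F x n"
    using assms(1) by (simp add: fst_sweep coalesces_def)
  fix j assume "j \<in> J"
  show "\<forall>\<^sub>F k in sequentially. snd (sweep F k n (w, x)) j = (if j \<le> n then evolve F x j else x j)"
  proof (cases "j \<le> n")
    case False
    then show ?thesis by (simp add: sweep_outside)
  next
    case True
    define i where "i = nat (n - j)"
    have j: "j = n - int i" using True by (simp add: i_def)
    obtain N where N: "\<And>k. k \<ge> N \<Longrightarrow> run F k x (j - 1) w = carrier_lim F x (j - 1)"
      using assms(1) unfolding coalesces_def eventually_sequentially by blast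
    have "snd (sweep F k n (w, x)) j = evolve F x j" if "k \<ge> N + i + 1" for k
    proof -
      have "run F (k - 1 - i) x (j - 1) w = carrier_lim F x (j - 1)" by (rule N) (use that in simp)
      then show ?thesis
        using snd_sweep[of i k F n w x] that unfolding j[symmetric] evolve_def by simp
    qed
    then show ?thesis using True unfolding eventually_sequentially by auto
  qed
qed (fact assms)

definition carrier_column :: "(real \<times> real \<Rightarrow> real \<times> real) \<Rightarrow> int \<Rightarrow> (int \<Rightarrow> real) \<Rightarrow> int \<Rightarrow> real" where
  "carrier_column F n x t = carrier_lim F ((evolve F ^^ nat t) x) n"

definition dual :: "(real \<times> real \<Rightarrow> real \<times> real) \<Rightarrow> real \<times> real \<Rightarrow> real \<times> real" where
  "dual F = (\<lambda>(u, x). prod.swap (F (x, u)))"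

definition forward_coalesces :: "(real \<times> real \<Rightarrow> real \<times> real) \<Rightarrow> (int \<Rightarrow> real) \<Rightarrow> bool" where
  "forward_coalesces G z \<longleftrightarrow> (\<forall>s M :: nat. \<exists>k.
     run G k z (int s + int k - 1) (- real M) = run G k z (int s + int k - 1) (real M))"

definition carrier_monotone :: "(real \<times> real \<Rightarrow> real \<times> real) \<Rightarrow> bool" where
  "carrier_monotone F \<longleftrightarrow>
     (\<forall>x. mono (\<lambda>w. snd (F (x, w)))) \<or> (\<forall>x. antimono (\<lambda>w. snd (F (x, w))))"

lemma run_mono_or_antimono:
  assumes "carrier_monotone F"
  shows "mono (run F k x n) \<or> antimono (run F k x n)"
proof (induction k arbitrary: n)
  case 0
  then show ?case by (simp add: mono_def)
next
  case (Suc k)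
  show ?case
    using assms Suc.IH[of "n - 1"] unfolding carrier_monotone_def mono_def antimono_def run.simps by metis
qed

lemma run_eq_between:
  assumes "carrier_monotone F" "run F k x n a = run F k x n b" "a \<le> w" "w \<le> b"
  shows "run F k x n w = run F k x n b"
  using run_mono_or_antimono[OF assms(1), of k x n]
proof
  assume "mono (run F k x n)"
  from monoD[OF this assms(3)] monoD[OF this assms(4)] assms(2) show ?thesis by simp
next
  assume "antimono (run F k x n)"
  from antimonoD[OF this assms(3)] antimonoD[OF this assms(4)] assms(2) show ?thesis by simp
qed

lemma evolve_iterate_eq_run:
  "(evolve F ^^ (s + k)) x n =
     run (dual F) k (carrier_column F (n - 1) x) (int s + int k - 1) ((evolve F ^^ s) x n)"
proof (induction k)
  case (Suc k)
  have "(evolve F ^^ (s + Suc k)) x n =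
      fst (F ((evolve F ^^ (s + k)) x n, carrier_lim F ((evolve F ^^ (s + k)) x) (n - 1)))"
    by (simp add: evolve_def)
  also have "carrier_lim F ((evolve F ^^ (s + k)) x) (n - 1) = carrier_column F (n - 1) x (int s + int k)"
    by (simp add: carrier_column_def nat_add_distrib)
  finally show ?case by (simp add: Suc.IH dual_def)
qed simp

lemma iterate_evolve_cong:
  "(\<And>j. j \<le> n \<Longrightarrow> x j = y j) \<Longrightarrow> j \<le> n \<Longrightarrow> (evolve F ^^ t) x j = (evolve F ^^ t) y j"
proof (induction t arbitrary: j)
  case (Suc t)
  have "(evolve F ^^ t) x i = (evolve F ^^ t) y i" if "i \<le> j" for i
    using Suc.IH[OF Suc.prems(1), of i] Suc.prems(2) that by linarith
  then show ?case using evolve_cong[of j "(evolve F ^^ t) x" "(evolve F ^^ t) y" F] by simp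
qed simp

lemma carrier_column_cong: "(\<And>j. j \<le> n \<Longrightarrow> x j = y j) \<Longrightarrow> carrier_column F n x t = carrier_column F n y t"
  unfolding carrier_column_def by (intro carrier_lim_cong iterate_evolve_cong[of n]) auto

lemma carrier_column_Suc:
  "carrier_column F n x (int (Suc i)) = carrier_column F n (evolve F x) (int i)"
  unfolding carrier_column_def nat_int funpow_Suc_right comp_apply ..

lemma measurable_iterate_evolve[measurable]:
  assumes [measurable]: "F \<in> borel \<Otimes>\<^sub>M borel \<rightarrow>\<^sub>M borel \<Otimes>\<^sub>M borel"
  shows "(evolve F ^^ t) \<in> iid borel \<rightarrow>\<^sub>M iid borel"
proof (induction t)
  case (Suc t)
  then show ?case
    unfolding funpow.simps by (rule measurable_comp[OF _ measurable_evolve[OF assms]])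
qed simp

lemma measurable_column[measurable]:
  assumes [measurable]: "F \<in> borel \<Otimes>\<^sub>M borel \<rightarrow>\<^sub>M borel \<Otimes>\<^sub>M borel"
  shows "(\<lambda>x. carrier_column F n x t) \<in> borel_measurable (iid borel)"
  unfolding carrier_column_def
  by (rule measurable_compose[OF measurable_iterate_evolve measurable_carrier_lim]; fact)

context exchange
begin

context
  assumes coal: "AE x in iid \<mu>. coalesces F x"
begin

lemma emeasure_partial_evolve:
  assumes [measurable]: "B \<in> sets borel" and J: "finite J" and D: "\<And>j. j \<in> J \<Longrightarrow> D j \<in> sets borel"
  shows "emeasure (iid \<mu>) {x. carrier_lim F x n \<in> B \<and> (\<forall>j\<in>J. (if j \<le> n then evolve F x j else x j) \<in> D j)}
    = emeasure \<nu> B * (\<Prod>j\<in>J. emeasure \<mu> (D j))" (is "emeasure _ ?S = ?c")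
proof -
  define C where "C = {x :: int \<Rightarrow> real. \<forall>j\<in>J. x j \<in> D j}"
  have C[measurable]: "C \<in> sets (iid borel)"
    unfolding C_def by (rule sets_cylinder[OF J D])
  have S: "?S = {x. carrier_lim F x n \<in> B \<and> (\<lambda>j. if j \<le> n then evolve F x j else x j) \<in> C}"
    by (auto simp: C_def)
  have [measurable]: "(\<lambda>x j. if j \<le> n then evolve F x j else x j) \<in> iid borel \<rightarrow>\<^sub>M iid borel"
  proof (rule measurable_PiM_single')
    fix i
    have [measurable]: "(\<lambda>x. evolve F x i) \<in> borel_measurable (iid borel)"
      by (rule measurable_compose[OF measurable_evolve[OF F_meas] measurable_component_singleton]) simp
    show "(\<lambda>x. if i \<le> n then evolve F x i else x i) \<in> borel_measurable (iid borel)"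
      by measurable
  qed auto
  have Sm: "?S \<in> sets (iid borel)"
  proof -
    have "{x \<in> space (iid borel). carrier_lim F x n \<in> B \<and> (\<lambda>j. if j \<le> n then evolve F x j else x j) \<in> C} \<in> sets (iid borel)"
      by measurable
    then show ?thesis unfolding S by simp
  qed
  let ?N = "\<nu> \<Otimes>\<^sub>M iid \<mu>"
  let ?A = "\<lambda>k. sweep F k n -` (B \<times> C) \<inter> space ?N"
  have spN: "space ?N = UNIV" by (simp add: space_pair_measure)
  have BC: "B \<times> C \<in> sets ?N"
    by (intro pair_measureI) (simp_all add: sets_eq sets_iids)
  have A: "emeasure ?N (?A k) = ?c" for k
  proof -
    have "emeasure ?N (?A k) = emeasure (distr ?N ?N (sweep F k n)) (B \<times> C)"
      using BC by (subst emeasure_distr) auto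
    also have "\<dots> = emeasure \<nu> B * emeasure (iid \<mu>) C"
      unfolding sweep_preserves by (rule P.emeasure_pair_measure_Times) (simp_all add: sets_eq sets_iids)
    finally show ?thesis
      unfolding C_def by (simp add: emeasure_iid_cylinder[OF sets_eq(1) prob(1) J D])
  qed
  have "(\<lambda>k. emeasure ?N (?A k)) \<longlonglongrightarrow> emeasure ?N (UNIV \<times> ?S)"
  proof (rule tendsto_emeasure_of_eventually_eq)
    show "finite_measure ?N" by unfold_locales
    show "?A k \<in> sets ?N" for k using BC by (intro measurable_sets[of _ ?N ?N]) auto
    show "UNIV \<times> ?S \<in> sets ?N" using Sm by (intro pair_measureI) (auto simp: sets_eq sets_iids)
    show "AE z in ?N. \<forall>\<^sub>F k in sequentially. z \<in> ?A k \<longleftrightarrow> z \<in> UNIV \<times> ?S"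
      using AE_pair_snd[OF prob(2) P.prob_space_axioms coal]
    proof eventually_elim
      case (elim z)
      from eventually_sweep[OF this J, of n "fst z"] show ?case
        by eventually_elim (cases z, auto simp: spN mem_Times_iff C_def)
    qed
  qed
  then have "emeasure ?N (UNIV \<times> ?S) = ?c" unfolding A by (rule LIMSEQ_unique[OF _ tendsto_const])
  moreover have "emeasure ?N (UNIV \<times> ?S) = emeasure (iid \<mu>) ?S"
    using nu.emeasure_space_1 Sm by (subst P.emeasure_pair_measure_Times) (auto simp: sets_eq sets_iids)
  ultimately show ?thesis by simp
qed

lemma evolve_preserves: "distr (iid \<mu>) (iid \<mu>) (evolve F) = iid \<mu>"
proof -
  have "distr (iid \<mu>) (iid \<mu>) (evolve F) = scale_measure 1 (iid \<mu>)"
  proof (rule iid_eqI)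
    show "finite_measure (distr (iid \<mu>) (iid \<mu>) (evolve F))"
      by (intro prob_space.finite_measure P.prob_space_distr) simp
    fix D :: "int \<Rightarrow> real set" and J :: "int set" assume J: "finite J" and D: "\<And>j. j \<in> J \<Longrightarrow> D j \<in> sets borel"
    obtain n where n: "\<And>j. j \<in> J \<Longrightarrow> j \<le> n" using bdd_above_finite[OF J] by (auto simp: bdd_above_def)
    from sets_cylinder[OF J D] have "emeasure (distr (iid \<mu>) (iid \<mu>) (evolve F)) {x. \<forall>j\<in>J. x j \<in> D j} =
        emeasure (iid \<mu>) {x. \<forall>j\<in>J. evolve F x j \<in> D j}"
      by (subst emeasure_distr) (simp_all add: sets_iids vimage_def)
    also have "{x. \<forall>j\<in>J. evolve F x j \<in> D j} =
        {x. carrier_lim F x n \<in> UNIV \<and> (\<forall>j\<in>J. (if j \<le> n then evolve F x j else x j) \<in> D j)}"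
      using n by auto
    also have "emeasure (iid \<mu>) \<dots> = 1 * (\<Prod>j\<in>J. emeasure \<mu> (D j))"
      using nu.emeasure_space_1 by (subst emeasure_partial_evolve[OF _ J D]) auto
    finally show "emeasure (distr (iid \<mu>) (iid \<mu>) (evolve F)) {x. \<forall>j\<in>J. x j \<in> D j} =
        1 * (\<Prod>j\<in>J. emeasure \<mu> (D j))" .
  qed (simp_all add: sets_eq prob)
  then show ?thesis by simp
qed

lemma burke:
  assumes [measurable]: "B \<in> sets borel" "C \<in> sets (iid borel)"
    and C: "\<And>x y. (\<And>j. j \<le> n \<Longrightarrow> x j = y j) \<Longrightarrow> x \<in> C \<Longrightarrow> y \<in> C"
  shows "emeasure (iid \<mu>) {x. carrier_lim F x n \<in> B \<and> evolve F x \<in> C} = emeasure \<nu> B * emeasure (iid \<mu>) C"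
proof -
  define U where "U = {x. carrier_lim F x n \<in> B}"
  define \<phi> where "\<phi> = (\<lambda>x j. if j \<le> n then evolve F x j else x j)"
  have [measurable]: "\<phi> \<in> iid borel \<rightarrow>\<^sub>M iid borel"
    unfolding \<phi>_def
  proof (rule measurable_PiM_single')
    fix i
    have [measurable]: "(\<lambda>x. evolve F x i) \<in> borel_measurable (iid borel)"
      by (rule measurable_compose[OF measurable_evolve[OF F_meas] measurable_component_singleton]) simp
    show "(\<lambda>x. if i \<le> n then evolve F x i else x i) \<in> borel_measurable (iid borel)"
      by measurable
  qed auto
  have [measurable]: "U \<in> sets (iid borel)"
  proof -
    have "{x \<in> space (iid borel). carrier_lim F x n \<in> B} \<in> sets (iid borel)" by measurable
    then show ?thesis by (simp add: U_def)
  qed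
  let ?Q = "distr (density (iid \<mu>) (indicator U)) (iid \<mu>) \<phi>"
  have Q: "emeasure ?Q A = emeasure (iid \<mu>) {x. x \<in> U \<and> \<phi> x \<in> A}" if [measurable]: "A \<in> sets (iid borel)" for A
  proof -
    have [measurable]: "\<phi> -` A \<in> sets (iid borel)"
      using measurable_sets[of \<phi> "iid borel" "iid borel" A] by (simp add: space_PiM)
    have "emeasure ?Q A = emeasure (density (iid \<mu>) (indicator U)) (\<phi> -` A)"
      by (subst emeasure_distr) (auto simp: sets_iids)
    also have "\<dots> = (\<integral>\<^sup>+x. indicator U x * indicator (\<phi> -` A) x \<partial>iid \<mu>)"
      by (rule emeasure_density) measurable
    also have "\<dots> = (\<integral>\<^sup>+x. indicator (U \<inter> \<phi> -` A) x \<partial>iid \<mu>)"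
      by (simp add: indicator_inter_arith)
    also have "\<dots> = emeasure (iid \<mu>) (U \<inter> \<phi> -` A)"
      by (rule nn_integral_indicator) measurable
    also have "U \<inter> \<phi> -` A = {x. x \<in> U \<and> \<phi> x \<in> A}" by auto
    finally show ?thesis .
  qed
  have "?Q = scale_measure (emeasure \<nu> B) (iid \<mu>)"
  proof (rule iid_eqI)
    show "finite_measure ?Q"
    proof (rule finite_measureI)
      have "emeasure ?Q UNIV \<le> 1" using Q[of UNIV] sets.top[of "iid borel"] P.emeasure_le_1 by (simp add: P.emeasure_le_1)
      then show "emeasure ?Q (space ?Q) \<noteq> \<infinity>" by (auto simp: top_unique)
    qed
    fix D :: "int \<Rightarrow> real set" and J :: "int set" assume J: "finite J" and D: "\<And>j. j \<in> J \<Longrightarrow> D j \<in> sets borel"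
    have "{x. \<forall>j\<in>J. x j \<in> D j} \<in> sets (iid borel)"
      using J D by (rule sets_cylinder)
    then show "emeasure ?Q {x. \<forall>j\<in>J. x j \<in> D j} = emeasure \<nu> B * (\<Prod>j\<in>J. emeasure \<mu> (D j))"
      using emeasure_partial_evolve[OF assms(1) J, of D n] D by (subst Q) (simp_all add: U_def \<phi>_def)
  qed (simp_all add: sets_eq prob)
  then have "emeasure ?Q C = emeasure \<nu> B * emeasure (iid \<mu>) C" by simp
  moreover have "{x. x \<in> U \<and> \<phi> x \<in> C} = {x. carrier_lim F x n \<in> B \<and> evolve F x \<in> C}"
  proof -
    have "\<phi> x \<in> C \<longleftrightarrow> evolve F x \<in> C" for x
      using C[of "\<phi> x" "evolve F x"] C[of "evolve F x" "\<phi> x"] by (auto simp: \<phi>_def)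
    then show ?thesis by (simp add: U_def)
  qed
  ultimately show ?thesis by (simp add: Q)
qed

lemma carrier_column_iid:
  fixes k :: nat
  assumes "\<And>i. B i \<in> sets borel"
  shows "emeasure (iid \<mu>) {x. \<forall>i<k. carrier_column F n x (int i) \<in> B i} = (\<Prod>i<k. emeasure \<nu> (B i))"
  using assms
proof (induction k arbitrary: B)
  case 0
  then show ?case using P.emeasure_space_1 by simp
next
  case (Suc k)
  note [measurable] = Suc.prems
  let ?C = "{x. \<forall>i<k. carrier_column F n x (int i) \<in> B (Suc i)}"
  have "?C = {x \<in> space (iid borel). \<forall>i<k. carrier_column F n x (int i) \<in> B (Suc i)}" by (simp add: space_PiM)
  also have "\<dots> \<in> sets (iid borel)" by measurable
  finally have C: "?C \<in> sets (iid borel)" .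
  have "{x. \<forall>i<Suc k. carrier_column F n x (int i) \<in> B i} = {x. carrier_lim F x n \<in> B 0 \<and> evolve F x \<in> ?C}"
    unfolding All_less_Suc2 carrier_column_Suc by (simp add: carrier_column_def)
  also have "emeasure (iid \<mu>) \<dots> = emeasure \<nu> (B 0) * emeasure (iid \<mu>) ?C"
  proof (rule burke[OF Suc.prems C])
    fix x y assume "\<And>j. j \<le> n \<Longrightarrow> x j = y j" and x: "x \<in> ?C"
    then have "carrier_column F n x t = carrier_column F n y t" for t by (intro carrier_column_cong)
    with x show "y \<in> ?C" by simp
  qed
  also have "emeasure (iid \<mu>) ?C = (\<Prod>i<k. emeasure \<nu> (B (Suc i)))"
    by (rule Suc.IH) (use Suc.prems in auto)
  finally show ?case by (simp only: prod.lessThan_Suc_shift)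
qed

end

end

section \<open>Ergodicity by resampling one coordinate\<close>

locale ergodic_exchange = exchange +
  assumes coal: "AE x in iid \<mu>. coalesces F x"
    and dual_coal: "AE u in iid \<nu>. coalesces (dual F) u"
    and dual_mono: "carrier_monotone (dual F)"
begin

sublocale Q: prob_space "iid \<nu>" by (intro prob_space_iid prob)

lemma dual_meas[measurable]: "dual F \<in> borel \<Otimes>\<^sub>M borel \<rightarrow>\<^sub>M borel \<Otimes>\<^sub>M borel"
  unfolding dual_def by (simp add: split_beta' prod.swap_def)

lemma AE_forward_coalesces: "AE u in iid \<nu>. forward_coalesces (dual F) u"
proof -
  have "AE u in iid \<nu>. \<exists>k. run (dual F) k u (int s + int k - 1) (- real M) =
      run (dual F) k u (int s + int k - 1) (real M)" for s M :: nat
  proof -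
    define E where "E k n = {u. run (dual F) k u n (- real M) \<noteq> run (dual F) k u n (real M)}" for k n
    have [measurable]: "E k n \<in> sets (iid borel)" for k n
    proof -
      have "{u \<in> space (iid borel). run (dual F) k u n (- real M) \<noteq> run (dual F) k u n (real M)} \<in> sets (iid borel)"
        by (rule borel_measurable_neq[OF measurable_run[OF dual_meas] measurable_run[OF dual_meas]])
      then show ?thesis by (simp add: E_def)
    qed
    have shift: "emeasure (iid \<nu>) (E k n) = emeasure (iid \<nu>) (E k 0)" for k n
    proof -
      have [measurable]: "(\<lambda>x j. x (j + n)) \<in> iid borel \<rightarrow>\<^sub>M iid borel"
        by (rule measurable_PiM_single') auto
      have "emeasure (iid \<nu>) (E k 0) = emeasure (distr (iid \<nu>) (iid \<nu>) (\<lambda>x j. x (j + n))) (E k 0)"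
        by (subst iid_reindex) (auto simp: prob sets_eq inj_def)
      also have "\<dots> = emeasure (iid \<nu>) ((\<lambda>x j. x (j + n)) -` E k 0 \<inter> space (iid \<nu>))"
        by (rule emeasure_distr) measurable
      also have "(\<lambda>x j. x (j + n)) -` E k 0 \<inter> space (iid \<nu>) = E k n"
        by (auto simp: E_def run_reindex)
      finally show ?thesis ..
    qed
    have "(\<lambda>k. emeasure (iid \<nu>) (E k 0)) \<longlonglongrightarrow> emeasure (iid \<nu>) {}"
    proof (rule tendsto_emeasure_of_eventually_eq)
      show "finite_measure (iid \<nu>)" by unfold_locales
      show "AE u in iid \<nu>. \<forall>\<^sub>F k in sequentially. (u \<in> E k 0) = (u \<in> {})"
        using dual_coal
      proof eventually_elim
        case (elim u)
        then have "\<forall>\<^sub>F k in sequentially. run (dual F) k u 0 (- real M) = carrier_lim (dual F) u 0"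
          "\<forall>\<^sub>F k in sequentially. run (dual F) k u 0 (real M) = carrier_lim (dual F) u 0"
          by (simp_all add: coalesces_def)
        then show ?case by eventually_elim (simp add: E_def)
      qed
    qed measurable
    then have lim: "(\<lambda>k. emeasure (iid \<nu>) (E k 0)) \<longlonglongrightarrow> 0" by simp
    let ?I = "\<Inter>k. E k (int s + int k - 1)"
    have I[measurable]: "?I \<in> sets (iid \<nu>)" by measurable
    have "emeasure (iid \<nu>) ?I \<le> emeasure (iid \<nu>) (E k 0)" for k
      unfolding shift[of k "int s + int k - 1", symmetric] by (rule emeasure_mono) (auto, measurable)
    then have "emeasure (iid \<nu>) ?I \<le> 0"
      by (intro LIMSEQ_le_const[OF lim]) auto
    then have "?I \<in> null_sets (iid \<nu>)" using I by (intro null_setsI) auto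
    then have "AE u in iid \<nu>. u \<notin> ?I" by (rule AE_not_in)
    then show ?thesis by eventually_elim (simp add: E_def)
  qed
  then show ?thesis unfolding forward_coalesces_def by (intro AE_all_countable[THEN iffD2] allI)
qed

lemma AE_column_coalesces: "AE x in iid \<mu>. forward_coalesces (dual F) (carrier_column F n x)"
proof -
  interpret R: pair_prob_space "iid \<mu>" "iid \<nu>" ..
  let ?mix = "\<lambda>(x, y) j. if 0 \<le> j then carrier_column F n x j else y j"
  have [measurable]: "?mix \<in> iid borel \<Otimes>\<^sub>M iid borel \<rightarrow>\<^sub>M iid borel"
    by (rule measurable_PiM_single') (auto simp: split_beta')
  have "distr (iid \<mu> \<Otimes>\<^sub>M iid \<nu>) (iid \<nu>) ?mix = scale_measure 1 (iid \<nu>)"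
  proof (rule iid_eqI)
    show "finite_measure (distr (iid \<mu> \<Otimes>\<^sub>M iid \<nu>) (iid \<nu>) ?mix)"
      by (intro prob_space.finite_measure R.prob_space_distr) measurable
    fix D :: "int \<Rightarrow> real set" and J :: "int set"
    assume J: "finite J" and D: "\<And>j. j \<in> J \<Longrightarrow> D j \<in> sets borel"
    have cyl: "{x. \<forall>j\<in>J. x j \<in> D j} \<in> sets (iid borel)" using J D by (rule sets_cylinder)
    let ?J = "{j \<in> J. 0 \<le> j}" and ?J' = "{j \<in> J. \<not> 0 \<le> j}"
    obtain m where m: "\<And>j. j \<in> J \<Longrightarrow> j \<le> m" using bdd_above_finite[OF J] by (auto simp: bdd_above_def)
    define k where "k = nat (m + 1)"
    define B where "B i = (if int i \<in> J then D (int i) else UNIV)" for i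
    have B: "B i \<in> sets borel" for i using D by (simp add: B_def)
    let ?X = "{x. \<forall>i<k. carrier_column F n x (int i) \<in> B i}" and ?Y = "{y. \<forall>j\<in>?J'. y j \<in> D j}"
    have X: "?X \<in> sets (iid borel)"
    proof -
      note [measurable] = B
      have "{x \<in> space (iid borel). \<forall>i<k. carrier_column F n x (int i) \<in> B i} \<in> sets (iid borel)" by measurable
      then show ?thesis by simp
    qed
    have Y: "?Y \<in> sets (iid borel)" by (rule sets_cylinder) (use J D in auto)
    have nonneg: "(\<forall>i<k. carrier_column F n x (int i) \<in> B i) \<longleftrightarrow> (\<forall>j\<in>?J. carrier_column F n x j \<in> D j)" for x
    proof safe
      fix j assume "\<forall>i<k. carrier_column F n x (int i) \<in> B i" "j \<in> J" "0 \<le> j"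
      moreover from this m[of j] have "nat j < k" "int (nat j) = j" by (auto simp: k_def)
      ultimately have "carrier_column F n x (int (nat j)) \<in> B (nat j)" by blast
      then show "carrier_column F n x j \<in> D j" using \<open>j \<in> J\<close> \<open>int (nat j) = j\<close> by (simp add: B_def)
    qed (auto simp: B_def)
    have "(\<Prod>i<k. emeasure \<nu> (B i)) = (\<Prod>i\<in>{i\<in>{..<k}. int i \<in> J}. emeasure \<nu> (D (int i)))"
      using nu.emeasure_space_1 by (intro prod.mono_neutral_cong_right) (auto simp: B_def)
    also have "\<dots> = (\<Prod>j\<in>?J. emeasure \<nu> (D j))"
      by (rule prod.reindex_bij_witness[of _ nat int]) (use m in \<open>auto simp: k_def\<close>, force)
    finally have prodB: "(\<Prod>i<k. emeasure \<nu> (B i)) = (\<Prod>j\<in>?J. emeasure \<nu> (D j))" .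
    have "emeasure (distr (iid \<mu> \<Otimes>\<^sub>M iid \<nu>) (iid \<nu>) ?mix) {x. \<forall>j\<in>J. x j \<in> D j} =
        emeasure (iid \<mu> \<Otimes>\<^sub>M iid \<nu>) (?mix -` {x. \<forall>j\<in>J. x j \<in> D j} \<inter> space (iid \<mu> \<Otimes>\<^sub>M iid \<nu>))"
      by (rule emeasure_distr) (use cyl in \<open>simp_all add: sets_iids\<close>)
    also have "?mix -` {x. \<forall>j\<in>J. x j \<in> D j} \<inter> space (iid \<mu> \<Otimes>\<^sub>M iid \<nu>) = ?X \<times> ?Y"
      by (auto simp: space_pair_measure nonneg split: if_splits)
    also have "emeasure (iid \<mu> \<Otimes>\<^sub>M iid \<nu>) (?X \<times> ?Y) = emeasure (iid \<mu>) ?X * emeasure (iid \<nu>) ?Y"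
      using X Y by (intro Q.emeasure_pair_measure_Times) (simp_all add: sets_iids)
    also have "\<dots> = (\<Prod>j\<in>?J. emeasure \<nu> (D j)) * (\<Prod>j\<in>?J'. emeasure \<nu> (D j))"
      using J D by (subst carrier_column_iid[OF coal B], subst emeasure_iid_cylinder) (auto simp: sets_eq prob prodB)
    also have "\<dots> = (\<Prod>j\<in>?J \<union> ?J'. emeasure \<nu> (D j))"
      using J by (intro prod.union_disjoint[symmetric]) auto
    also have "?J \<union> ?J' = J" by auto
    finally show "emeasure (distr (iid \<mu> \<Otimes>\<^sub>M iid \<nu>) (iid \<nu>) ?mix) {x. \<forall>j\<in>J. x j \<in> D j} =
        1 * (\<Prod>j\<in>J. emeasure \<nu> (D j))" by simp
  qed (simp_all add: sets_eq prob)
  then have law: "distr (iid \<mu> \<Otimes>\<^sub>M iid \<nu>) (iid \<nu>) ?mix = iid \<nu>" by simp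
  have "AE z in iid \<mu> \<Otimes>\<^sub>M iid \<nu>. forward_coalesces (dual F) (?mix z)"
    by (rule AE_distrD[of _ _ "iid \<nu>"], measurable, subst law, rule AE_forward_coalesces)
  then have "AE x in iid \<mu>. AE y in iid \<nu>. forward_coalesces (dual F) (?mix (x, y))"
    by (rule R.AE_pair)
  moreover have "forward_coalesces (dual F) (?mix (x, y)) \<longleftrightarrow> forward_coalesces (dual F) (carrier_column F n x)" for x y
  proof -
    have "run (dual F) k (?mix (x, y)) (int s + int k - 1) w =
        run (dual F) k (carrier_column F n x) (int s + int k - 1) w" for k w and s :: nat
      by (rule run_cong_range) auto
    then show ?thesis by (simp add: forward_coalesces_def)
  qed
  ultimately show ?thesis by simp
qed

definition good :: "(int \<Rightarrow> real) \<Rightarrow> bool" where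
  "good x \<longleftrightarrow> (\<forall>t. coalesces F ((evolve F ^^ t) x)) \<and> (\<forall>n. forward_coalesces (dual F) (carrier_column F n x))"

lemma iterate_preserves: "distr (iid \<mu>) (iid \<mu>) (evolve F ^^ t) = iid \<mu>"
proof (induction t)
  case 0
  then show ?case by (simp add: distr_id)
next
  case (Suc t)
  have "distr (distr (iid \<mu>) (iid \<mu>) (evolve F ^^ t)) (iid \<mu>) (evolve F) =
      distr (iid \<mu>) (iid \<mu>) (evolve F \<circ> evolve F ^^ t)"
    by (rule distr_distr) measurable
  then show ?case unfolding Suc evolve_preserves[OF coal] funpow.simps by (rule sym)
qed

lemma AE_good: "AE x in iid \<mu>. good x"
proof -
  have "AE x in iid \<mu>. coalesces F ((evolve F ^^ t) x)" for t
    by (rule AE_distrD[of _ _ "iid \<mu>"], measurable, subst iterate_preserves, rule coal)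
  then show ?thesis
    unfolding good_def using AE_column_coalesces by (simp add: AE_all_countable)
qed

lemma eventually_agree:
  assumes x: "good x" and y: "good y" and past: "\<And>j. j < p \<Longrightarrow> x j = y j"
  shows "\<forall>\<^sub>F t in sequentially. (evolve F ^^ t) x n = (evolve F ^^ t) y n"
proof -
  have left: "(evolve F ^^ t) x n = (evolve F ^^ t) y n" if "n < p" for n t
    using that past by (intro iterate_evolve_cong[of n]) auto
  have col: "carrier_column F (p - 1) x t = carrier_column F (p - 1) y t" for t
    by (rule carrier_column_cong) (use past in auto)
  have "\<exists>t1. \<forall>t\<ge>t1. (evolve F ^^ t) x (p + int i) = (evolve F ^^ t) y (p + int i) \<and>
      carrier_column F (p + int i) x (int t) = carrier_column F (p + int i) y (int t)" for i
  proof (induction i)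
    have step: "\<exists>t1. \<forall>t\<ge>t1. (evolve F ^^ t) x n = (evolve F ^^ t) y n \<and> carrier_column F n x (int t) = carrier_column F n y (int t)"
      if t0: "\<And>t. t \<ge> t0 \<Longrightarrow> carrier_column F (n - 1) x (int t) = carrier_column F (n - 1) y (int t)" for n t0
    proof -
      let ?X = "\<lambda>t. (evolve F ^^ t) x n" and ?Y = "\<lambda>t. (evolve F ^^ t) y n"
      obtain M :: nat where M: "\<bar>?X t0\<bar> \<le> M" "\<bar>?Y t0\<bar> \<le> M"
        using real_arch_simple[of "max \<bar>?X t0\<bar> \<bar>?Y t0\<bar>"] by auto
      obtain k where k: "run (dual F) k (carrier_column F (n - 1) x) (int t0 + int k - 1) (- real M) =
          run (dual F) k (carrier_column F (n - 1) x) (int t0 + int k - 1) (real M)"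
        using x unfolding good_def forward_coalesces_def by blast
      have btw: "run (dual F) k (carrier_column F (n - 1) x) (int t0 + int k - 1) w =
          run (dual F) k (carrier_column F (n - 1) x) (int t0 + int k - 1) (real M)" if "\<bar>w\<bar> \<le> real M" for w
        by (rule run_eq_between[OF dual_mono k(1)]) (use that in auto)
      have runs: "run (dual F) k (carrier_column F (n - 1) x) (int t0 + int k - 1) w =
          run (dual F) k (carrier_column F (n - 1) y) (int t0 + int k - 1) w" for k w
      proof (rule run_cong_range)
        fix j assume "int t0 + int k - 1 - int k < j"
        then show "carrier_column F (n - 1) x j = carrier_column F (n - 1) y j" using t0[of "nat j"] by auto
      qed
      have meet: "?X (t0 + k) = ?Y (t0 + k)"
        unfolding evolve_iterate_eq_run runs[symmetric] using btw[OF M(1)] btw[OF M(2)] by simp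
      have X: "?X t = ?Y t" if "t \<ge> t0 + k" for t
        using that
      proof (induction rule: dec_induct)
        case base
        show ?case by (rule meet)
      next
        case (step t)
        then have "carrier_lim F ((evolve F ^^ t) x) (n - 1) = carrier_lim F ((evolve F ^^ t) y) (n - 1)"
          using t0[of t] by (simp add: carrier_column_def)
        then show ?case
          using step evolve_def[of F "(evolve F ^^ t) x" n] evolve_def[of F "(evolve F ^^ t) y" n] by simp
      qed
      have "carrier_column F n x (int t) = carrier_column F n y (int t)" if "t \<ge> t0 + k" for t
        using X[OF that] t0[of t] that x y
          carrier_lim_step[of F "(evolve F ^^ t) x" n] carrier_lim_step[of F "(evolve F ^^ t) y" n]
        by (simp add: carrier_column_def good_def)
      with X show ?thesis by blast
    qed
    case 0
    show ?case using step[of 0 p] col by simp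
    case (Suc i)
    then obtain t1 where "\<And>t. t \<ge> t1 \<Longrightarrow> carrier_column F (p + int i) x (int t) = carrier_column F (p + int i) y (int t)" by blast
    then show ?case using step[of t1 "p + int (Suc i)"] by (simp add: algebra_simps)
  qed
  from this[of "nat (n - p)"] left[of n] show ?thesis
    unfolding eventually_sequentially by (cases "n < p") auto
qed

definition discrepancy :: "int \<Rightarrow> nat \<Rightarrow> (int \<Rightarrow> real) set \<Rightarrow> (real \<times> (int \<Rightarrow> real)) set" where
  "discrepancy p t C = {(r, x). ((evolve F ^^ t) x \<in> C) \<noteq> ((evolve F ^^ t) (x(p := r)) \<in> C)}"

lemma upd_meas[measurable]: "(\<lambda>(r, x). x(p := r)) \<in> borel \<Otimes>\<^sub>M iid borel \<rightarrow>\<^sub>M iid borel"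
  unfolding split_beta' by (intro measurable_fun_upd_UNIV) measurable

lemma discrepancy_sets[measurable]:
  assumes [measurable]: "C \<in> sets (iid borel)"
  shows "discrepancy p t C \<in> sets (\<mu> \<Otimes>\<^sub>M iid \<mu>)"
proof -
  have [measurable]: "Measurable.pred (borel \<Otimes>\<^sub>M iid borel) (\<lambda>z. (evolve F ^^ t) (case z of (r, x) \<Rightarrow> x(p := r)) \<in> C)"
    by (rule pred_sets2[OF assms], rule measurable_compose[OF upd_meas measurable_iterate_evolve[OF F_meas]])
  have "{z \<in> space (\<mu> \<Otimes>\<^sub>M iid \<mu>). ((evolve F ^^ t) (snd z) \<in> C) \<noteq> ((evolve F ^^ t) (case z of (r, x) \<Rightarrow> x(p := r)) \<in> C)}
      \<in> sets (\<mu> \<Otimes>\<^sub>M iid \<mu>)" by measurable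
  also have "{z \<in> space (\<mu> \<Otimes>\<^sub>M iid \<mu>). ((evolve F ^^ t) (snd z) \<in> C) \<noteq> ((evolve F ^^ t) (case z of (r, x) \<Rightarrow> x(p := r)) \<in> C)} = discrepancy p t C"
    by (auto simp: discrepancy_def space_pair_measure)
  finally show ?thesis .
qed

lemma AE_resampled:
  assumes "AE x in iid \<mu>. R x"
  shows "AE z in \<mu> \<Otimes>\<^sub>M iid \<mu>. R (snd z) \<and> R ((snd z)(p := fst z))"
proof -
  have "AE z in \<mu> \<Otimes>\<^sub>M iid \<mu>. R (case z of (r, x) \<Rightarrow> x(p := r))"
    by (rule AE_distrD[of _ _ "iid \<mu>"], measurable, subst resample_preserves, rule assms)
  moreover have "AE z in \<mu> \<Otimes>\<^sub>M iid \<mu>. R (snd z)"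
    by (rule AE_pair_snd[OF prob(1) P.prob_space_axioms assms])
  ultimately show ?thesis by eventually_elim (simp add: split_beta)
qed

end

context ergodic_exchange
begin

sublocale muP: pair_prob_space \<mu> "iid \<mu>" ..

lemma discrepancy_cylinder:
  assumes J: "finite J" and D: "\<And>j. j \<in> J \<Longrightarrow> D j \<in> sets borel"
  shows "(\<lambda>t. measure (\<mu> \<Otimes>\<^sub>M iid \<mu>) (discrepancy p t {x. \<forall>j\<in>J. x j \<in> D j})) \<longlonglongrightarrow> 0"
proof -
  have C: "{x. \<forall>j\<in>J. x j \<in> D j} \<in> sets (iid borel)" using J D by (rule sets_cylinder)
  have "(\<lambda>t. emeasure (\<mu> \<Otimes>\<^sub>M iid \<mu>) (discrepancy p t {x. \<forall>j\<in>J. x j \<in> D j})) \<longlonglongrightarrow>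
      emeasure (\<mu> \<Otimes>\<^sub>M iid \<mu>) {}"
  proof (rule tendsto_emeasure_of_eventually_eq)
    show "finite_measure (\<mu> \<Otimes>\<^sub>M iid \<mu>)" by unfold_locales
    show "discrepancy p t {x. \<forall>j\<in>J. x j \<in> D j} \<in> sets (\<mu> \<Otimes>\<^sub>M iid \<mu>)" for t by (rule discrepancy_sets[OF C])
    show "AE z in \<mu> \<Otimes>\<^sub>M iid \<mu>. \<forall>\<^sub>F t in sequentially. (z \<in> discrepancy p t {x. \<forall>j\<in>J. x j \<in> D j}) = (z \<in> {})"
      using AE_resampled[OF AE_good, of p]
    proof eventually_elim
      case (elim z)
      have "\<forall>\<^sub>F t in sequentially. \<forall>j\<in>J. (evolve F ^^ t) (snd z) j = (evolve F ^^ t) ((snd z)(p := fst z)) j"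
        using J elim by (intro eventually_ball_finite ballI eventually_agree[of _ _ p]) auto
      then show ?case by eventually_elim (auto simp: discrepancy_def split_beta)
    qed
  qed simp
  then show ?thesis
    unfolding muP.P.emeasure_eq_measure by (simp add: ennreal_tendsto_0_iff)
qed

lemma law_iterate:
  assumes [measurable]: "C \<in> sets (iid borel)"
  shows "measure (\<mu> \<Otimes>\<^sub>M iid \<mu>) {z. (evolve F ^^ t) (snd z) \<in> C} = measure (iid \<mu>) C"
    and "measure (\<mu> \<Otimes>\<^sub>M iid \<mu>) {z. (evolve F ^^ t) ((snd z)(p := fst z)) \<in> C} = measure (iid \<mu>) C"
    and "{z. (evolve F ^^ t) (snd z) \<in> C} \<in> sets (\<mu> \<Otimes>\<^sub>M iid \<mu>)"
    and "{z. (evolve F ^^ t) ((snd z)(p := fst z)) \<in> C} \<in> sets (\<mu> \<Otimes>\<^sub>M iid \<mu>)"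
proof -
  have law: "measure (\<mu> \<Otimes>\<^sub>M iid \<mu>) {z. (evolve F ^^ t) (g z) \<in> C} = measure (iid \<mu>) C \<and>
      {z. (evolve F ^^ t) (g z) \<in> C} \<in> sets (\<mu> \<Otimes>\<^sub>M iid \<mu>)"
    if [measurable]: "g \<in> borel \<Otimes>\<^sub>M iid borel \<rightarrow>\<^sub>M iid borel" and g: "distr (\<mu> \<Otimes>\<^sub>M iid \<mu>) (iid \<mu>) g = iid \<mu>" for g
  proof -
    have comp: "(\<lambda>z. (evolve F ^^ t) (g z)) \<in> \<mu> \<Otimes>\<^sub>M iid \<mu> \<rightarrow>\<^sub>M iid \<mu>" by measurable
    have eq: "{z. (evolve F ^^ t) (g z) \<in> C} = (\<lambda>z. (evolve F ^^ t) (g z)) -` C \<inter> space (\<mu> \<Otimes>\<^sub>M iid \<mu>)"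
      by (auto simp: space_pair_measure)
    have "distr (distr (\<mu> \<Otimes>\<^sub>M iid \<mu>) (iid \<mu>) g) (iid \<mu>) (evolve F ^^ t) =
        distr (\<mu> \<Otimes>\<^sub>M iid \<mu>) (iid \<mu>) ((evolve F ^^ t) \<circ> g)"
      by (rule distr_distr) measurable
    then have "iid \<mu> = distr (\<mu> \<Otimes>\<^sub>M iid \<mu>) (iid \<mu>) (\<lambda>z. (evolve F ^^ t) (g z))"
      unfolding g iterate_preserves by (simp add: comp_def)
    then have "measure (iid \<mu>) C = measure (distr (\<mu> \<Otimes>\<^sub>M iid \<mu>) (iid \<mu>) (\<lambda>z. (evolve F ^^ t) (g z))) C" by simp
    also have "\<dots> = measure (\<mu> \<Otimes>\<^sub>M iid \<mu>) {z. (evolve F ^^ t) (g z) \<in> C}"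
      unfolding eq by (rule measure_distr[OF comp]) (simp add: sets_iids)
    finally have "measure (iid \<mu>) C = measure (\<mu> \<Otimes>\<^sub>M iid \<mu>) {z. (evolve F ^^ t) (g z) \<in> C}" .
    moreover have "{z. (evolve F ^^ t) (g z) \<in> C} \<in> sets (\<mu> \<Otimes>\<^sub>M iid \<mu>)"
      unfolding eq by (rule measurable_sets[OF comp]) (simp add: sets_iids)
    ultimately show ?thesis by simp
  qed
  have 1: "measure (\<mu> \<Otimes>\<^sub>M iid \<mu>) {z. (evolve F ^^ t) (snd z) \<in> C} = measure (iid \<mu>) C \<and>
      {z. (evolve F ^^ t) (snd z) \<in> C} \<in> sets (\<mu> \<Otimes>\<^sub>M iid \<mu>)"
    by (rule law) (simp_all add: distr_pair_snd prob P.prob_space_axioms)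
  have 2: "measure (\<mu> \<Otimes>\<^sub>M iid \<mu>) {z. (evolve F ^^ t) ((snd z)(p := fst z)) \<in> C} = measure (iid \<mu>) C \<and>
      {z. (evolve F ^^ t) ((snd z)(p := fst z)) \<in> C} \<in> sets (\<mu> \<Otimes>\<^sub>M iid \<mu>)"
    using upd_meas resample_preserves[of p] by (intro law) (simp_all add: split_beta')
  show "measure (\<mu> \<Otimes>\<^sub>M iid \<mu>) {z. (evolve F ^^ t) (snd z) \<in> C} = measure (iid \<mu>) C"
    and "measure (\<mu> \<Otimes>\<^sub>M iid \<mu>) {z. (evolve F ^^ t) ((snd z)(p := fst z)) \<in> C} = measure (iid \<mu>) C"
    and "{z. (evolve F ^^ t) (snd z) \<in> C} \<in> sets (\<mu> \<Otimes>\<^sub>M iid \<mu>)"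
    and "{z. (evolve F ^^ t) ((snd z)(p := fst z)) \<in> C} \<in> sets (\<mu> \<Otimes>\<^sub>M iid \<mu>)"
    using 1 2 by auto
qed

lemma discrepancy_tendsto:
  assumes "C \<in> sets (iid borel)"
  shows "(\<lambda>t. measure (\<mu> \<Otimes>\<^sub>M iid \<mu>) (discrepancy p t C)) \<longlonglongrightarrow> 0"
proof -
  let ?m = "measure (\<mu> \<Otimes>\<^sub>M iid \<mu>)"
  let ?G = "prod_algebra (UNIV :: int set) (\<lambda>_. borel :: real measure)"
  have sets: "sets (iid borel) = sigma_sets UNIV ?G"
    by (simp add: sets_PiM)
  have "Int_stable ?G" by (rule Int_stable_prod_algebra)
  moreover have "?G \<subseteq> Pow UNIV" by simp
  moreover have "C \<in> sigma_sets UNIV ?G" using assms by (simp only: sets)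
  ultimately show ?thesis
  proof (induction rule: sigma_sets_induct_disjoint)
    case (basic A)
    then obtain J E where A: "A = prod_emb UNIV (\<lambda>_. borel) J (Pi\<^sub>E J E)" and J: "finite J"
      and E: "E \<in> (\<Pi> i\<in>J. sets borel)"
      by (rule prod_algebraE) blast
    have "A = {x. \<forall>j\<in>J. x j \<in> E j}"
      unfolding A by (auto simp: prod_emb_def PiE_def Pi_def extensional_def)
    then show ?case using discrepancy_cylinder[OF J, of E p] E by auto
  next
    case empty
    then show ?case by (simp add: discrepancy_def)
  next
    case (compl A)
    have "discrepancy p t (UNIV - A) = discrepancy p t A" for t by (auto simp: discrepancy_def)
    then show ?case using compl by simp
  next
    case (union A)
    have Am[measurable]: "A i \<in> sets (iid borel)" for i using union.hyps(2) sets by blast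
    define V where "V m = (\<Union>i\<in>{m..}. A i)" for m
    have V[measurable]: "V m \<in> sets (iid borel)" for m unfolding V_def by measurable
    have "(\<lambda>m. measure (iid \<mu>) (V m)) \<longlonglongrightarrow> measure (iid \<mu>) (\<Inter>m. V m)"
    proof (rule P.finite_Lim_measure_decseq)
      show "decseq V" unfolding decseq_def V_def by (intro allI impI UN_mono) auto
    qed (auto simp: sets_iids)
    moreover have "(\<Inter>m. V m) = {}"
    proof (rule ccontr)
      assume "(\<Inter>m. V m) \<noteq> {}"
      then obtain x where x: "\<And>m. x \<in> V m" by auto
      from x[of 0] obtain i where i: "x \<in> A i" by (auto simp: V_def)
      from x[of "Suc i"] obtain j where j: "j \<ge> Suc i" "x \<in> A j" by (auto simp: V_def)
      then have "i \<noteq> j" by simp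
      then have "A i \<inter> A j = {}" using union.hyps(1) by (auto simp: disjoint_family_on_def)
      with i j show False by auto
    qed
    ultimately have V0: "(\<lambda>m. measure (iid \<mu>) (V m)) \<longlonglongrightarrow> 0" by simp
    show ?case
    proof (rule tendstoI)
      fix e :: real assume e: "e > 0"
      have "\<forall>\<^sub>F m in sequentially. measure (iid \<mu>) (V m) < e / 4"
        using order_tendstoD(2)[OF V0, of "e / 4"] e by simp
      then obtain m where m: "measure (iid \<mu>) (V m) < e / 4"
        by (auto simp: eventually_sequentially)
      have "(\<lambda>t. \<Sum>i<m. ?m (discrepancy p t (A i))) \<longlonglongrightarrow> (\<Sum>i<m. 0)"
        by (intro tendsto_sum union.IH)
      then have "\<forall>\<^sub>F t in sequentially. (\<Sum>i<m. ?m (discrepancy p t (A i))) < e / 2"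
        using e by (intro order_tendstoD(2)) auto
      then show "\<forall>\<^sub>F t in sequentially. dist (?m (discrepancy p t (\<Union>i. A i))) 0 < e"
      proof eventually_elim
        case (elim t)
        let ?X = "{z. (evolve F ^^ t) (snd z) \<in> V m}" and ?Y = "{z. (evolve F ^^ t) ((snd z)(p := fst z)) \<in> V m}"
        let ?Z = "\<Union>i<m. discrepancy p t (A i)"
        have "x \<in> (\<Union>i. A i) \<longleftrightarrow> (\<exists>i<m. x \<in> A i) \<or> x \<in> V m" for x
          unfolding V_def by (auto, metis atLeast_iff not_less)
        then have sub: "discrepancy p t (\<Union>i. A i) \<subseteq> ?Z \<union> (?X \<union> ?Y)"
          by (auto simp: discrepancy_def)
        note [measurable] = law_iterate(3)[OF V] law_iterate(4)[OF V]
        have Z: "?Z \<in> sets (\<mu> \<Otimes>\<^sub>M iid \<mu>)" by measurable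
        have "?m (discrepancy p t (\<Union>i. A i)) \<le> ?m (?Z \<union> (?X \<union> ?Y))"
          using sub by (rule muP.P.finite_measure_mono) measurable
        also have "\<dots> \<le> ?m ?Z + ?m (?X \<union> ?Y)"
          by (rule measure_Un_le) measurable
        also have "?m ?Z \<le> (\<Sum>i<m. ?m (discrepancy p t (A i)))"
          by (rule measure_UNION_le) (auto intro: discrepancy_sets)
        also have "?m (?X \<union> ?Y) \<le> ?m ?X + ?m ?Y"
          by (rule measure_Un_le) measurable
        also have "?m ?X + ?m ?Y = 2 * measure (iid \<mu>) (V m)"
          by (simp add: law_iterate[OF V])
        finally show ?case using m elim by (simp add: dist_real_def)
      qed
    qed
  qed
qed

lemma invariant_resample:
  assumes [measurable]: "A \<in> sets (iid borel)" and inv: "AE x in iid \<mu>. evolve F x \<in> A \<longleftrightarrow> x \<in> A"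
  shows "AE z in \<mu> \<Otimes>\<^sub>M iid \<mu>. snd z \<in> A \<longleftrightarrow> (snd z)(p := fst z) \<in> A"
proof -
  have "AE x in iid \<mu>. evolve F ((evolve F ^^ t) x) \<in> A \<longleftrightarrow> (evolve F ^^ t) x \<in> A" for t
    by (rule AE_distrD[of _ _ "iid \<mu>"], measurable, subst iterate_preserves, rule inv)
  then have "AE x in iid \<mu>. \<forall>t. evolve F ((evolve F ^^ t) x) \<in> A \<longleftrightarrow> (evolve F ^^ t) x \<in> A"
    by (simp add: AE_all_countable)
  then have "AE x in iid \<mu>. \<forall>t. (evolve F ^^ t) x \<in> A \<longleftrightarrow> x \<in> A"
  proof eventually_elim
    case (elim x)
    have "(evolve F ^^ t) x \<in> A \<longleftrightarrow> x \<in> A" for t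
      by (induction t) (use elim in auto)
    then show ?case by simp
  qed
  from AE_resampled[OF this, of p]
  have *: "AE z in \<mu> \<Otimes>\<^sub>M iid \<mu>. z \<in> discrepancy p t A \<longleftrightarrow> z \<in> discrepancy p 0 A" for t
    by eventually_elim (simp add: discrepancy_def split_beta)
  have "(\<lambda>t. measure (\<mu> \<Otimes>\<^sub>M iid \<mu>) (discrepancy p t A)) = (\<lambda>t. measure (\<mu> \<Otimes>\<^sub>M iid \<mu>) (discrepancy p 0 A))"
    by (rule ext, rule muP.P.finite_measure_eq_AE[OF *]) measurable
  with discrepancy_tendsto[OF assms(1), of p] have "measure (\<mu> \<Otimes>\<^sub>M iid \<mu>) (discrepancy p 0 A) = 0"
    by (simp add: LIMSEQ_const_iff)
  then have "discrepancy p 0 A \<in> null_sets (\<mu> \<Otimes>\<^sub>M iid \<mu>)"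
    by (intro null_setsI) (simp_all add: muP.P.emeasure_eq_measure)
  from AE_not_in[OF this] show ?thesis
    by eventually_elim (simp add: discrepancy_def split_beta)
qed

text \<open>In the induction step the site update of the swap map exchanges the resampled value with the coordinate
  \<open>p\<close>, and the invariant event does not notice.\<close>
lemma invariant_indep_cylinder:
  assumes A[measurable]: "A \<in> sets (iid borel)" and inv: "AE x in iid \<mu>. evolve F x \<in> A \<longleftrightarrow> x \<in> A"
    and "finite J" "\<And>j. j \<in> J \<Longrightarrow> D j \<in> sets borel"
  shows "emeasure (iid \<mu>) (A \<inter> {x. \<forall>j\<in>J. x j \<in> D j}) = emeasure (iid \<mu>) A * (\<Prod>j\<in>J. emeasure \<mu> (D j))"
  using assms(3,4)
proof (induction J rule: finite_induct)
  case empty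
  then show ?case by simp
next
  case (insert p J)
  interpret mm: pair_prob_space \<mu> \<mu> ..
  interpret S: exchange "\<lambda>(x, w). (w, x)" \<mu> \<mu>
  proof
    show "distr (\<mu> \<Otimes>\<^sub>M \<mu>) (borel \<Otimes>\<^sub>M borel) (\<lambda>(x, w). (w, x)) = \<mu> \<Otimes>\<^sub>M \<mu>"
      by (rule trans[OF distr_cong mm.distr_pair_swap[symmetric]])
        (auto intro!: sets_pair_measure_cong simp: sets_eq)
  qed (simp_all add: prob sets_eq split_beta')
  let ?N = "\<mu> \<Otimes>\<^sub>M iid \<mu>" and ?\<sigma> = "site_update (\<lambda>(x, w). (w, x)) p"
  let ?C = "{x. \<forall>j\<in>J. x j \<in> D j}"
  have C[measurable]: "?C \<in> sets (iid borel)" using insert by (intro sets_cylinder) auto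
  have Dp[measurable]: "D p \<in> sets borel" using insert by auto
  have AC: "A \<inter> ?C \<in> sets (iid borel)" by measurable
  have X: "{x \<in> space (iid borel). x p \<in> D p} \<in> sets (iid borel)" by measurable
  have "D p \<times> (A \<inter> ?C) \<in> sets (borel \<Otimes>\<^sub>M iid borel)" using AC Dp by (intro pair_measureI) auto
  also have "sets (borel \<Otimes>\<^sub>M iid borel) = sets ?N" by (intro sets_pair_measure_cong) (simp_all add: sets_eq sets_iids)
  finally have DAC: "D p \<times> (A \<inter> ?C) \<in> sets ?N" .
  have "emeasure \<mu> (D p) * emeasure (iid \<mu>) (A \<inter> ?C) = emeasure ?N (D p \<times> (A \<inter> ?C))"
    using AC by (intro P.emeasure_pair_measure_Times[symmetric]) (auto simp: sets_eq sets_iids)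
  also have "\<dots> = emeasure (distr ?N ?N ?\<sigma>) (D p \<times> (A \<inter> ?C))"
    by (simp only: S.site_update_preserves)
  also have "\<dots> = emeasure ?N (?\<sigma> -` (D p \<times> (A \<inter> ?C)) \<inter> space ?N)"
    using DAC by (intro emeasure_distr) measurable
  also have "\<dots> = emeasure ?N (UNIV \<times> (A \<inter> ?C \<inter> {x. x p \<in> D p}))"
  proof (rule emeasure_eq_AE)
    show "AE z in ?N. z \<in> ?\<sigma> -` (D p \<times> (A \<inter> ?C)) \<inter> space ?N \<longleftrightarrow> z \<in> UNIV \<times> (A \<inter> ?C \<inter> {x. x p \<in> D p})"
      using invariant_resample[OF A inv, of p]
    proof eventually_elim
      case (elim z)
      have "(snd z)(p := fst z) \<in> ?C \<longleftrightarrow> snd z \<in> ?C" using insert.hyps by auto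
      with elim show ?case by (auto simp: site_update_def split_beta space_pair_measure mem_Times_iff)
    qed
    show "?\<sigma> -` (D p \<times> (A \<inter> ?C)) \<inter> space ?N \<in> sets ?N"
      using DAC by (intro measurable_sets[of _ ?N ?N]) measurable
    show "UNIV \<times> (A \<inter> ?C \<inter> {x. x p \<in> D p}) \<in> sets ?N"
      using sets.Int[OF AC X] by (intro pair_measureI) (auto simp: sets_eq sets_iids)
  qed
  also have "\<dots> = emeasure (iid \<mu>) (A \<inter> ?C \<inter> {x. x p \<in> D p})"
    using mu.emeasure_space_1 sets.Int[OF AC X]
    by (subst P.emeasure_pair_measure_Times) (auto simp: sets_eq sets_iids)
  also have "A \<inter> ?C \<inter> {x. x p \<in> D p} = A \<inter> {x. \<forall>j\<in>insert p J. x j \<in> D j}" by auto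
  finally show ?case using insert by (simp add: mult_ac)
qed

theorem evolve_ergodic:
  assumes A[measurable]: "A \<in> sets (iid borel)" and inv: "AE x in iid \<mu>. evolve F x \<in> A \<longleftrightarrow> x \<in> A"
  shows "emeasure (iid \<mu>) A = 0 \<or> emeasure (iid \<mu>) A = 1"
proof -
  let ?Q = "density (iid \<mu>) (indicator A)"
  have Q: "emeasure ?Q C = emeasure (iid \<mu>) (A \<inter> C)" if [measurable]: "C \<in> sets (iid borel)" for C
  proof -
    have "emeasure ?Q C = (\<integral>\<^sup>+x. indicator A x * indicator C x \<partial>iid \<mu>)"
      by (rule emeasure_density) measurable
    also have "\<dots> = (\<integral>\<^sup>+x. indicator (A \<inter> C) x \<partial>iid \<mu>)"
      by (simp add: indicator_inter_arith)
    also have "\<dots> = emeasure (iid \<mu>) (A \<inter> C)"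
      by (rule nn_integral_indicator) measurable
    finally show ?thesis .
  qed
  have "?Q = scale_measure (emeasure (iid \<mu>) A) (iid \<mu>)"
  proof (rule iid_eqI)
    show "finite_measure ?Q"
      by (rule finite_measureI) (use sets.top[of "iid borel"] in \<open>simp add: Q\<close>)
    show "emeasure ?Q {x. \<forall>j\<in>J. x j \<in> D j} = emeasure (iid \<mu>) A * (\<Prod>j\<in>J. emeasure \<mu> (D j))"
      if "finite J" "\<And>j. j \<in> J \<Longrightarrow> D j \<in> sets borel" for D and J :: "int set"
      using invariant_indep_cylinder[OF A inv that] sets_cylinder[OF that] by (simp add: Q)
  qed (simp_all add: prob sets_eq)
  then have "emeasure ?Q A = emeasure (iid \<mu>) A * emeasure (iid \<mu>) A" by simp
  then have "emeasure (iid \<mu>) A = emeasure (iid \<mu>) A * emeasure (iid \<mu>) A"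
    using Q[OF A] by simp
  then have "measure (iid \<mu>) A = measure (iid \<mu>) A * measure (iid \<mu>) A"
    by (simp add: P.emeasure_eq_measure ennreal_mult[symmetric])
  then have "measure (iid \<mu>) A = 0 \<or> measure (iid \<mu>) A = 1" by simp
  then show ?thesis by (auto simp: P.emeasure_eq_measure)
qed

end

section \<open>From carriers to the dynamics\<close>

lemma run_add: "run F (k + m) x n w = run F k x n (run F m x (n - int k) w)"
  by (induction k arbitrary: n) (auto simp: algebra_simps)

definition strongly_coalesces :: "(real \<times> real \<Rightarrow> real \<times> real) \<Rightarrow> (int \<Rightarrow> real) \<Rightarrow> bool" where
  "strongly_coalesces F x \<longleftrightarrow> (\<forall>n. \<exists>k. \<forall>w w'. run F k x n w = run F k x n w')"

lemma coalescesI: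
  assumes "\<And>n w. \<forall>\<^sub>F k in sequentially. run F k x n w = c n"
  shows "coalesces F x" "carrier_lim F x n = c n"
proof -
  have c: "carrier_lim F x n = c n" for n
    unfolding carrier_lim_def by (rule limI, rule tendsto_eventually, rule assms)
  then show "carrier_lim F x n = c n" .
  show "coalesces F x" unfolding coalesces_def c using assms by simp
qed

lemma strongly_coalesces_imp_coalesces:
  assumes "strongly_coalesces F x"
  shows "coalesces F x"
proof -
  obtain k where k: "\<And>n w w'. run F (k n) x n w = run F (k n) x n w'"
    using assms unfolding strongly_coalesces_def by metis
  show ?thesis
  proof (rule coalescesI)
    fix n w
    have "run F m x n w = run F (k n) x n 0" if "m \<ge> k n" for m
      using run_add[of F "k n" "m - k n" x n w] k that by simp
    then show "\<forall>\<^sub>F m in sequentially. run F m x n w = run F (k n) x n 0"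
      unfolding eventually_sequentially by blast
  qed
qed

lemma carrier_ok_run:
  assumes "carrier_ok A B x U"
  shows "U n = run (F_udK A B) k x n (U (n - int k))"
proof (induction k arbitrary: n)
  case (Suc k)
  have "run (F_udK A B) (Suc k) x n (U (n - int (Suc k))) = snd (F_udK A B (x n, U (n - 1)))"
    using Suc[of "n - 1"] by (simp add: algebra_simps)
  then show ?case using assms by (simp add: carrier_ok_def)
qed simp

lemma coalesces_carrier_ok:
  assumes "coalesces (F_udK A B) x"
  shows "carrier_ok A B x (carrier_lim (F_udK A B) x)"
  unfolding carrier_ok_def by (intro allI carrier_lim_step[OF assms, symmetric])

lemma strongly_coalesces_uniq:
  assumes "strongly_coalesces (F_udK A B) x" "carrier_ok A B x U"
  shows "U = carrier_lim (F_udK A B) x"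
proof
  fix n
  obtain k where "\<And>w w'. run (F_udK A B) k x n w = run (F_udK A B) k x n w'"
    using assms unfolding strongly_coalesces_def by metis
  then show "U n = carrier_lim (F_udK A B) x n"
    using carrier_ok_run[OF assms(2), of n k]
      carrier_ok_run[OF coalesces_carrier_ok[OF strongly_coalesces_imp_coalesces[OF assms(1)]], of n k]
    by metis
qed

definition T_regular :: "ereal \<Rightarrow> ereal \<Rightarrow> (int \<Rightarrow> real) \<Rightarrow> bool" where
  "T_regular A B x \<longleftrightarrow> T_defined A B x \<and> T_carrier A B x = carrier_lim (F_udK A B) x"

lemma T_regular_evolve: "T_regular A B x \<Longrightarrow> T_udK A B x = evolve (F_udK A B) x"
  by (simp add: T_regular_def T_udK_def evolve_def fun_eq_iff)

lemma strongly_coalesces_T_regular: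
  assumes x: "strongly_coalesces (F_udK A B) x"
  shows "T_regular A B x"
proof -
  have ok: "carrier_ok A B x (carrier_lim (F_udK A B) x)"
    by (intro coalesces_carrier_ok strongly_coalesces_imp_coalesces x)
  have "uniq_carrier A B x"
    unfolding uniq_carrier_def using ok strongly_coalesces_uniq[OF x] by blast
  moreover have "(THE U. carrier_ok A B x U) = carrier_lim (F_udK A B) x"
    using ok strongly_coalesces_uniq[OF x] by (intro the_equality)
  moreover have "(\<lambda>n. snd (THE XU. fam_ok A B x XU) n 0) = carrier_lim (F_udK A B) x" if "uniq_fam A B x"
  proof (rule strongly_coalesces_uniq[OF x])
    obtain X U where XU: "(THE XU. fam_ok A B x XU) = (X, U)" by (rule prod.exhaust)
    from that have "fam_ok A B x (THE XU. fam_ok A B x XU)"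
      unfolding uniq_fam_def by (rule theI')
    then have "fam_ok A B x (X, U)" unfolding XU .
    then have "F_udK A B (X n 0, U (n - 1) 0) = (X n (0 + 1), U n 0)" "X n 0 = x n" for n
      unfolding fam_ok_def prod.case by blast+
    then show "carrier_ok A B x (\<lambda>n. snd (THE XU. fam_ok A B x XU) n 0)"
      unfolding XU carrier_ok_def by simp
  qed
  ultimately show ?thesis by (simp add: T_regular_def T_defined_def T_carrier_def)
qed

lemma ergodic_under_udK:
  assumes "ergodic_exchange (F_udK A B) \<mu> \<nu>" and reg: "AE x in iid \<mu>. T_regular A B x"
  shows "ergodic_under (iid \<mu>) (T_udK A B) (T_defined A B)"
proof -
  interpret ergodic_exchange "F_udK A B" \<mu> \<nu> by fact
  let ?E = "evolve (F_udK A B)" and ?T = "T_udK A B"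
  have T: "AE x in iid \<mu>. ?T x = ?E x"
    using reg by eventually_elim (rule T_regular_evolve)
  have E_sets: "?E -` A \<in> sets (iid \<mu>)" if "A \<in> sets (iid \<mu>)" for A
    using measurable_sets[of ?E "iid \<mu>" "iid \<mu>" A] that by simp
  have ae: "AE x in completion (iid \<mu>). x \<in> ?E -` A \<longleftrightarrow> x \<in> ?T -` A" for A
    by (rule AE_completion) (use T in eventually_elim, auto)
  have T_sets: "?T -` A \<in> sets (completion (iid \<mu>))" if "A \<in> sets (iid \<mu>)" for A
    using ae by (rule completion.in_sets_AE) (use E_sets[OF that] in auto)
  show ?thesis
    unfolding ergodic_under_def
  proof (intro conjI ballI impI)
    show "prob_space (iid \<mu>)" by unfold_locales
    show "AE x in iid \<mu>. T_defined A B x" using reg by eventually_elim (simp add: T_regular_def)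
    show "?T \<in> completion (iid \<mu>) \<rightarrow>\<^sub>M iid \<mu>"
      by (rule measurableI) (use T_sets in auto)
    fix A assume A: "A \<in> sets (iid \<mu>)"
    have "emeasure (completion (iid \<mu>)) (?T -` A) = emeasure (completion (iid \<mu>)) (?E -` A)"
      using ae[of A] by (intro emeasure_eq_AE T_sets A sets_completionI_sets E_sets) auto
    also have "\<dots> = emeasure (iid \<mu>) (?E -` A)"
      using E_sets[OF A] by simp
    also have "\<dots> = emeasure (distr (iid \<mu>) (iid \<mu>) ?E) A"
      using A by (subst emeasure_distr) auto
    finally show "emeasure (completion (iid \<mu>)) (?T -` A \<inter> space (iid \<mu>)) = emeasure (iid \<mu>) A"
      by (simp add: evolve_preserves[OF coal])
    assume inv: "?T -` A \<inter> space (iid \<mu>) = A"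
    have "AE x in iid \<mu>. ?E x \<in> A \<longleftrightarrow> x \<in> A"
      using T
    proof eventually_elim
      case (elim x)
      have "x \<in> A \<longleftrightarrow> ?T x \<in> A" by (subst inv[symmetric]) simp
      with elim show ?case by simp
    qed
    moreover have "A \<in> sets (iid borel)" using A by (simp add: sets_iids)
    ultimately show "emeasure (iid \<mu>) A = 0 \<or> emeasure (iid \<mu>) A = 1" by (intro evolve_ergodic)
  qed
qed

lemma indep_coordinates:
  assumes "prob_space \<mu>" "sets \<mu> = sets borel" "inj f"
  shows "prob_space.indep_vars (iid \<mu>) (\<lambda>_. borel) (\<lambda>i x. x (f i)) (UNIV :: 'i set)"
proof -
  interpret P: prob_space "iid \<mu>" by (intro prob_space_iid assms)
  have [measurable_cong]: "sets (iid \<mu>) = sets (iid borel)" by (intro sets_iid assms)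
  have c: "distr (iid \<mu>) borel (\<lambda>x. x (f i)) = \<mu>" for i
  proof -
    have "distr (iid \<mu>) borel (\<lambda>x. x (f i)) = distr (iid \<mu>) \<mu> (\<lambda>x. x (f i))"
      by (rule distr_cong) (simp_all add: assms)
    also have "\<dots> = \<mu>" using assms by (intro distr_PiM_component) auto
    finally show ?thesis .
  qed
  have "distr (iid \<mu>) (PiM UNIV (\<lambda>_. borel)) (\<lambda>x. \<lambda>i\<in>UNIV. x (f i)) =
      distr (iid \<mu>) (PiM UNIV (\<lambda>_. \<mu>)) (\<lambda>x. \<lambda>i\<in>UNIV. x (f i))"
    by (rule distr_cong) (auto intro!: sets_PiM_cong simp: assms)
  also have "\<dots> = PiM UNIV (\<lambda>_. \<mu>)"
    using distr_PiM_reindex[of UNIV "\<lambda>_. \<mu>" f UNIV] assms by simp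
  finally have "distr (iid \<mu>) (PiM UNIV (\<lambda>_. borel)) (\<lambda>x. \<lambda>i\<in>UNIV. x (f i)) = PiM UNIV (\<lambda>_. \<mu>)" .
  then show ?thesis
    by (subst P.indep_vars_iff_distr_eq_PiM) (simp_all add: c)
qed

lemma AE_block:
  assumes mu: "prob_space \<mu>" "sets \<mu> = sets borel" and E: "E \<in> sets borel" "emeasure \<mu> E > 0"
  shows "AE x in iid \<mu>. \<forall>n. \<exists>k. \<forall>i<N. x (n - int k - int i) \<in> E"
proof -
  interpret mu: prob_space \<mu> by fact
  interpret P: prob_space "iid \<mu>" by (intro prob_space_iid mu)
  note sets_P[measurable_cong] = sets_iid[OF mu(2)]
  have "AE x in iid \<mu>. \<exists>k. \<forall>i<N. x (n - int k - int i) \<in> E" for n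
  proof -
    define f where "f = (\<lambda>(b, i). n - int (b * N) - int i)"
    define K where "K b = {n - int (b * N) - int i | i. i < N}" for b
    define G where "G b = {x. \<forall>j\<in>K b. x j \<in> E}" for b
    have fin: "finite (K b)" for b unfolding K_def by simp
    have cardK: "card (K b) = N" for b
    proof -
      have "K b = (\<lambda>i. n - int (b * N) - int i) ` {..<N}" by (auto simp: K_def)
      also have "card \<dots> = N" by (subst card_image) (auto simp: inj_on_def)
      finally show ?thesis .
    qed
    have dis: "disjoint_family K"
      unfolding disjoint_family_on_def
    proof (intro ballI impI)
      have *: "K b \<inter> K c = {}" if "b < c" for b c
      proof -
        from that have "(b + 1) * N \<le> c * N" by (intro mult_right_mono) auto
        then have "b * N + N \<le> c * N" by simp
        then have "n - int (b * N) - int i > n - int (c * N) - int i'" if "i < N" for i i' using that by linarith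
        then show ?thesis unfolding K_def by fastforce
      qed
      fix b c :: nat assume "b \<noteq> c"
      then show "K b \<inter> K c = {}" using *[of b c] *[of c b] by (cases "b < c") auto
    qed
    have G[measurable]: "G b \<in> sets (iid borel)" for b
      unfolding G_def using fin E by (intro sets_cylinder)
    define p where "p = measure \<mu> E"
    have p: "0 < p" using E(2) by (simp add: p_def mu.emeasure_eq_measure)
    have PG: "P.prob (G b) = p ^ N" for b
    proof -
      have "emeasure (iid \<mu>) (G b) = (\<Prod>j\<in>K b. emeasure \<mu> E)"
        unfolding G_def using fin E by (intro emeasure_iid_cylinder mu)
      also have "\<dots> = ennreal (p ^ N)"
        by (simp add: cardK p_def mu.emeasure_eq_measure ennreal_power)
      finally show ?thesis by (simp add: P.emeasure_eq_measure p_def)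
    qed
    have "P.indep_vars (\<lambda>_. borel) (\<lambda>i x. x i) (UNIV :: int set)"
      using indep_coordinates[OF mu, of id] by simp
    then have "P.indep_vars (\<lambda>b. PiM (K b) (\<lambda>_. borel)) (\<lambda>b x. restrict (\<lambda>i. x i) (K b)) UNIV"
      by (rule P.indep_vars_restrict) (use dis in auto)
    then have "P.indep_vars (\<lambda>_. count_space UNIV) (\<lambda>b x. (\<lambda>y. \<forall>j\<in>K b. y j \<in> E) (restrict (\<lambda>i. x i) (K b))) UNIV"
    proof (rule P.indep_vars_compose2)
      fix b
      have "{y \<in> space (PiM (K b) (\<lambda>_. borel :: real measure)). \<forall>j\<in>K b. y j \<in> E} \<in> sets (PiM (K b) (\<lambda>_. borel))"
      proof (cases "K b = {}")
        case False
        have "{y \<in> space (PiM (K b) (\<lambda>_. borel :: real measure)). y j \<in> E} \<in> sets (PiM (K b) (\<lambda>_. borel))" if "j \<in> K b" for j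
          using that E(1) by measurable
        from sets.sets_Collect_finite_All'[OF this fin False] show ?thesis .
      qed simp
      then show "(\<lambda>y. \<forall>j\<in>K b. y j \<in> E) \<in> PiM (K b) (\<lambda>_. borel) \<rightarrow>\<^sub>M count_space UNIV"
        by (simp add: pred_def)
    qed
    then have ind: "P.indep_vars (\<lambda>_. count_space UNIV) (\<lambda>b x. x \<in> G b) UNIV"
      by (simp add: G_def)
    have zero: "P.prob (\<Inter>b. UNIV - G b) \<le> (1 - p ^ N) ^ Suc m" for m
    proof -
      have "P.prob (\<Inter>b\<in>{..m}. (\<lambda>x. x \<in> G b) -` {False} \<inter> space (iid \<mu>)) =
          (\<Prod>b\<in>{..m}. P.prob ((\<lambda>x. x \<in> G b) -` {False} \<inter> space (iid \<mu>)))"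
        by (rule P.indep_varsD[OF ind]) auto
      moreover have "(\<lambda>x. x \<in> G b) -` {False} \<inter> space (iid \<mu>) = space (iid \<mu>) - G b" for b by auto
      moreover have "P.prob (space (iid \<mu>) - G b) = 1 - p ^ N" for b
        using G by (subst P.prob_compl) (simp_all add: PG sets_P)
      ultimately have "P.prob (\<Inter>b\<in>{..m}. space (iid \<mu>) - G b) = (1 - p ^ N) ^ Suc m"
        by simp
      moreover have "P.prob (\<Inter>b. UNIV - G b) \<le> P.prob (\<Inter>b\<in>{..m}. space (iid \<mu>) - G b)"
      proof (rule P.finite_measure_mono)
        have "space (iid \<mu>) - G b \<in> sets (iid \<mu>)" for b
          using G by (intro sets.compl_sets) (simp add: sets_P)
        then show "(\<Inter>b\<in>{..m}. space (iid \<mu>) - G b) \<in> sets (iid \<mu>)"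
          by (intro sets.finite_INT) auto
      qed (auto simp: space_iid[OF mu(2)])
      ultimately show ?thesis by simp
    qed
    have pN: "0 < p ^ N" "p ^ N \<le> 1" using p PG[of 0] P.prob_le_1[of "G 0"] by auto
    have "(\<lambda>m. (1 - p ^ N) ^ Suc m) \<longlonglongrightarrow> 0"
      using pN by (intro LIMSEQ_Suc LIMSEQ_power_zero) auto
    then have "P.prob (\<Inter>b. UNIV - G b) \<le> 0"
      by (rule LIMSEQ_le_const) (use zero in auto)
    moreover have Im: "(\<Inter>b. UNIV - G b) \<in> sets (iid \<mu>)"
    proof -
      have "UNIV - G b \<in> sets (iid \<mu>)" for b
        using sets.compl_sets[OF G[of b]] by (simp add: sets_P)
      then show ?thesis by (intro sets.countable_INT) blast+
    qed
    ultimately have "(\<Inter>b. UNIV - G b) \<in> null_sets (iid \<mu>)"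
      by (intro null_setsI) (auto simp: P.emeasure_eq_measure measure_le_0_iff)
    from AE_not_in[OF this] show ?thesis
    proof eventually_elim
      case (elim x)
      then obtain b where "x \<in> G b" by auto
      then have "\<forall>i<N. x (n - int (b * N) - int i) \<in> E" by (auto simp: G_def K_def)
      then show ?case by blast
    qed
  qed
  then show ?thesis by (simp add: AE_all_countable)
qed

lemma AE_strongly_coalesces:
  assumes "prob_space \<mu>" "sets \<mu> = sets borel" "E \<in> sets borel" "emeasure \<mu> E > 0"
    and const: "\<And>x n w w'. (\<And>i. i < N \<Longrightarrow> x (n - int i) \<in> E) \<Longrightarrow> run F N x n w = run F N x n w'"
  shows "AE x in iid \<mu>. strongly_coalesces F x"
  using AE_block[OF assms(1-4), of N]
proof eventually_elim
  case (elim x)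
  show ?case unfolding strongly_coalesces_def
  proof
    fix n
    from elim obtain k where "\<forall>i<N. x (n - int k - int i) \<in> E" by blast
    then have "run F (k + N) x n w = run F (k + N) x n w'" for w w'
      unfolding run_add using const[of x "n - int k"] by metis
    then show "\<exists>k. \<forall>w w'. run F k x n w = run F k x n w'" by blast
  qed
qed

lemma AE_partial_sums_at_bot:
  assumes mu: "prob_space \<mu>" "sets \<mu> = sets borel" and g[measurable]: "g \<in> borel_measurable borel"
    and h: "h > 0" "(\<integral>\<^sup>+x. ennreal (exp (h * g x)) \<partial>\<mu>) < 1" and f: "inj f"
  shows "AE x in iid \<mu>. filterlim (\<lambda>k. \<Sum>i<k. g (x (f i))) at_bot sequentially"
proof -
  interpret mu: prob_space \<mu> by fact
  interpret P: prob_space "iid \<mu>" by (intro prob_space_iid mu)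
  note sets_P[measurable_cong] = sets_iid[OF mu(2)]
  note [measurable_cong] = mu(2)
  obtain r where r: "(\<integral>\<^sup>+x. ennreal (exp (h * g x)) \<partial>\<mu>) = ennreal r" "0 \<le> r" "r < 1"
  proof (cases "\<integral>\<^sup>+x. ennreal (exp (h * g x)) \<partial>\<mu>")
    case (real r)
    with h(2) have "r < 1" by (simp add: ennreal_less_one_iff)
    with real that show ?thesis by blast
  next
    case top
    with h(2) show ?thesis by simp
  qed
  let ?S = "\<lambda>k x. \<Sum>i<k. g (x (f i))"
  have mgf: "(\<integral>\<^sup>+x. ennreal (exp (h * ?S k x)) \<partial>iid \<mu>) = ennreal (r ^ k)" for k
  proof -
    have ind: "P.indep_vars (\<lambda>_. borel) (\<lambda>i x. ennreal (exp (h * g (x (f i))))) {..<k}"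
    proof -
      have "P.indep_vars (\<lambda>_. borel) (\<lambda>i x. x (f i)) {..<k}"
        by (rule P.indep_vars_subset[OF indep_coordinates[OF mu f]]) simp
      then show ?thesis by (rule P.indep_vars_compose2) measurable
    qed
    have "(\<integral>\<^sup>+x. ennreal (exp (h * ?S k x)) \<partial>iid \<mu>) = (\<integral>\<^sup>+x. (\<Prod>i<k. ennreal (exp (h * g (x (f i))))) \<partial>iid \<mu>)"
      by (simp add: sum_distrib_left exp_sum prod_ennreal)
    also have "\<dots> = (\<Prod>i<k. \<integral>\<^sup>+x. ennreal (exp (h * g (x (f i)))) \<partial>iid \<mu>)"
      by (rule P.indep_vars_nn_integral[OF _ ind]) auto
    also have "\<dots> = (\<Prod>i<k. \<integral>\<^sup>+x. ennreal (exp (h * g x)) \<partial>distr (iid \<mu>) \<mu> (\<lambda>x. x (f i)))"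
      by (subst nn_integral_distr) auto
    also have "\<dots> = (\<Prod>i<k. \<integral>\<^sup>+x. ennreal (exp (h * g x)) \<partial>\<mu>)"
      using mu(1) by (subst distr_PiM_component) auto
    also have "\<dots> = ennreal (r ^ k)" using r by (simp add: ennreal_power)
    finally show ?thesis .
  qed
  have "AE x in iid \<mu>. \<forall>\<^sub>F k in sequentially. x \<in> space (iid \<mu>) - {x \<in> space (iid \<mu>). - real a \<le> ?S k x}" for a :: nat
  proof (rule borel_cantelli_AE1)
    let ?A = "\<lambda>k. {x \<in> space (iid \<mu>). - real a \<le> ?S k x}"
    show A: "?A k \<in> sets (iid \<mu>)" for k by measurable
    have le: "P.prob (?A k) \<le> exp (h * a) * r ^ k" for k
    proof -
      have "emeasure (iid \<mu>) (?A k) = (\<integral>\<^sup>+x. indicator (?A k) x \<partial>iid \<mu>)"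
        using A by simp
      also have "\<dots> \<le> (\<integral>\<^sup>+x. ennreal (exp (h * a)) * ennreal (exp (h * ?S k x)) \<partial>iid \<mu>)"
      proof (rule nn_integral_mono)
        fix x
        have "1 \<le> exp (h * a) * exp (h * ?S k x)" if "- real a \<le> ?S k x"
        proof -
          have "0 \<le> h * (a + ?S k x)" using that h(1) by (intro mult_nonneg_nonneg) auto
          then show ?thesis by (simp add: exp_add[symmetric] algebra_simps)
        qed
        then show "indicator (?A k) x \<le> ennreal (exp (h * a)) * ennreal (exp (h * ?S k x))"
          by (auto simp: indicator_def ennreal_mult[symmetric])
      qed
      also have "\<dots> = ennreal (exp (h * a)) * ennreal (r ^ k)"
        by (subst nn_integral_cmult) (simp_all add: mgf)
      also have "\<dots> = ennreal (exp (h * a) * r ^ k)" using r by (simp add: ennreal_mult)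
      finally show ?thesis using r by (simp add: P.emeasure_eq_measure)
    qed
    show "emeasure (iid \<mu>) (?A k) < \<infinity>" for k by (simp add: P.emeasure_eq_measure)
    show "summable (\<lambda>k. P.prob (?A k))"
    proof (rule summable_comparison_test')
      show "summable (\<lambda>k. exp (h * a) * r ^ k)"
        using r by (intro summable_mult summable_geometric) auto
      show "norm (P.prob (?A k)) \<le> exp (h * a) * r ^ k" if "k \<ge> 0" for k using le by simp
    qed
  qed
  then have "AE x in iid \<mu>. \<forall>a. \<forall>\<^sub>F k in sequentially. x \<in> space (iid \<mu>) - {x \<in> space (iid \<mu>). - real a \<le> ?S k x}"
    by (simp only: AE_all_countable) auto
  then show ?thesis
  proof eventually_elim
    case (elim x)
    show ?case unfolding filterlim_at_bot
    proof
      fix Z :: real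
      obtain a :: nat where "- Z \<le> real a" using real_arch_simple by blast
      with elim[rule_format, of a] show "\<forall>\<^sub>F k in sequentially. ?S k x \<le> Z"
        by (auto elim!: eventually_mono simp: space_iid[OF mu(2)])
    qed
  qed
qed

section \<open>Coalescence for the ultra-discrete KdV map\<close>

lemma mx_ereal[simp]: "mx (ereal a) s = max (s - a) 0"
  and mx_infty[simp]: "mx \<infinity> s = 0"
  by (simp_all add: mx_def)

lemma F_udK_eq: "F_udK A B (x, u) = (u - (mx A (x + u) - mx B (x + u)), x + (mx A (x + u) - mx B (x + u)))"
  by (simp add: F_udK_def)

lemma measurable_mx[measurable]: "mx A \<in> borel_measurable borel"
  unfolding mx_def by (cases A) simp_all

lemma measurable_F_udK[measurable]: "F_udK A B \<in> borel \<Otimes>\<^sub>M borel \<rightarrow>\<^sub>M borel \<Otimes>\<^sub>M borel"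
  unfolding F_udK_def split_beta' by measurable

lemma dual_F_udK: "dual (F_udK A B) = F_udK B A"
  by (simp add: dual_def fun_eq_iff F_udK_eq add.commute)

lemma F_udK_involution: "F_udK A B (F_udK A B p) = p"
  by (cases p) (simp add: F_udK_eq algebra_simps)

lemma mx_diff_mono:
  assumes "J \<noteq> -\<infinity>" "J \<le> K" "s \<le> t"
  shows "mx J s - mx K s \<le> mx J t - mx K t"
  using assms by (cases J; cases K) auto

lemma carrier_monotone_F_udK:
  assumes "J \<noteq> -\<infinity>" "J \<le> K"
  shows "carrier_monotone (F_udK J K)" "carrier_monotone (F_udK K J)"
proof -
  have "mono (\<lambda>w. snd (F_udK J K (x, w)))" "antimono (\<lambda>w. snd (F_udK K J (x, w)))" for x
    using mx_diff_mono[OF assms, of "x + v" "x + w" for v w]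
    by (auto simp: mono_def antimono_def F_udK_eq intro!: monoI antimonoI; smt (verit))+
  then show "carrier_monotone (F_udK J K)" "carrier_monotone (F_udK K J)"
    by (auto simp: carrier_monotone_def)
qed

lemma run_const_equal: "run (F_udK J J) 1 x n w = run (F_udK J J) 1 x n w'"
  by (simp add: F_udK_eq)

lemma run_const_dual_low:
  assumes "ereal j \<le> K" "x n \<le> j / 2" "x (n - 1) \<le> j / 2"
  shows "run (F_udK K (ereal j)) 2 x n w = x n"
  using assms by (cases K) (auto simp: F_udK_eq numeral_2_eq_2 max_def)

lemma run_const_dual_high:
  assumes "j \<le> k" "k - j / 2 \<le> x n" "k - j / 2 \<le> x (n - 1)"
  shows "run (F_udK (ereal k) (ereal j)) 2 x n w = x n - (k - j)"
proof -
  let ?v = "snd (F_udK (ereal k) (ereal j) (x (n - 1), w))"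
  have "?v \<ge> x (n - 1) - (k - j)" using assms(1) by (auto simp: F_udK_eq max_def)
  then have "x n + ?v \<ge> k" using assms by simp
  then have "snd (F_udK (ereal k) (ereal j) (x n, ?v)) = x n - (k - j)"
    using assms(1) unfolding F_udK_eq by (simp add: max_def)
  then show ?thesis by (simp add: numeral_2_eq_2)
qed

lemma run_mono:
  assumes "J \<noteq> -\<infinity>" "J \<le> K" "w \<le> w'"
  shows "run (F_udK J K) k x n w \<le> run (F_udK J K) k x n w'"
proof (induction k arbitrary: n)
  case (Suc k)
  then show ?case
    using mx_diff_mono[OF assms(1,2), of "x n + run (F_udK J K) k x (n - 1) w" "x n + run (F_udK J K) k x (n - 1) w'"]
    by (simp add: F_udK_eq)
qed (use assms in simp)

text \<open>Two carriers separated by an unclipped stretch both move by \<open>2 x - j\<close> per site, so they would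
  leave the window \<open>[x, x + k - j]\<close> forced by the last step; hence they meet.\<close>
lemma run_const_down:
  assumes jk: "j \<le> k" and r: "r > 0" and N: "real N > r * (r + j / 2 + k - j) / 2"
    and x: "\<And>i. i < Suc N \<Longrightarrow> - r \<le> x (n - int i) \<and> x (n - int i) \<le> j / 2 - 1 / r"
  shows "run (F_udK (ereal j) (ereal k)) (Suc N) x n w = run (F_udK (ereal j) (ereal k)) (Suc N) x n w'"
proof -
  let ?F = "F_udK (ereal j) (ereal k)"
  have F: "snd (?F (y, v)) = y + (max (y + v - j) 0 - max (y + v - k) 0)" for y v by (simp add: F_udK_eq)
  have claim: "run ?F (Suc i) x n w = run ?F (Suc i) x n w' \<or> run ?F (Suc i) x n w' \<le> j / 2 + k - j - 2 * real i / r"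
    if "w \<le> w'" "\<And>l. l < Suc i \<Longrightarrow> - r \<le> x (n - int l) \<and> x (n - int l) \<le> j / 2 - 1 / r" for i n w w'
    using that
  proof (induction i arbitrary: n)
    case 0
    have "x n \<le> j / 2 - 1 / r" using 0(2)[of 0] by simp
    moreover have "1 / r > 0" using r by simp
    ultimately have "x n \<le> j / 2" by linarith
    moreover have "max (x n + w' - j) 0 - max (x n + w' - k) 0 \<le> k - j" using jk by (auto simp: max_def)
    ultimately have "snd (?F (x n, w')) \<le> j / 2 + k - j" unfolding F by linarith
    then show ?case by simp
  next
    case (Suc i)
    let ?v = "run ?F (Suc i) x (n - 1) w" and ?v' = "run ?F (Suc i) x (n - 1) w'"
    have xn: "x n \<le> j / 2 - 1 / r" using Suc.prems(2)[of 0] by simp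
    have "- r \<le> x (n - 1 - int l) \<and> x (n - 1 - int l) \<le> j / 2 - 1 / r" if "l < Suc i" for l
      using Suc.prems(2)[of "Suc l"] that by (simp add: algebra_simps)
    from Suc.IH[OF Suc.prems(1) this] have IH: "?v = ?v' \<or> ?v' \<le> j / 2 + k - j - 2 * real i / r" .
    have le: "?v \<le> ?v'" by (rule run_mono) (use jk Suc.prems(1) in auto)
    have rs: "run ?F (Suc (Suc i)) x n u = snd (?F (x n, run ?F (Suc i) x (n - 1) u))" for u by simp
    show ?case
    proof (cases "x n + ?v' \<le> j")
      case True
      with le have "x n + ?v \<le> j" by simp
      with True have "snd (?F (x n, ?v)) = snd (?F (x n, ?v'))" using jk by (simp add: F)
      then show ?thesis unfolding rs by simp
    next
      case False
      then have "snd (?F (x n, ?v')) \<le> 2 * x n + ?v' - j" by (simp add: F)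
      also have "\<dots> \<le> ?v' - 2 / r" using xn by simp
      finally have "snd (?F (x n, ?v')) \<le> ?v' - 2 / r" .
      moreover have "2 * real (Suc i) / r = 2 * real i / r + 2 / r" by (simp add: add_divide_distrib algebra_simps)
      ultimately show ?thesis using IH unfolding rs by (smt (verit))
    qed
  qed
  have main: "run ?F (Suc N) x n w = run ?F (Suc N) x n w'" if "w \<le> w'" for w w'
  proof -
    have "- r \<le> x n" using x[of 0] by simp
    also have "x n \<le> run ?F (Suc N) x n w'" using jk by (simp add: F)
    finally have "- r \<le> run ?F (Suc N) x n w'" .
    moreover have "j / 2 + k - j - 2 * real N / r < - r"
    proof -
      have "2 * real N / r > r + j / 2 + k - j" using r N by (simp add: field_simps)
      then show ?thesis by simp
    qed
    moreover have "run ?F (Suc N) x n w = run ?F (Suc N) x n w' \<or>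
        run ?F (Suc N) x n w' \<le> j / 2 + k - j - 2 * real N / r"
      by (rule claim[OF that x])
    ultimately show ?thesis by linarith
  qed
  show ?thesis using main[of w w'] main[of w' w, symmetric] by (rule linorder_le_cases[of w w'])
qed

lemma run_reflect:
  "run (F_udK (ereal j) (ereal k)) N x n w =
    (k - j) - run (F_udK (ereal (- j)) (ereal (k - 2 * j))) N (\<lambda>i. - x i) n (k - j - w)"
proof (induction N arbitrary: n)
  case (Suc N)
  show ?case unfolding run.simps Suc F_udK_eq by (auto simp: max_def)
qed simp

lemma run_const_up:
  assumes jk: "j \<le> k" and r: "r > 0" and N: "real N > r * (r - 3 * j / 2 + k) / 2"
    and x: "\<And>i. i < Suc N \<Longrightarrow> j / 2 + 1 / r \<le> x (n - int i) \<and> x (n - int i) \<le> r"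
  shows "run (F_udK (ereal j) (ereal k)) (Suc N) x n w = run (F_udK (ereal j) (ereal k)) (Suc N) x n w'"
proof -
  have "run (F_udK (ereal (- j)) (ereal (k - 2 * j))) (Suc N) (\<lambda>i. - x i) n (k - j - w) =
      run (F_udK (ereal (- j)) (ereal (k - 2 * j))) (Suc N) (\<lambda>i. - x i) n (k - j - w')"
  proof (rule run_const_down[where r = r])
    have "r + - j / 2 + (k - 2 * j) - - j = r - 3 * j / 2 + k" by simp
    with N show "real N > r * (r + - j / 2 + (k - 2 * j) - - j) / 2" by (simp only:)
    show "- r \<le> - x (n - int i) \<and> - x (n - int i) \<le> - j / 2 - 1 / r" if "i < Suc N" for i
      using x[OF that] by linarith
  qed (use jk r in auto)
  then show ?thesis by (simp only: run_reflect[of j k])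
qed

section \<open>The case \<open>K = \<infinity>\<close>\<close>

definition drift_sum :: "real \<Rightarrow> (int \<Rightarrow> real) \<Rightarrow> int \<Rightarrow> nat \<Rightarrow> real" where
  "drift_sum j x n k = (\<Sum>i<k. 2 * x (n - int i) - j)"

lemma drift_sum_Suc: "drift_sum j x n (Suc k) = (2 * x n - j) + drift_sum j x (n - 1) k"
  unfolding drift_sum_def sum.lessThan_Suc_shift by (simp add: algebra_simps)

lemma run_infty_step:
  "run (F_udK (ereal j) \<infinity>) (Suc k) x n w = max (x n) (2 * x n - j + run (F_udK (ereal j) \<infinity>) k x (n - 1) w)"
  by (simp add: F_udK_eq max_def)

lemma run_infty_ge_reset:
  "i < k \<Longrightarrow> x (n - int i) + drift_sum j x n i \<le> run (F_udK (ereal j) \<infinity>) k x n w"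
proof (induction k arbitrary: n i)
  case (Suc k)
  show ?case
  proof (cases i)
    case 0
    then show ?thesis unfolding run_infty_step by (simp add: drift_sum_def)
  next
    case (Suc l)
    then have "x (n - 1 - int l) + drift_sum j x (n - 1) l \<le> run (F_udK (ereal j) \<infinity>) k x (n - 1) w"
      using Suc.IH Suc.prems by simp
    then have "x (n - int i) + drift_sum j x n i \<le> 2 * x n - j + run (F_udK (ereal j) \<infinity>) k x (n - 1) w"
      unfolding Suc drift_sum_Suc by (simp add: algebra_simps)
    then show ?thesis unfolding run_infty_step by linarith
  qed
qed simp

lemma run_infty_cases:
  "run (F_udK (ereal j) \<infinity>) k x n w = w + drift_sum j x n k \<or>
    (\<exists>i<k. run (F_udK (ereal j) \<infinity>) k x n w = x (n - int i) + drift_sum j x n i)"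
proof (induction k arbitrary: n)
  case 0
  then show ?case by (simp add: drift_sum_def)
next
  case (Suc k)
  let ?r = "run (F_udK (ereal j) \<infinity>)"
  show ?case
  proof (cases "x n \<ge> 2 * x n - j + ?r k x (n - 1) w")
    case True
    then have "?r (Suc k) x n w = x (n - int 0) + drift_sum j x n 0"
      unfolding run_infty_step by (simp add: drift_sum_def)
    then show ?thesis by blast
  next
    case False
    then have step: "?r (Suc k) x n w = 2 * x n - j + ?r k x (n - 1) w" unfolding run_infty_step by simp
    from Suc[of "n - 1"] show ?thesis
    proof
      assume "?r k x (n - 1) w = w + drift_sum j x (n - 1) k"
      then show ?thesis unfolding step drift_sum_Suc by simp
    next
      assume "\<exists>i<k. ?r k x (n - 1) w = x (n - 1 - int i) + drift_sum j x (n - 1) i"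
      then obtain i where "i < k" "?r k x (n - 1) w = x (n - 1 - int i) + drift_sum j x (n - 1) i" by blast
      then have "Suc i < Suc k" "?r (Suc k) x n w = x (n - int (Suc i)) + drift_sum j x n (Suc i)"
        unfolding step drift_sum_Suc by (simp_all add: algebra_simps)
      then show ?thesis by blast
    qed
  qed
qed

definition subcritical :: "real \<Rightarrow> real \<Rightarrow> (int \<Rightarrow> real) \<Rightarrow> bool" where
  "subcritical j b x \<longleftrightarrow> (\<forall>n. x n \<le> b) \<and> (\<forall>n. filterlim (drift_sum j x n) at_bot sequentially)"

lemma subcritical_carrier_lim:
  assumes x: "subcritical j b x"
  shows "coalesces (F_udK (ereal j) \<infinity>) x"
    and "\<exists>i. carrier_lim (F_udK (ereal j) \<infinity>) x n = x (n - int i) + drift_sum j x n i"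
    and "x (n - int i) + drift_sum j x n i \<le> carrier_lim (F_udK (ereal j) \<infinity>) x n"
proof -
  let ?a = "\<lambda>n i. x (n - int i) + drift_sum j x n i"
  have "\<exists>m. \<forall>i. ?a n i \<le> ?a n m" for n
  proof -
    have "\<forall>\<^sub>F i in sequentially. drift_sum j x n i \<le> ?a n 0 - b"
      using x by (simp add: subcritical_def filterlim_at_bot)
    then obtain I where I: "\<And>i. i \<ge> I \<Longrightarrow> drift_sum j x n i \<le> ?a n 0 - b"
      by (auto simp: eventually_sequentially)
    have "Max (?a n ` {..I}) \<in> ?a n ` {..I}" by (intro Max_in) auto
    then obtain m where "m \<in> {..I}" "Max (?a n ` {..I}) = ?a n m" by blast
    then have m: "?a n i \<le> ?a n m" if "i \<le> I" for i
      using Max_ge[of "?a n ` {..I}" "?a n i"] that by auto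
    have "?a n i \<le> ?a n m" for i
    proof (cases "i \<le> I")
      case False
      then have "?a n i \<le> ?a n 0" using I[of i] x by (smt (verit) nat_le_linear subcritical_def)
      also have "\<dots> \<le> ?a n m" by (rule m) simp
      finally show ?thesis .
    qed (use m in auto)
    then show ?thesis by blast
  qed
  then obtain m where m: "\<And>n i. ?a n i \<le> ?a n (m n)" by metis
  have ev: "\<forall>\<^sub>F k in sequentially. run (F_udK (ereal j) \<infinity>) k x n w = ?a n (m n)" for n w
  proof -
    have "\<forall>\<^sub>F k in sequentially. drift_sum j x n k \<le> ?a n (m n) - w - 1"
      using x by (simp add: subcritical_def filterlim_at_bot)
    moreover have "\<forall>\<^sub>F k in sequentially. m n < k" by (rule eventually_gt_at_top)
    ultimately show ?thesis
    proof eventually_elim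
      case (elim k)
      have "?a n (m n) \<le> run (F_udK (ereal j) \<infinity>) k x n w" by (rule run_infty_ge_reset[OF elim(2)])
      then show ?case using run_infty_cases[of j k x n w] m[of n] elim(1) by (smt (verit))
    qed
  qed
  show "coalesces (F_udK (ereal j) \<infinity>) x" by (rule coalescesI(1)[OF ev])
  have "carrier_lim (F_udK (ereal j) \<infinity>) x n = ?a n (m n)" by (rule coalescesI(2)[OF ev])
  then show "\<exists>i. carrier_lim (F_udK (ereal j) \<infinity>) x n = x (n - int i) + drift_sum j x n i"
    and "x (n - int i) + drift_sum j x n i \<le> carrier_lim (F_udK (ereal j) \<infinity>) x n"
    using m by auto
qed

text \<open>A carrier other than the limiting one is never clipped to the left of some site, so there it turns
  \<open>x\<close> into \<open>j - x\<close>; the drift changes sign and the new configuration has no finite carrier.\<close>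
lemma subcritical_carrier_unique:
  assumes x: "subcritical j b x" and U: "carrier_ok (ereal j) \<infinity> x U"
    and y: "\<And>n. y n = fst (F_udK (ereal j) \<infinity> (x n, U (n - 1)))" and V: "carrier_ok (ereal j) \<infinity> y V"
  shows "U = carrier_lim (F_udK (ereal j) \<infinity>) x"
proof (rule ccontr)
  let ?c = "carrier_lim (F_udK (ereal j) \<infinity>) x"
  assume "U \<noteq> ?c"
  then obtain n where n: "U n \<noteq> ?c n" by blast
  have Uk: "U n = run (F_udK (ereal j) \<infinity>) k x n (U (n - int k))" for k by (rule carrier_ok_run[OF U])
  obtain m where m: "?c n = x (n - int m) + drift_sum j x n m" using subcritical_carrier_lim(2)[OF x] by blast
  have "?c n \<le> U n" unfolding m Uk[of "Suc m"] by (rule run_infty_ge_reset) simp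
  with n have gt: "?c n < U n" by simp
  have lin: "U n = U (n - int k) + drift_sum j x n k" for k
    using run_infty_cases[of j k x n "U (n - int k)"] subcritical_carrier_lim(3)[OF x, of n] gt Uk[of k]
    by (smt (verit))
  have yx: "y (n - int i) = j - x (n - int i)" for i
  proof -
    have "U (n - int i) - U (n - int (Suc i)) = drift_sum j x n (Suc i) - drift_sum j x n i"
      using lin[of i] lin[of "Suc i"] by simp
    also have "\<dots> = 2 * x (n - int i) - j" by (simp add: drift_sum_def)
    finally have "U (n - int i) = U (n - int i - 1) + 2 * x (n - int i) - j" by (simp add: algebra_simps)
    moreover have "snd (F_udK (ereal j) \<infinity> (x (n - int i), U (n - int i - 1))) = U (n - int i)"
      using U by (simp add: carrier_ok_def)
    ultimately show ?thesis unfolding y by (simp add: F_udK_eq)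
  qed
  have dy: "drift_sum j y n k = - drift_sum j x n k" for k
    unfolding drift_sum_def yx by (simp add: sum_negf[symmetric] algebra_simps)
  have "\<forall>\<^sub>F k in sequentially. drift_sum j x n k \<le> j - b - V n - 1"
    using x by (simp add: subcritical_def filterlim_at_bot)
  then obtain k where k: "drift_sum j x n k \<le> j - b - V n - 1" by (auto simp: eventually_sequentially)
  have "y (n - int k) + drift_sum j y n k \<le> run (F_udK (ereal j) \<infinity>) (Suc k) y n (V (n - int (Suc k)))"
    by (rule run_infty_ge_reset) simp
  also have "\<dots> = V n" by (rule carrier_ok_run[OF V, symmetric])
  finally have "j - x (n - int k) - drift_sum j x n k \<le> V n" by (simp add: yx dy)
  moreover have "x (n - int k) \<le> b" using x by (simp add: subcritical_def)
  ultimately show False using k by linarith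
qed

definition reflect :: "(int \<Rightarrow> real) \<Rightarrow> int \<Rightarrow> real" where
  "reflect x = (\<lambda>n. x (- n))"

definition evolve_back :: "(real \<times> real \<Rightarrow> real \<times> real) \<Rightarrow> (int \<Rightarrow> real) \<Rightarrow> int \<Rightarrow> real" where
  "evolve_back F x = reflect (evolve F (reflect x))"

lemma reflect_reflect[simp]: "reflect (reflect x) = x"
  by (simp add: reflect_def)

lemma F_udK_swap_sides:
  "F_udK A B p = q \<longleftrightarrow> F_udK A B q = p"
  using F_udK_involution by metis

lemma fam_ok_reflect:
  assumes "fam_ok A B x (X, U)"
  shows "carrier_ok A B (\<lambda>n. X n t) (\<lambda>n. U n t)"
    and "X n (t + 1) = fst (F_udK A B (X n t, U (n - 1) t))"
    and "carrier_ok A B (reflect (\<lambda>n. X n (t + 1))) (\<lambda>n. U (- n - 1) t)"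
    and "reflect (\<lambda>n. X n t) n = fst (F_udK A B (reflect (\<lambda>n. X n (t + 1)) n, U (- (n - 1) - 1) t))"
proof -
  have eq: "F_udK A B (X n t, U (n - 1) t) = (X n (t + 1), U n t)" for n t
    using assms by (simp add: fam_ok_def)
  then have eq': "F_udK A B (X n (t + 1), U n t) = (X n t, U (n - 1) t)" for n t
    using F_udK_swap_sides by blast
  show "carrier_ok A B (\<lambda>n. X n t) (\<lambda>n. U n t)" "X n (t + 1) = fst (F_udK A B (X n t, U (n - 1) t))"
    by (simp_all add: carrier_ok_def eq)
  show "carrier_ok A B (reflect (\<lambda>n. X n (t + 1))) (\<lambda>n. U (- n - 1) t)"
    "reflect (\<lambda>n. X n t) n = fst (F_udK A B (reflect (\<lambda>n. X n (t + 1)) n, U (- (n - 1) - 1) t))"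
    by (simp_all add: carrier_ok_def reflect_def eq')
qed

lemma subcritical_T_regular:
  fixes j b :: real
  defines "F \<equiv> F_udK (ereal j) \<infinity>"
  assumes fwd: "\<And>t. subcritical j b ((evolve F ^^ t) x)"
    and bwd: "\<And>t. subcritical j b (reflect ((evolve_back F ^^ t) x))"
  shows "T_regular (ereal j) \<infinity> x"
proof -
  define X where "X n t = (if 0 \<le> t then (evolve F ^^ nat t) x n else (evolve_back F ^^ nat (- t)) x n)" for n t
  define U where "U n t = (if 0 \<le> t then carrier_lim F ((evolve F ^^ nat t) x) n
      else carrier_lim F (reflect ((evolve_back F ^^ nat (- t - 1)) x)) (- n - 1))" for n t
  have "fam_ok (ereal j) \<infinity> x (X, U)"
    unfolding fam_ok_def prod.case
  proof (intro conjI allI)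
    show "X n 0 = x n" for n by (simp add: X_def)
    fix n t
    show "F_udK (ereal j) \<infinity> (X n t, U (n - 1) t) = (X n (t + 1), U n t)"
    proof (cases "0 \<le> t")
      case True
      let ?y = "(evolve F ^^ nat t) x"
      have "carrier_lim F ?y n = snd (F (?y n, carrier_lim F ?y (n - 1)))"
        unfolding F_def using fwd[of "nat t"] by (intro carrier_lim_step subcritical_carrier_lim(1)) (simp add: F_def)
      moreover have "nat (t + 1) = Suc (nat t)" using True by simp
      ultimately show ?thesis using True by (simp add: X_def U_def evolve_def[of F ?y n] F_def[symmetric])
    next
      case False
      define s where "s = nat (- t - 1)"
      let ?y = "(evolve_back F ^^ s) x"
      have s: "nat (- t) = Suc s" "nat (- t - 1) = s" using False by (auto simp: s_def)
      have Xt: "X n t = fst (F (?y n, carrier_lim F (reflect ?y) (- n - 1)))"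
        using False s by (simp add: X_def evolve_back_def[of F ?y] reflect_def[of "evolve F (reflect ?y)"]
            evolve_def[of F "reflect ?y"]) (simp add: reflect_def)
      have "carrier_lim F (reflect ?y) (- n) = snd (F (reflect ?y (- n), carrier_lim F (reflect ?y) (- n - 1)))"
        unfolding F_def using bwd[of s] by (intro carrier_lim_step subcritical_carrier_lim(1)) (simp add: F_def)
      then have Ut: "U (n - 1) t = snd (F (?y n, carrier_lim F (reflect ?y) (- n - 1)))"
        using False s by (simp add: U_def reflect_def)
      have X1: "X n (t + 1) = ?y n"
      proof (cases "t = - 1")
        case True
        then show ?thesis by (simp add: X_def s_def)
      next
        case neq: False
        have "nat (- (t + 1)) = s" unfolding s_def by (rule arg_cong[of _ _ nat]) simp
        moreover have "\<not> 0 \<le> t + 1" using False neq by simp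
        ultimately show ?thesis by (simp only: X_def if_False)
      qed
      have U1: "U n t = carrier_lim F (reflect ?y) (- n - 1)" using False s by (simp add: U_def)
      have "F (?y n, carrier_lim F (reflect ?y) (- n - 1)) = (X n t, U (n - 1) t)"
        unfolding Xt Ut by simp
      then show ?thesis unfolding X1 U1 F_def by (subst F_udK_swap_sides)
    qed
  qed
  moreover have "XU = (X, U)" if "fam_ok (ereal j) \<infinity> x XU" for XU
  proof -
    obtain X' U' where XU: "XU = (X', U')" by fastforce
    note fam = fam_ok_reflect[OF that[unfolded XU]]
    have x0: "X' n 0 = x n" for n using that by (simp add: XU fam_ok_def)
    have f: "(\<lambda>n. X' n (int t)) = (evolve F ^^ t) x \<and> (\<lambda>n. U' n (int t)) = carrier_lim F ((evolve F ^^ t) x)" for t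
    proof -
      have u: "(\<lambda>n. U' n (int t)) = carrier_lim F ((evolve F ^^ t) x)"
        if X: "(\<lambda>n. X' n (int t)) = (evolve F ^^ t) x" for t
        unfolding F_def
      proof (rule subcritical_carrier_unique)
        show "subcritical j b ((evolve (F_udK (ereal j) \<infinity>) ^^ t) x)" using fwd by (simp add: F_def)
        show "carrier_ok (ereal j) \<infinity> ((evolve (F_udK (ereal j) \<infinity>) ^^ t) x) (\<lambda>n. U' n (int t))"
          using fam(1)[of "int t"] unfolding X F_def .
        show "carrier_ok (ereal j) \<infinity> (\<lambda>n. X' n (int t + 1)) (\<lambda>n. U' n (int t + 1))"
          by (rule fam(1))
        show "X' n (int t + 1) = fst (F_udK (ereal j) \<infinity> ((evolve (F_udK (ereal j) \<infinity>) ^^ t) x n, U' (n - 1) (int t)))" for n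
          using fam(2)[of n "int t"] fun_cong[OF X, of n] by (simp add: F_def)
      qed
      have "(\<lambda>n. X' n (int t)) = (evolve F ^^ t) x"
      proof (induction t)
        case 0
        then show ?case using x0 by simp
      next
        case (Suc t)
        show ?case
        proof
          fix n
          have "X' n (int (Suc t)) = fst (F (X' n (int t), U' (n - 1) (int t)))"
            using fam(2)[of n "int t"] by (simp add: F_def add.commute)
          also have "\<dots> = evolve F ((evolve F ^^ t) x) n"
            using fun_cong[OF Suc, of n] fun_cong[OF u[OF Suc], of "n - 1"] by (simp add: evolve_def[of F "(evolve F ^^ t) x" n])
          finally show "X' n (int (Suc t)) = (evolve F ^^ Suc t) x n" by simp
        qed
      qed
      with u show ?thesis by blast
    qed
    have b: "(\<lambda>n. X' n (- int t)) = (evolve_back F ^^ t) x \<and>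
        (\<lambda>n. U' (- n - 1) (- int t - 1)) = carrier_lim F (reflect ((evolve_back F ^^ t) x))" for t
    proof -
      have u: "(\<lambda>n. U' (- n - 1) (- int t - 1)) = carrier_lim F (reflect ((evolve_back F ^^ t) x))"
        if X: "(\<lambda>n. X' n (- int t)) = (evolve_back F ^^ t) x" for t
        unfolding F_def
      proof (rule subcritical_carrier_unique)
        show "subcritical j b (reflect ((evolve_back (F_udK (ereal j) \<infinity>) ^^ t) x))" using bwd by (simp add: F_def)
        show "carrier_ok (ereal j) \<infinity> (reflect ((evolve_back (F_udK (ereal j) \<infinity>) ^^ t) x)) (\<lambda>n. U' (- n - 1) (- int t - 1))"
          using fam(3)[of "- int t - 1"] X by (simp add: F_def)
        show "carrier_ok (ereal j) \<infinity> (reflect (\<lambda>n. X' n (- int t - 1))) (\<lambda>n. U' (- n - 1) (- int t - 2))"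
        proof -
          have "- int t - 2 + 1 = - int t - 1" by simp
          from fam(3)[of "- int t - 2", unfolded this] show ?thesis .
        qed
        show "reflect (\<lambda>n. X' n (- int t - 1)) n = fst (F_udK (ereal j) \<infinity>
            (reflect ((evolve_back (F_udK (ereal j) \<infinity>) ^^ t) x) n, U' (- (n - 1) - 1) (- int t - 1)))" for n
          using fam(4)[of "- int t - 1" n] X by (simp add: F_def)
      qed
      have "(\<lambda>n. X' n (- int t)) = (evolve_back F ^^ t) x"
      proof (induction t)
        case 0
        then show ?case using x0 by simp
      next
        case (Suc t)
        let ?y = "(evolve_back F ^^ t) x"
        have "reflect (\<lambda>n. X' n (- int (Suc t))) n = evolve F (reflect ?y) n" for n
        proof -
          have "reflect (\<lambda>n. X' n (- int t - 1)) n = fst (F (reflect ?y n, U' (- (n - 1) - 1) (- int t - 1)))"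
            using fam(4)[of "- int t - 1" n] Suc by (simp add: F_def)
          also have "U' (- (n - 1) - 1) (- int t - 1) = carrier_lim F (reflect ?y) (n - 1)"
            by (rule fun_cong[OF u[OF Suc], of "n - 1"])
          finally have "reflect (\<lambda>n. X' n (- int t - 1)) n = evolve F (reflect ?y) n"
            unfolding evolve_def[of F "reflect ?y" n] .
          moreover have "- int (Suc t) = - int t - 1" by simp
          ultimately show ?thesis by (simp only:)
        qed
        then have "reflect (\<lambda>n. X' n (- int (Suc t))) = evolve F (reflect ?y)" by blast
        then have "reflect (reflect (\<lambda>n. X' n (- int (Suc t)))) = reflect (evolve F (reflect ?y))" by (rule arg_cong)
        then show ?case unfolding reflect_reflect funpow.simps comp_apply evolve_back_def[of F ?y] .
      qed
      with u show ?thesis by blast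
    qed
    have "X' n t = X n t \<and> U' n t = U n t" for n t
    proof (cases "0 \<le> t")
      case True
      then have t: "t = int (nat t)" by simp
      show ?thesis
        using fun_cong[OF conjunct1[OF f[of "nat t"]], of n] fun_cong[OF conjunct2[OF f[of "nat t"]], of n] True
        by (simp add: X_def U_def)
    next
      case False
      then show ?thesis
        using fun_cong[OF conjunct1[OF b[of "nat (- t)"]], of n]
          fun_cong[OF conjunct2[OF b[of "nat (- t - 1)"]], of "- n - 1"]
        by (simp add: X_def U_def)
    qed
    then show ?thesis unfolding XU by (simp add: fun_eq_iff)
  qed
  ultimately have "uniq_fam (ereal j) \<infinity> x" "(THE XU. fam_ok (ereal j) \<infinity> x XU) = (X, U)"
    unfolding uniq_fam_def by (blast, intro the_equality)
  then show ?thesis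
    by (simp add: T_regular_def T_defined_def T_carrier_def U_def F_def fun_eq_iff)
qed

lemma preserves_funpow:
  assumes [measurable]: "f \<in> M \<rightarrow>\<^sub>M M" and f: "distr M M f = M"
  shows "distr M M (f ^^ t) = M \<and> (f ^^ t) \<in> M \<rightarrow>\<^sub>M M"
proof (induction t)
  case 0
  then show ?case by (simp add: distr_id)
next
  case (Suc t)
  then have "(f ^^ Suc t) \<in> M \<rightarrow>\<^sub>M M" unfolding funpow.simps by (intro measurable_comp[OF _ assms(1)]) simp
  moreover have "distr M M (f ^^ Suc t) = distr (distr M M (f ^^ t)) M f"
    unfolding funpow.simps using Suc by (intro distr_distr[symmetric]) auto
  ultimately show ?case unfolding conjunct1[OF Suc] f by blast
qed

lemma AE_subcritical_T_regular:
  assumes ex: "exchange (F_udK (ereal j) \<infinity>) \<mu> \<nu>" and sub: "AE x in iid \<mu>. subcritical j b x"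
  shows "AE x in iid \<mu>. T_regular (ereal j) \<infinity> x"
proof -
  let ?F = "F_udK (ereal j) \<infinity>"
  interpret exchange ?F \<mu> \<nu> by fact
  have coal: "AE x in iid \<mu>. coalesces ?F x"
    using sub by eventually_elim (rule subcritical_carrier_lim(1))
  have E: "evolve ?F \<in> iid \<mu> \<rightarrow>\<^sub>M iid \<mu>" by measurable
  note E' = evolve_preserves[OF coal]
  have "reflect \<in> iid borel \<rightarrow>\<^sub>M iid borel" unfolding reflect_def by (rule measurable_PiM_single') auto
  then have R: "reflect \<in> iid \<mu> \<rightarrow>\<^sub>M iid \<mu>" by (simp cong: measurable_cong_sets add: sets_iids)
  have R': "distr (iid \<mu>) (iid \<mu>) reflect = iid \<mu>"
    unfolding reflect_def by (rule iid_reindex) (auto simp: prob sets_eq)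
  have RE: "(\<lambda>x. evolve ?F (reflect x)) \<in> iid \<mu> \<rightarrow>\<^sub>M iid \<mu>" using R E by (rule measurable_compose)
  have B: "evolve_back ?F \<in> iid \<mu> \<rightarrow>\<^sub>M iid \<mu>"
    unfolding evolve_back_def using RE R by (rule measurable_compose)
  have "distr (distr (iid \<mu>) (iid \<mu>) reflect) (iid \<mu>) (evolve ?F) = distr (iid \<mu>) (iid \<mu>) (evolve ?F \<circ> reflect)"
    by (rule distr_distr[OF E R])
  then have "distr (iid \<mu>) (iid \<mu>) (evolve ?F \<circ> reflect) = iid \<mu>" by (simp only: R' E')
  moreover have "distr (distr (iid \<mu>) (iid \<mu>) (evolve ?F \<circ> reflect)) (iid \<mu>) reflect =
      distr (iid \<mu>) (iid \<mu>) (reflect \<circ> (evolve ?F \<circ> reflect))"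
    using RE by (intro distr_distr[OF R]) (simp add: comp_def)
  moreover have "reflect \<circ> (evolve ?F \<circ> reflect) = evolve_back ?F"
    by (rule ext) (simp add: evolve_back_def)
  ultimately have B': "distr (iid \<mu>) (iid \<mu>) (evolve_back ?F) = iid \<mu>"
    using R' by simp
  have subR: "AE x in iid \<mu>. subcritical j b (reflect x)"
    by (rule AE_distrD[OF R], subst R', rule sub)
  have "AE x in iid \<mu>. subcritical j b ((evolve ?F ^^ t) x)" for t
    using preserves_funpow[OF E E', of t] sub AE_distrD[of "evolve ?F ^^ t" "iid \<mu>" "iid \<mu>" "subcritical j b"]
    by presburger
  moreover have "AE x in iid \<mu>. subcritical j b (reflect ((evolve_back ?F ^^ t) x))" for t
    using preserves_funpow[OF B B', of t] subR
      AE_distrD[of "evolve_back ?F ^^ t" "iid \<mu>" "iid \<mu>" "\<lambda>x. subcritical j b (reflect x)"]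
    by presburger
  ultimately have "AE x in iid \<mu>. (\<forall>t. subcritical j b ((evolve ?F ^^ t) x)) \<and>
      (\<forall>t. subcritical j b (reflect ((evolve_back ?F ^^ t) x)))"
    by (simp add: AE_all_countable)
  then show ?thesis by eventually_elim (intro subcritical_T_regular, auto)
qed

lemma AE_subcritical:
  assumes mu: "prob_space \<mu>" "sets \<mu> = sets borel" and b: "AE y in \<mu>. y \<le> b"
    and h: "h > 0" "(\<integral>\<^sup>+y. ennreal (exp (h * (2 * y - j))) \<partial>\<mu>) < 1"
  shows "AE x in iid \<mu>. subcritical j b x"
proof -
  have "AE x in iid \<mu>. x n \<le> b" for n
    using AE_PiM_component[of UNIV "\<lambda>_. \<mu>" n "\<lambda>y. y \<le> b"] mu b by simp
  moreover have "AE x in iid \<mu>. filterlim (drift_sum j x n) at_bot sequentially" for n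
  proof -
    have "AE x in iid \<mu>. filterlim (\<lambda>k. \<Sum>i<k. 2 * x ((\<lambda>i. n - int i) i) - j) at_bot sequentially"
      by (rule AE_partial_sums_at_bot[OF mu _ h]) (auto simp: inj_on_def)
    then show ?thesis by eventually_elim (simp add: drift_sum_def[abs_def])
  qed
  ultimately show ?thesis unfolding subcritical_def by (simp add: AE_all_countable)
qed

section \<open>Ergodicity for local maps preserving a product measure\<close>

lemma exchange_dual:
  assumes "exchange F \<mu> \<nu>"
  shows "exchange (dual F) \<nu> \<mu>"
proof -
  interpret exchange F \<mu> \<nu> by fact
  interpret munu: pair_prob_space \<mu> \<nu> ..
  interpret numu: pair_prob_space \<nu> \<mu> ..
  have bb: "sets (\<mu> \<Otimes>\<^sub>M \<nu>) = sets (borel \<Otimes>\<^sub>M borel)" "sets (\<nu> \<Otimes>\<^sub>M \<mu>) = sets (borel \<Otimes>\<^sub>M borel)"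
    by (intro sets_pair_measure_cong sets_eq)+
  show ?thesis
  proof
    show "dual F \<in> borel \<Otimes>\<^sub>M borel \<rightarrow>\<^sub>M borel \<Otimes>\<^sub>M borel"
      unfolding dual_def by (simp add: split_beta' prod.swap_def)
    let ?s = "\<lambda>(x :: real, y :: real). (y, x)"
    have s1: "distr (\<mu> \<Otimes>\<^sub>M \<nu>) (borel \<Otimes>\<^sub>M borel) ?s = \<nu> \<Otimes>\<^sub>M \<mu>"
      by (rule trans[OF distr_cong numu.distr_pair_swap[symmetric]]) (auto simp: bb)
    have s2: "distr (\<nu> \<Otimes>\<^sub>M \<mu>) (borel \<Otimes>\<^sub>M borel) ?s = \<mu> \<Otimes>\<^sub>M \<nu>"
      by (rule trans[OF distr_cong munu.distr_pair_swap[symmetric]]) (auto simp: bb)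
    have F: "distr (\<nu> \<Otimes>\<^sub>M \<mu>) (borel \<Otimes>\<^sub>M borel) (F \<circ> ?s) = \<mu> \<Otimes>\<^sub>M \<nu>"
    proof -
      have "distr (distr (\<nu> \<Otimes>\<^sub>M \<mu>) (borel \<Otimes>\<^sub>M borel) ?s) (borel \<Otimes>\<^sub>M borel) F =
          distr (\<nu> \<Otimes>\<^sub>M \<mu>) (borel \<Otimes>\<^sub>M borel) (F \<circ> ?s)"
        by (rule distr_distr) (simp_all add: measurable_cong_sets[OF bb(2) refl] split_beta')
      then show ?thesis unfolding s2 preserves by (rule sym)
    qed
    have "dual F = ?s \<circ> (F \<circ> ?s)" by (auto simp: dual_def fun_eq_iff split: prod.split)
    moreover have "distr (\<nu> \<Otimes>\<^sub>M \<mu>) (borel \<Otimes>\<^sub>M borel) (?s \<circ> (F \<circ> ?s)) =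
        distr (distr (\<nu> \<Otimes>\<^sub>M \<mu>) (borel \<Otimes>\<^sub>M borel) (F \<circ> ?s)) (borel \<Otimes>\<^sub>M borel) ?s"
      by (rule distr_distr[symmetric]) (simp_all add: measurable_cong_sets[OF bb(2) refl] split_beta' comp_def)
    ultimately show "distr (\<nu> \<Otimes>\<^sub>M \<mu>) (borel \<Otimes>\<^sub>M borel) (dual F) = \<nu> \<Otimes>\<^sub>M \<mu>"
      by (simp only: F s1)
  qed (fact prob sets_eq)+
qed

lemma eq_return_if_AE:
  assumes "prob_space \<mu>" "sets \<mu> = sets borel" "AE x in \<mu>. x = (c :: real)"
  shows "\<mu> = return borel c"
proof (rule measure_eqI)
  interpret prob_space \<mu> by fact
  fix A assume A: "A \<in> sets \<mu>"
  show "emeasure \<mu> A = emeasure (return borel c) A"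
  proof (cases "c \<in> A")
    case True
    have "emeasure \<mu> A = emeasure \<mu> (space \<mu>)"
      using assms(3) A True by (intro emeasure_eq_AE) (auto elim!: eventually_mono dest: sets.sets_into_space)
    then show ?thesis using True A assms(2) by (simp add: emeasure_space_1)
  next
    case False
    have "emeasure \<mu> A = emeasure \<mu> {}"
      using assms(3) A False by (intro emeasure_eq_AE) (auto elim!: eventually_mono)
    then show ?thesis using False A assms(2) by simp
  qed
qed (simp add: assms)

lemma AE_strongly_coalesces_dual:
  assumes nu: "prob_space \<nu>" "sets \<nu> = sets borel" and J: "J \<noteq> -\<infinity>" "J \<le> K"
    and pos: "emeasure \<nu> {x. ereal x \<le> J / 2 \<or> K - J / 2 \<le> ereal x} > 0"
  shows "AE x in iid \<nu>. strongly_coalesces (F_udK K J) x"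
proof (cases "J = K")
  case True
  interpret prob_space \<nu> by fact
  have "emeasure \<nu> UNIV > 0" using emeasure_space_1 sets_eq_imp_space_eq[OF nu(2)] by simp
  then show ?thesis unfolding True
    by (intro AE_strongly_coalesces[OF nu, of UNIV 1] run_const_equal) auto
next
  case False
  with J obtain j where j: "J = ereal j" by (cases J) auto
  have half: "J / 2 = ereal (j / 2)" by (simp add: j)
  let ?lo = "{x. x \<le> j / 2}" and ?hi = "{x. K - J / 2 \<le> ereal x}"
  have low: ?thesis if "emeasure \<nu> ?lo > 0"
  proof (rule AE_strongly_coalesces[OF nu _ that, of 2])
    fix x :: "int \<Rightarrow> real" and n w w' assume "\<And>i. i < 2 \<Longrightarrow> x (n - int i) \<in> ?lo"
    from this[of 0] this[of 1] show "run (F_udK K J) 2 x n w = run (F_udK K J) 2 x n w'"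
      using J unfolding j by (simp del: run.simps add: run_const_dual_low)
  qed simp
  show ?thesis
  proof (cases K)
    case (real k)
    have hi: "?hi = {x. k - j / 2 \<le> x}" unfolding real half by simp
    have high: ?thesis if "emeasure \<nu> {x. k - j / 2 \<le> x} > 0"
    proof (rule AE_strongly_coalesces[OF nu _ that, of 2])
      fix x :: "int \<Rightarrow> real" and n w w' assume "\<And>i. i < 2 \<Longrightarrow> x (n - int i) \<in> {x. k - j / 2 \<le> x}"
      from this[of 0] this[of 1] show "run (F_udK K J) 2 x n w = run (F_udK K J) 2 x n w'"
        using J unfolding j real by (simp del: run.simps add: run_const_dual_high)
    qed simp
    have "emeasure \<nu> (?lo \<union> {x. k - j / 2 \<le> x}) > 0" using pos unfolding real half by (simp add: Un_def)
    moreover have "emeasure \<nu> (?lo \<union> {x. k - j / 2 \<le> x}) \<le> emeasure \<nu> ?lo + emeasure \<nu> {x. k - j / 2 \<le> x}"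
      by (rule emeasure_subadditive) (auto simp: nu)
    ultimately have "emeasure \<nu> ?lo > 0 \<or> emeasure \<nu> {x. k - j / 2 \<le> x} > 0"
      using gr_zeroI by fastforce
    then show ?thesis using low high by blast
  next
    case PInf
    have "emeasure \<nu> ?lo > 0" using pos unfolding PInf half by simp
    then show ?thesis by (rule low)
  qed (use J j in auto)
qed

lemma AE_strongly_coalesces_finite:
  assumes mu: "prob_space \<mu>" "sets \<mu> = sets borel" and jk: "j \<le> k" and ne: "\<mu> \<noteq> return borel (j / 2)"
  shows "AE x in iid \<mu>. strongly_coalesces (F_udK (ereal j) (ereal k)) x"
proof -
  define E where "E r = {x. - real (Suc r) \<le> x \<and> x \<le> j / 2 - 1 / real (Suc r)}" for r
  define E' where "E' r = {x. j / 2 + 1 / real (Suc r) \<le> x \<and> x \<le> real (Suc r)}" for r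
  have meas: "E r \<in> sets borel" "E' r \<in> sets borel" for r
    unfolding E_def E'_def by measurable
  have "\<exists>r. emeasure \<mu> (E r) > 0 \<or> emeasure \<mu> (E' r) > 0"
  proof (rule ccontr)
    assume "\<nexists>r. emeasure \<mu> (E r) > 0 \<or> emeasure \<mu> (E' r) > 0"
    then have "E r \<in> null_sets \<mu>" "E' r \<in> null_sets \<mu>" for r
      using meas by (auto simp: null_sets_def mu)
    then have "AE x in \<mu>. x \<notin> E r \<and> x \<notin> E' r" for r
      by (intro AE_conjI AE_not_in) auto
    then have "AE x in \<mu>. \<forall>r. x \<notin> E r \<and> x \<notin> E' r" by (simp only: AE_all_countable) blast
    then have "AE x in \<mu>. x = j / 2"
    proof eventually_elim
      case (elim x)
      show ?case
      proof (rule ccontr)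
        assume ne: "x \<noteq> j / 2"
        define d where "d = \<bar>x - j / 2\<bar>"
        have d: "d > 0" using ne by (simp add: d_def)
        obtain r :: nat where r: "max \<bar>x\<bar> (1 / d) \<le> real r" using real_arch_simple by blast
        then have r1: "\<bar>x\<bar> \<le> real (Suc r)" and "1 / d \<le> real (Suc r)" by auto
        then have r2: "1 / real (Suc r) \<le> d" using d by (simp add: field_simps)
        have "x \<in> E r \<or> x \<in> E' r"
          using r1 r2 unfolding E_def E'_def d_def mem_Collect_eq by linarith
        with elim show False by blast
      qed
    qed
    with eq_return_if_AE[OF mu] ne show False by blast
  qed
  then obtain r where r: "emeasure \<mu> (E r) > 0 \<or> emeasure \<mu> (E' r) > 0" by blast
  let ?r = "real (Suc r)"
  obtain N :: nat where N: "max (?r * (?r + j / 2 + k - j) / 2) (?r * (?r - 3 * j / 2 + k) / 2) < real N"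
    using reals_Archimedean2 by blast
  from r show ?thesis
  proof
    assume "emeasure \<mu> (E r) > 0"
    then show ?thesis
    proof (rule AE_strongly_coalesces[OF mu meas(1)])
      fix x :: "int \<Rightarrow> real" and n w w' assume "\<And>i. i < Suc N \<Longrightarrow> x (n - int i) \<in> E r"
      then show "run (F_udK (ereal j) (ereal k)) (Suc N) x n w = run (F_udK (ereal j) (ereal k)) (Suc N) x n w'"
        using N by (intro run_const_down[OF jk, of ?r]) (auto simp: E_def)
    qed
  next
    assume "emeasure \<mu> (E' r) > 0"
    then show ?thesis
    proof (rule AE_strongly_coalesces[OF mu meas(2)])
      fix x :: "int \<Rightarrow> real" and n w w' assume "\<And>i. i < Suc N \<Longrightarrow> x (n - int i) \<in> E' r"
      then show "run (F_udK (ereal j) (ereal k)) (Suc N) x n w = run (F_udK (ereal j) (ereal k)) (Suc N) x n w'"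
        using N by (intro run_const_up[OF jk, of ?r]) (auto simp: E'_def)
    qed
  qed
qed

text \<open>With \<open>e = exp (h / 2 * (2 * y - j))\<close> this integrates \<open>2 * e \<le> 1 + e\<^sup>2\<close>, which is strict unless \<open>y = j / 2\<close>.\<close>
lemma exp_moment_half:
  assumes mu: "prob_space \<mu>" "sets \<mu> = sets borel" and ne: "\<mu> \<noteq> return borel (j / 2)"
    and h: "h > 0" "(\<integral>\<^sup>+y. ennreal (exp (h * (2 * y - j))) \<partial>\<mu>) \<le> 1"
  shows "(\<integral>\<^sup>+y. ennreal (exp (h / 2 * (2 * y - j))) \<partial>\<mu>) < 1"
proof -
  interpret prob_space \<mu> by fact
  note [measurable_cong] = mu(2)
  let ?e = "\<lambda>y. exp (h / 2 * (2 * y - j))"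
  let ?a = "\<integral>\<^sup>+y. ennreal (?e y) \<partial>\<mu>" and ?D = "\<integral>\<^sup>+y. ennreal ((1 - ?e y)\<^sup>2) \<partial>\<mu>"
  have "2 * ?a + ?D = (\<integral>\<^sup>+y. 2 * ennreal (?e y) + ennreal ((1 - ?e y)\<^sup>2) \<partial>\<mu>)"
    by (subst nn_integral_add) (simp_all add: nn_integral_cmult)
  also have "\<dots> = (\<integral>\<^sup>+y. 1 + ennreal (exp (h * (2 * y - j))) \<partial>\<mu>)"
  proof (rule nn_integral_cong)
    fix y
    have "?e y * ?e y = exp (h * (2 * y - j))" by (simp add: exp_add[symmetric] field_simps)
    then have "2 * ?e y + (1 - ?e y)\<^sup>2 = 1 + exp (h * (2 * y - j))"
      by (simp add: power2_eq_square algebra_simps)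
    moreover have "2 * ennreal (?e y) + ennreal ((1 - ?e y)\<^sup>2) = ennreal (2 * ?e y + (1 - ?e y)\<^sup>2)"
      by (simp add: ennreal_plus ennreal_mult)
    moreover have "ennreal (1 + exp (h * (2 * y - j))) = 1 + ennreal (exp (h * (2 * y - j)))"
      by (simp add: ennreal_plus)
    ultimately show "2 * ennreal (?e y) + ennreal ((1 - ?e y)\<^sup>2) = 1 + ennreal (exp (h * (2 * y - j)))"
      by simp
  qed
  also have "\<dots> = 1 + (\<integral>\<^sup>+y. ennreal (exp (h * (2 * y - j))) \<partial>\<mu>)"
    by (subst nn_integral_add) (simp_all add: emeasure_space_1)
  also have "\<dots> \<le> 2" using add_left_mono[OF h(2), of 1] by simp
  finally have le: "2 * ?a + ?D \<le> 2" .
  have D: "?D \<noteq> 0"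
  proof
    assume "?D = 0"
    then have "AE y in \<mu>. ennreal ((1 - ?e y)\<^sup>2) = 0" by (subst (asm) nn_integral_0_iff_AE) auto
    then have "AE y in \<mu>. y = j / 2"
      by eventually_elim (use h(1) in \<open>auto simp: ennreal_eq_0_iff\<close>)
    with eq_return_if_AE[OF mu] ne show False by blast
  qed
  show ?thesis
  proof (rule ccontr)
    assume "\<not> ?a < 1"
    then have "2 \<le> 2 * ?a" using mult_left_mono[of 1 ?a "2 :: ennreal"] by simp
    then have "2 + ?D \<le> 2" using le order_trans[OF add_right_mono] by blast
    then have "?D \<le> 0" using ennreal_add_left_cancel_le[of 2 ?D 0] by simp
    with D show False by simp
  qed
qed

lemma ergodic_udK_pair:
  assumes J: "J \<noteq> -\<infinity>" "J \<le> K" and ex: "exchange (F_udK J K) \<mu> \<nu>"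
    and ne: "\<And>j. J = ereal j \<Longrightarrow> \<mu> \<noteq> return borel (j / 2)"
    and pos: "emeasure \<nu> {x. ereal x \<le> J / 2 \<or> K - J / 2 \<le> ereal x} > 0"
    and sub: "\<And>j. J = ereal j \<Longrightarrow> K = \<infinity> \<Longrightarrow>
      \<exists>b h. (AE y in \<mu>. y \<le> b) \<and> h > 0 \<and> (\<integral>\<^sup>+y. ennreal (exp (h * (2 * y - j))) \<partial>\<mu>) \<le> 1"
  shows "ergodic_under (iid \<mu>) (T_udK J K) (T_defined J K) \<and> ergodic_under (iid \<nu>) (T_udK K J) (T_defined K J)"
proof -
  interpret exchange "F_udK J K" \<mu> \<nu> by fact
  have ex': "exchange (F_udK K J) \<nu> \<mu>" using exchange_dual[OF ex] by (simp add: dual_F_udK)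
  have strong': "AE x in iid \<nu>. strongly_coalesces (F_udK K J) x"
    by (rule AE_strongly_coalesces_dual[OF prob(2) sets_eq(2) J pos])
  then have coal': "AE x in iid \<nu>. coalesces (F_udK K J) x" and reg': "AE x in iid \<nu>. T_regular K J x"
    by (eventually_elim, simp add: strongly_coalesces_imp_coalesces strongly_coalesces_T_regular)+
  have "(AE x in iid \<mu>. coalesces (F_udK J K) x) \<and> (AE x in iid \<mu>. T_regular J K x)"
  proof (cases "K = \<infinity> \<and> J \<noteq> \<infinity>")
    case True
    with J obtain j where j: "J = ereal j" by (cases J) auto
    from sub[OF j] True obtain b h where b: "AE y in \<mu>. y \<le> b" and
      h: "h > 0" "(\<integral>\<^sup>+y. ennreal (exp (h * (2 * y - j))) \<partial>\<mu>) \<le> 1" by blast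
    have "AE x in iid \<mu>. subcritical j b x"
      using exp_moment_half[OF prob(1) sets_eq(1) ne[OF j] h] h(1)
      by (intro AE_subcritical[OF prob(1) sets_eq(1) b, of "h / 2"]) auto
    moreover from this have "AE x in iid \<mu>. coalesces (F_udK (ereal j) \<infinity>) x"
      by eventually_elim (rule subcritical_carrier_lim(1))
    ultimately show ?thesis
      using AE_subcritical_T_regular[of j \<mu> \<nu> b] ex True by (simp add: j)
  next
    case False
    have "AE x in iid \<mu>. strongly_coalesces (F_udK J K) x"
    proof (cases "J = \<infinity>")
      case True
      then have K: "K = J" using J by simp
      have "emeasure \<mu> UNIV > 0" using mu.emeasure_space_1 by simp
      then show ?thesis unfolding K
        by (intro AE_strongly_coalesces[OF prob(1) sets_eq(1), of UNIV 1] run_const_equal) auto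
    next
      case J': False
      with J obtain j where j: "J = ereal j" by (cases J) auto
      with False J obtain k where k: "K = ereal k" by (cases K) auto
      show ?thesis using J ne[OF j] unfolding j k
        by (intro AE_strongly_coalesces_finite[OF prob(1) sets_eq(1)]) auto
    qed
    then show ?thesis
      by (intro conjI; eventually_elim) (simp_all add: strongly_coalesces_imp_coalesces strongly_coalesces_T_regular)
  qed
  then have coal: "AE x in iid \<mu>. coalesces (F_udK J K) x" and reg: "AE x in iid \<mu>. T_regular J K x" by auto
  have "ergodic_exchange (F_udK J K) \<mu> \<nu>"
    by (intro ergodic_exchange.intro ex ergodic_exchange_axioms.intro coal)
      (simp_all add: dual_F_udK coal' carrier_monotone_F_udK[OF J])
  moreover have "ergodic_exchange (F_udK K J) \<nu> \<mu>"
    by (intro ergodic_exchange.intro ex' ergodic_exchange_axioms.intro coal')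
      (simp_all add: dual_F_udK coal carrier_monotone_F_udK[OF J])
  ultimately show ?thesis using reg reg' by (intro conjI ergodic_under_udK)
qed

section \<open>Invariance of the admissible products\<close>

lemma exchange_F_udKI:
  assumes p: "prob_space \<mu>" "prob_space \<nu>" and s[measurable_cong]: "sets \<mu> = sets borel" "sets \<nu> = sets borel"
    and eq: "\<And>G :: real \<times> real \<Rightarrow> ennreal. G \<in> borel_measurable (borel \<Otimes>\<^sub>M borel) \<Longrightarrow>
      (\<integral>\<^sup>+x. \<integral>\<^sup>+u. G (F_udK J K (x, u)) \<partial>\<nu> \<partial>\<mu>) = (\<integral>\<^sup>+x. \<integral>\<^sup>+u. G (x, u) \<partial>\<nu> \<partial>\<mu>)"
  shows "exchange (F_udK J K) \<mu> \<nu>"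
proof (rule exchange.intro)
  interpret mu: prob_space \<mu> by fact
  interpret nu: prob_space \<nu> by fact
  have b: "sets (\<mu> \<Otimes>\<^sub>M \<nu>) = sets (borel \<Otimes>\<^sub>M borel)" by (intro sets_pair_measure_cong s)
  have F: "F_udK J K \<in> \<mu> \<Otimes>\<^sub>M \<nu> \<rightarrow>\<^sub>M borel \<Otimes>\<^sub>M borel" by measurable
  show "distr (\<mu> \<Otimes>\<^sub>M \<nu>) (borel \<Otimes>\<^sub>M borel) (F_udK J K) = \<mu> \<Otimes>\<^sub>M \<nu>"
  proof (rule measure_eqI)
    fix A assume "A \<in> sets (distr (\<mu> \<Otimes>\<^sub>M \<nu>) (borel \<Otimes>\<^sub>M borel) (F_udK J K))"
    then have A[measurable]: "A \<in> sets (borel \<Otimes>\<^sub>M borel)" by simp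
    have "emeasure (distr (\<mu> \<Otimes>\<^sub>M \<nu>) (borel \<Otimes>\<^sub>M borel) (F_udK J K)) A =
        (\<integral>\<^sup>+z. indicator A (F_udK J K z) \<partial>(\<mu> \<Otimes>\<^sub>M \<nu>))"
      using F by (subst nn_integral_indicator[symmetric], simp, subst nn_integral_distr) auto
    also have "\<dots> = (\<integral>\<^sup>+x. \<integral>\<^sup>+u. indicator A (F_udK J K (x, u)) \<partial>\<nu> \<partial>\<mu>)"
      by (rule nu.nn_integral_fst[symmetric]) measurable
    also have "\<dots> = (\<integral>\<^sup>+x. \<integral>\<^sup>+u. indicator A (x, u) \<partial>\<nu> \<partial>\<mu>)"
      by (rule eq) measurable
    also have "\<dots> = (\<integral>\<^sup>+z. indicator A z \<partial>(\<mu> \<Otimes>\<^sub>M \<nu>))"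
      by (rule nu.nn_integral_fst) measurable
    also have "\<dots> = emeasure (\<mu> \<Otimes>\<^sub>M \<nu>) A" by (rule nn_integral_indicator) (simp add: b)
    finally show "emeasure (distr (\<mu> \<Otimes>\<^sub>M \<nu>) (borel \<Otimes>\<^sub>M borel) (F_udK J K)) A = emeasure (\<mu> \<Otimes>\<^sub>M \<nu>) A" .
  qed (simp add: b)
qed (fact p s measurable_F_udK)+

lemma exchange_swapping:
  assumes p: "prob_space \<mu>" and s[measurable_cong]: "sets \<mu> = sets borel"
    and ae: "AE x in \<mu>. S x" and F: "\<And>x u. S x \<Longrightarrow> S u \<Longrightarrow> F_udK J K (x, u) = (u, x)"
  shows "exchange (F_udK J K) \<mu> \<mu>"
proof (rule exchange_F_udKI[OF p p s s])
  interpret prob_space \<mu> by fact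
  interpret mm: pair_prob_space \<mu> \<mu> ..
  fix G :: "real \<times> real \<Rightarrow> ennreal" assume [measurable]: "G \<in> borel_measurable (borel \<Otimes>\<^sub>M borel)"
  have "(\<integral>\<^sup>+x. \<integral>\<^sup>+u. G (F_udK J K (x, u)) \<partial>\<mu> \<partial>\<mu>) = (\<integral>\<^sup>+x. \<integral>\<^sup>+u. G (u, x) \<partial>\<mu> \<partial>\<mu>)"
    using ae
  proof (intro nn_integral_cong_AE, eventually_elim)
    case (elim x)
    show ?case using ae by (intro nn_integral_cong_AE, eventually_elim) (simp add: F elim)
  qed
  also have "\<dots> = (\<integral>\<^sup>+x. \<integral>\<^sup>+u. G (x, u) \<partial>\<mu> \<partial>\<mu>)"
    by (rule mm.Fubini') measurable
  finally show "(\<integral>\<^sup>+x. \<integral>\<^sup>+u. G (F_udK J K (x, u)) \<partial>\<mu> \<partial>\<mu>) = (\<integral>\<^sup>+x. \<integral>\<^sup>+u. G (x, u) \<partial>\<mu> \<partial>\<mu>)" .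
qed

lemma exchange_shifted:
  assumes p: "prob_space \<mu>" and s[measurable_cong]: "sets \<mu> = sets borel"
    and jk: "j \<le> k" and ae: "AE x in \<mu>. j / 2 \<le> x"
  shows "exchange (F_udK (ereal j) (ereal k)) \<mu> (distr \<mu> borel (\<lambda>x. x + (k - j)))"
proof (rule exchange_F_udKI[OF p])
  interpret prob_space \<mu> by fact
  interpret mm: pair_prob_space \<mu> \<mu> ..
  let ?c = "k - j" and ?F = "F_udK (ereal j) (ereal k)"
  show "prob_space (distr \<mu> borel (\<lambda>x. x + ?c))" by (rule prob_space_distr) measurable
  fix G :: "real \<times> real \<Rightarrow> ennreal" assume [measurable]: "G \<in> borel_measurable (borel \<Otimes>\<^sub>M borel)"
  have F: "?F (x, y + ?c) = (y, x + ?c)" if "j / 2 \<le> x" "j / 2 \<le> y" for x y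
    using that jk by (simp add: F_udK_eq max_def)
  have "(\<integral>\<^sup>+x. \<integral>\<^sup>+u. G (?F (x, u)) \<partial>distr \<mu> borel (\<lambda>x. x + ?c) \<partial>\<mu>) = (\<integral>\<^sup>+x. \<integral>\<^sup>+y. G (?F (x, y + ?c)) \<partial>\<mu> \<partial>\<mu>)"
    by (subst nn_integral_distr) measurable
  also have "\<dots> = (\<integral>\<^sup>+x. \<integral>\<^sup>+y. G (y, x + ?c) \<partial>\<mu> \<partial>\<mu>)"
    using ae
  proof (intro nn_integral_cong_AE, eventually_elim)
    case (elim x)
    show ?case using ae by (intro nn_integral_cong_AE, eventually_elim) (simp add: F[OF elim(2)])
  qed
  also have "\<dots> = (\<integral>\<^sup>+x. \<integral>\<^sup>+y. G (x, y + ?c) \<partial>\<mu> \<partial>\<mu>)"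
    by (rule mm.Fubini') measurable
  also have "\<dots> = (\<integral>\<^sup>+x. \<integral>\<^sup>+u. G (x, u) \<partial>distr \<mu> borel (\<lambda>x. x + ?c) \<partial>\<mu>)"
    by (subst nn_integral_distr) measurable
  finally show "(\<integral>\<^sup>+x. \<integral>\<^sup>+u. G (?F (x, u)) \<partial>distr \<mu> borel (\<lambda>x. x + ?c) \<partial>\<mu>) =
      (\<integral>\<^sup>+x. \<integral>\<^sup>+u. G (x, u) \<partial>distr \<mu> borel (\<lambda>x. x + ?c) \<partial>\<mu>)" .
qed (simp_all add: s)

lemma lborel_translate:
  fixes f :: "real \<Rightarrow> ennreal"
  assumes [measurable]: "f \<in> borel_measurable borel"
  shows "(\<integral>\<^sup>+x. f (x + c) \<partial>lborel) = (\<integral>\<^sup>+x. f x \<partial>lborel)"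
  using nn_integral_real_affine[of f 1 c] by (simp add: add.commute)

text \<open>In the coordinates \<open>(x, x + u)\<close> the map is a shear followed by a reflection.\<close>
lemma F_udK_lborel:
  fixes G :: "real \<times> real \<Rightarrow> ennreal"
  assumes [measurable]: "G \<in> borel_measurable (borel \<Otimes>\<^sub>M borel)"
  shows "(\<integral>\<^sup>+x. \<integral>\<^sup>+u. G (F_udK J K (x, u)) \<partial>lborel \<partial>lborel) = (\<integral>\<^sup>+x. \<integral>\<^sup>+u. G (x, u) \<partial>lborel \<partial>lborel)"
proof -
  define d where "d s = mx J s - mx K s" for s
  have [measurable]: "d \<in> borel_measurable borel" unfolding d_def by measurable
  have "(\<integral>\<^sup>+x. \<integral>\<^sup>+u. G (F_udK J K (x, u)) \<partial>lborel \<partial>lborel) =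
      (\<integral>\<^sup>+x. \<integral>\<^sup>+u. G ((u + x) - (x + d (u + x)), x + d (u + x)) \<partial>lborel \<partial>lborel)"
    by (simp add: F_udK_eq d_def algebra_simps)
  also have "\<dots> = (\<integral>\<^sup>+x. \<integral>\<^sup>+s. G (s - (x + d s), x + d s) \<partial>lborel \<partial>lborel)"
    by (subst lborel_translate[where f = "\<lambda>s. G (s - (x + d s), x + d s)" for x]) measurable
  also have "\<dots> = (\<integral>\<^sup>+s. \<integral>\<^sup>+x. G (s - (x + d s), x + d s) \<partial>lborel \<partial>lborel)"
    by (rule lborel_pair.Fubini') measurable
  also have "\<dots> = (\<integral>\<^sup>+s. \<integral>\<^sup>+v. G (s - v, v) \<partial>lborel \<partial>lborel)"
    by (subst lborel_translate[where f = "\<lambda>v. G (s - v, v)" for s]) measurable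
  also have "\<dots> = (\<integral>\<^sup>+v. \<integral>\<^sup>+s. G (s - v, v) \<partial>lborel \<partial>lborel)"
    by (rule lborel_pair.Fubini') measurable
  also have "\<dots> = (\<integral>\<^sup>+v. \<integral>\<^sup>+s. G (s + (- v), v) \<partial>lborel \<partial>lborel)" by simp
  also have "\<dots> = (\<integral>\<^sup>+v. \<integral>\<^sup>+y. G (y, v) \<partial>lborel \<partial>lborel)"
    by (subst lborel_translate[where f = "\<lambda>y. G (y, v)" for v]) measurable
  also have "\<dots> = (\<integral>\<^sup>+y. \<integral>\<^sup>+v. G (y, v) \<partial>lborel \<partial>lborel)"
    by (rule lborel_pair.Fubini') measurable
  finally show ?thesis .
qed

definition in_rect :: "real \<Rightarrow> ereal \<Rightarrow> ereal \<Rightarrow> real \<times> real \<Rightarrow> bool" where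
  "in_rect c J K = (\<lambda>(x, u). c \<le> x \<and> ereal x \<le> J - ereal c \<and> c \<le> u \<and> ereal u \<le> K - ereal c)"

lemma in_rect_F_udK:
  assumes "J \<noteq> -\<infinity>" "J \<le> K" "ereal c < J / 2"
  shows "in_rect c J K (F_udK J K p) \<longleftrightarrow> in_rect c J K p"
proof -
  have imp: "in_rect c J K (F_udK J K (x, u))" if "in_rect c J K (x, u)" for x u
    using assms that by (cases J; cases K) (auto simp: in_rect_def F_udK_eq max_def)
  then have "in_rect c J K (F_udK J K p)" if "in_rect c J K p" for p using that by (cases p) auto
  from this[of p] this[of "F_udK J K p"] show ?thesis by (auto simp: F_udK_involution)
qed

lemma stExp_sets: "is_stExp M l a b \<Longrightarrow> prob_space M \<and> sets M = sets borel"
  by (auto simp: is_stExp_def)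

lemma exchange_stExp:
  assumes J: "J \<noteq> -\<infinity>" "J \<le> K" "ereal c < J / 2"
    and mu: "is_stExp \<mu> l c (J - ereal c)" and nu: "is_stExp \<nu> l c (K - ereal c)"
  shows "exchange (F_udK J K) \<mu> \<nu>"
proof (rule exchange_F_udKI)
  show "prob_space \<mu>" "prob_space \<nu>" "sets \<mu> = sets borel" "sets \<nu> = sets borel"
    using stExp_sets[OF mu] stExp_sets[OF nu] by auto
  define f where "f Z B x = ennreal (Z * exp (- l * x)) * indicator {x. c \<le> x \<and> ereal x \<le> B - ereal c} x" for Z B x
  have [measurable]: "f Z B \<in> borel_measurable borel" for Z B unfolding f_def by measurable
  obtain Z where Z: "Z > 0" "\<mu> = density lborel (f Z J)"
    using mu unfolding is_stExp_def f_def by auto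
  obtain Z' where Z': "Z' > 0" "\<nu> = density lborel (f Z' K)"
    using nu unfolding is_stExp_def f_def by auto
  define H where "H = (\<lambda>p. f Z J (fst p) * f Z' K (snd p))"
  have [measurable]: "H \<in> borel_measurable (borel \<Otimes>\<^sub>M borel)" unfolding H_def by measurable
  have H: "H p = (if in_rect c J K p then ennreal (Z * Z' * exp (- l * (fst p + snd p))) else 0)" for p
  proof -
    have "Z * exp (- l * fst p) * (Z' * exp (- l * snd p)) = Z * Z' * exp (- l * (fst p + snd p))"
      by (simp add: distrib_left exp_add exp_diff exp_minus field_simps)
    then have "ennreal (Z * exp (- l * fst p)) * ennreal (Z' * exp (- l * snd p)) = ennreal (Z * Z' * exp (- l * (fst p + snd p)))"
      using Z(1) Z'(1) by (simp only: ennreal_mult[symmetric] mult_nonneg_nonneg less_imp_le exp_ge_zero)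
    then show ?thesis by (cases p) (auto simp: H_def f_def in_rect_def indicator_def)
  qed
  have HF: "H (F_udK J K p) = H p" for p
    unfolding H in_rect_F_udK[OF J] by (cases p) (simp add: F_udK_eq add.commute)
  fix G :: "real \<times> real \<Rightarrow> ennreal" assume G[measurable]: "G \<in> borel_measurable (borel \<Otimes>\<^sub>M borel)"
  have dens: "(\<integral>\<^sup>+x. \<integral>\<^sup>+u. g (x, u) \<partial>\<nu> \<partial>\<mu>) = (\<integral>\<^sup>+x. \<integral>\<^sup>+u. H (x, u) * g (x, u) \<partial>lborel \<partial>lborel)"
    if [measurable]: "g \<in> borel_measurable (borel \<Otimes>\<^sub>M borel)" for g
  proof -
    have "(\<integral>\<^sup>+x. \<integral>\<^sup>+u. g (x, u) \<partial>\<nu> \<partial>\<mu>) = (\<integral>\<^sup>+x. f Z J x * (\<integral>\<^sup>+u. g (x, u) \<partial>\<nu>) \<partial>lborel)"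
    proof -
      interpret nu: prob_space \<nu> using stExp_sets[OF nu] by simp
      have "sets \<nu> = sets borel" using stExp_sets[OF nu] by simp
      note [measurable_cong] = this
      show ?thesis unfolding Z(2) by (rule nn_integral_density) measurable
    qed
    also have "\<dots> = (\<integral>\<^sup>+x. f Z J x * (\<integral>\<^sup>+u. f Z' K u * g (x, u) \<partial>lborel) \<partial>lborel)"
      unfolding Z'(2) by (subst nn_integral_density) measurable
    also have "\<dots> = (\<integral>\<^sup>+x. \<integral>\<^sup>+u. f Z J x * (f Z' K u * g (x, u)) \<partial>lborel \<partial>lborel)"
      by (subst nn_integral_cmult) measurable
    finally show ?thesis by (simp add: H_def mult.assoc)
  qed
  have "(\<integral>\<^sup>+x. \<integral>\<^sup>+u. G (F_udK J K (x, u)) \<partial>\<nu> \<partial>\<mu>) =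
      (\<integral>\<^sup>+x. \<integral>\<^sup>+u. H (F_udK J K (x, u)) * G (F_udK J K (x, u)) \<partial>lborel \<partial>lborel)"
    unfolding HF by (rule dens) measurable
  also have "\<dots> = (\<integral>\<^sup>+x. \<integral>\<^sup>+u. H (x, u) * G (x, u) \<partial>lborel \<partial>lborel)"
    by (rule F_udK_lborel[where G = "\<lambda>p. H p * G p"]) measurable
  also have "\<dots> = (\<integral>\<^sup>+x. \<integral>\<^sup>+u. G (x, u) \<partial>\<nu> \<partial>\<mu>)"
    by (rule dens[symmetric]) measurable
  finally show "(\<integral>\<^sup>+x. \<integral>\<^sup>+u. G (F_udK J K (x, u)) \<partial>\<nu> \<partial>\<mu>) = (\<integral>\<^sup>+x. \<integral>\<^sup>+u. G (x, u) \<partial>\<nu> \<partial>\<mu>)" .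
qed

lemma stExp_moment:
  assumes mu: "is_stExp \<mu> l c (ereal j - ereal c)"
  shows "AE y in \<mu>. y \<le> j - c" "(\<integral>\<^sup>+y. ennreal (exp (l * (2 * y - j))) \<partial>\<mu>) = 1"
proof -
  interpret prob_space \<mu> using stExp_sets[OF mu] by simp
  define f where "f Z x = ennreal (Z * exp (- l * x)) * indicator {c..j - c} x" for Z x
  have [measurable]: "f Z \<in> borel_measurable borel" for Z unfolding f_def by measurable
  have "{x. c \<le> x \<and> ereal x \<le> ereal j - ereal c} = {c..j - c}" by auto
  then obtain Z where Z: "Z > 0" "\<mu> = density lborel (f Z)"
    using mu unfolding is_stExp_def f_def by auto
  show "AE y in \<mu>. y \<le> j - c" unfolding Z(2)
    by (subst AE_density) (auto simp: f_def indicator_def split: if_splits)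
  have "(\<integral>\<^sup>+y. ennreal (exp (l * (2 * y - j))) \<partial>\<mu>) = (\<integral>\<^sup>+y. f Z y * ennreal (exp (l * (2 * y - j))) \<partial>lborel)"
    unfolding Z(2) by (rule nn_integral_density) measurable
  also have "\<dots> = (\<integral>\<^sup>+y. f Z (j + (- 1) * y) \<partial>lborel)"
  proof (rule nn_integral_cong)
    fix y
    have "Z * exp (- l * y) * exp (l * (2 * y - j)) = Z * exp (- l * (j + (- 1) * y))"
      by (simp add: exp_add[symmetric] algebra_simps)
    then have "ennreal (Z * exp (- l * y)) * ennreal (exp (l * (2 * y - j))) = ennreal (Z * exp (- l * (j + (- 1) * y)))"
      using Z(1) by (simp only: ennreal_mult[symmetric] mult_nonneg_nonneg less_imp_le exp_ge_zero)
    then show "f Z y * ennreal (exp (l * (2 * y - j))) = f Z (j + (- 1) * y)"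
      by (auto simp: f_def indicator_def)
  qed
  also have "\<dots> = (\<integral>\<^sup>+y. f Z y \<partial>lborel)"
    using nn_integral_real_affine[of "f Z" "- 1" j] by simp
  also have "\<dots> = emeasure \<mu> (space \<mu>)" unfolding Z(2) by (simp add: emeasure_density)
  finally show "(\<integral>\<^sup>+y. ennreal (exp (l * (2 * y - j))) \<partial>\<mu>) = 1" by (simp add: emeasure_space_1)
qed

definition geo_weight :: "real \<Rightarrow> real \<Rightarrow> real \<Rightarrow> real \<Rightarrow> real \<Rightarrow> ereal \<Rightarrow> int \<Rightarrow> ennreal" where
  "geo_weight Z \<theta> \<kappa> m c B x = ennreal (Z * \<theta> powi x * \<kappa> ^ iota x) *
     indicator {x. c \<le> m * of_int x \<and> ereal (m * of_int x) \<le> B - ereal c} x"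

lemma geo_range:
  assumes "m > 0" "B \<noteq> -\<infinity>"
  shows "c / m \<le> of_int x \<and> ereal (of_int x) \<le> (B - ereal c) / ereal m \<longleftrightarrow>
    c \<le> m * of_int x \<and> ereal (m * of_int x) \<le> B - ereal c"
  using assms by (cases B) (auto simp: field_simps)

lemma sstbGeo_nn_integral:
  assumes M: "is_sstbGeo M \<theta> (c / m) ((B - ereal c) / ereal m) \<kappa> m" and m: "m > 0" and B: "B \<noteq> -\<infinity>"
  shows "\<exists>Z>0. \<forall>g\<in>borel_measurable borel. (\<integral>\<^sup>+y. g y \<partial>M) =
    (\<integral>\<^sup>+x. geo_weight Z \<theta> \<kappa> m c B x * g (m * of_int x) \<partial>count_space UNIV)"
proof -
  from M obtain Z where Z: "Z > 0" and em: "\<And>A. A \<in> sets borel \<Longrightarrow> emeasure M A =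
      (\<integral>\<^sup>+x. ennreal (Z * \<theta> powi x * \<kappa> ^ iota x) \<partial>count_space
        {x::int. c / m \<le> of_int x \<and> ereal (of_int x) \<le> (B - ereal c) / ereal m \<and> m * of_int x \<in> A})"
    and s: "sets M = sets borel"
    unfolding is_sstbGeo_def by blast
  let ?W = "geo_weight Z \<theta> \<kappa> m c B" and ?f = "\<lambda>x :: int. m * of_int x :: real"
  have "M = distr (density (count_space UNIV) ?W) borel ?f"
  proof (rule measure_eqI)
    fix A assume "A \<in> sets M"
    then have A: "A \<in> sets borel" by (simp add: s)
    let ?I = "{x::int. c / m \<le> of_int x \<and> ereal (of_int x) \<le> (B - ereal c) / ereal m \<and> m * of_int x \<in> A}"
    have "emeasure M A = (\<integral>\<^sup>+x. ennreal (Z * \<theta> powi x * \<kappa> ^ iota x) * indicator ?I x \<partial>count_space UNIV)"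
      unfolding em[OF A] by (rule nn_integral_count_space_indicator) simp
    also have "\<dots> = (\<integral>\<^sup>+x. ?W x * indicator (?f -` A) x \<partial>count_space UNIV)"
    proof (rule nn_integral_cong)
      fix x :: int
      have "x \<in> ?I \<longleftrightarrow> x \<in> {x. c \<le> m * of_int x \<and> ereal (m * of_int x) \<le> B - ereal c} \<and> ?f x \<in> A"
        using geo_range[OF m B, of c x] by blast
      then show "ennreal (Z * \<theta> powi x * \<kappa> ^ iota x) * indicator ?I x = ?W x * indicator (?f -` A) x"
        unfolding geo_weight_def by (auto split: split_indicator)
    qed
    also have "\<dots> = emeasure (distr (density (count_space UNIV) ?W) borel ?f) A"
      using A by (simp add: emeasure_distr emeasure_density)
    finally show "emeasure M A = emeasure (distr (density (count_space UNIV) ?W) borel ?f) A" .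
  qed (simp add: s)
  then have "(\<integral>\<^sup>+y. g y \<partial>M) = (\<integral>\<^sup>+x. ?W x * g (m * of_int x) \<partial>count_space UNIV)"
    if "g \<in> borel_measurable borel" for g
    using that by (simp add: nn_integral_distr nn_integral_density)
  with Z show ?thesis by blast
qed

lemma iota_reflect: "even a \<Longrightarrow> iota (a - x) = iota x" "even a \<Longrightarrow> iota (x - a) = iota x"
  "even a \<Longrightarrow> iota (x + a) = iota x"
  by (simp_all add: iota_def)

lemma in_mZ_inf_even:
  assumes "m > 0" "in_mZ_inf (2 * m) (ereal (m * of_int a))"
  shows "even a"
proof -
  obtain k :: int where "m * of_int a = 2 * m * of_int k"
    using assms(2) unfolding in_mZ_inf_def by auto
  then have "real_of_int a = real_of_int (2 * k)" using assms(1) by simp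
  then have "a = 2 * k" by (simp only: of_int_eq_iff)
  then show ?thesis by simp
qed

lemma F_udK_lattice:
  assumes m: "m > 0" and J: "J \<le> K" and mZ: "in_mZ_inf m J" "in_mZ_inf m K"
  shows "\<exists>y v. F_udK J K (m * of_int x, m * of_int u) = (m * of_int y, m * of_int v) \<and> y + v = x + u \<and>
    (in_mZ_inf (2 * m) J \<and> in_mZ_inf (2 * m) K \<longrightarrow> iota y + iota v = iota x + iota u)"
proof (cases "J = \<infinity>")
  case True
  then show ?thesis using J by (intro exI[of _ u, OF exI[of _ x]]) (simp add: F_udK_eq)
next
  case False
  then obtain a where a: "J = ereal (m * of_int a)" using mZ(1) unfolding in_mZ_inf_def by blast
  have a2: "even a" if "in_mZ_inf (2 * m) J"
    using in_mZ_inf_even[OF m] that unfolding a .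
  have s: "m * of_int x + m * of_int u - m * of_int a = m * of_int (x + u - a)" for a
    by (simp add: algebra_simps)
  have mx: "max (m * of_int x + m * of_int u - m * of_int a) 0 = m * of_int (max (x + u - a) 0)" for a
    unfolding s using m by (auto simp: max_def mult_le_0_iff zero_le_mult_iff simp del: of_int_diff of_int_add)
  show ?thesis
  proof (cases "K = \<infinity>")
    case True
    show ?thesis
    proof (cases "x + u \<le> a")
      case True
      then show ?thesis
        by (intro exI[of _ u, OF exI[of _ x]]) (simp add: F_udK_eq a \<open>K = \<infinity>\<close> mx)
    next
      case False
      then have "max (x + u - a) 0 = x + u - a" by simp
      then have "F_udK J K (m * of_int x, m * of_int u) = (m * of_int (a - x), m * of_int (u - (a - 2 * x)))"
        unfolding F_udK_eq a \<open>K = \<infinity>\<close> mx_ereal mx_infty mx by (simp add: algebra_simps)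
      then show ?thesis
        using a2 by (intro exI[of _ "a - x", OF exI[of _ "u - (a - 2 * x)"]]) (auto simp: iota_reflect)
    qed
  next
    case False
    then obtain b where b: "K = ereal (m * of_int b)" using mZ(2) unfolding in_mZ_inf_def by blast
    have b2: "even b" if "in_mZ_inf (2 * m) K"
      using in_mZ_inf_even[OF m] that unfolding b .
    have ab: "a \<le> b" using J m by (simp add: a b)
    consider "x + u \<le> a" | "a < x + u" "x + u \<le> b" | "b < x + u" by linarith
    then show ?thesis
    proof cases
      case 1
      then show ?thesis using ab
        by (intro exI[of _ u, OF exI[of _ x]]) (simp add: F_udK_eq a b mx)
    next
      case 2
      then have "max (x + u - a) 0 = x + u - a" "max (x + u - b) 0 = 0" by auto
      then have "F_udK J K (m * of_int x, m * of_int u) = (m * of_int (a - x), m * of_int (u - (a - 2 * x)))"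
        unfolding F_udK_eq a b mx_ereal mx by (simp add: algebra_simps)
      then show ?thesis
        using a2 by (intro exI[of _ "a - x", OF exI[of _ "u - (a - 2 * x)"]]) (auto simp: iota_reflect)
    next
      case 3
      then have "max (x + u - a) 0 = x + u - a" "max (x + u - b) 0 = x + u - b" using ab by auto
      then have "F_udK J K (m * of_int x, m * of_int u) = (m * of_int (u - (b - a)), m * of_int (x + (b - a)))"
        unfolding F_udK_eq a b mx_ereal mx by (simp add: algebra_simps)
      then show ?thesis
        using a2 b2 by (intro exI[of _ "u - (b - a)", OF exI[of _ "x + (b - a)"]]) (auto simp: iota_reflect)
    qed
  qed
qed

lemma exchange_sstbGeo:
  assumes J: "J \<noteq> -\<infinity>" "J \<le> K" "ereal c < J / 2" and m: "m > 0" and \<kappa>: "\<kappa> > 0" and \<theta>: "\<theta> > 0"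
    and mZ: "in_mZ_inf m J" "in_mZ_inf m K"
    and par: "\<kappa> = 1 \<or> in_mZ_inf (2 * m) J \<and> in_mZ_inf (2 * m) K"
    and mu: "is_sstbGeo \<mu> \<theta> (c / m) ((J - ereal c) / ereal m) \<kappa> m"
    and nu: "is_sstbGeo \<nu> \<theta> (c / m) ((K - ereal c) / ereal m) \<kappa> m"
  shows "exchange (F_udK J K) \<mu> \<nu>"
proof (rule exchange_F_udKI)
  show p: "prob_space \<mu>" "prob_space \<nu>" and s: "sets \<mu> = sets borel" "sets \<nu> = sets borel"
    using mu nu by (auto simp: is_sstbGeo_def)
  note [measurable_cong] = s
  interpret nu: prob_space \<nu> by fact
  have K: "K \<noteq> -\<infinity>" using J by auto
  obtain Z where Z: "Z > 0" "\<And>g. g \<in> borel_measurable borel \<Longrightarrow> (\<integral>\<^sup>+y. g y \<partial>\<mu>) =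
      (\<integral>\<^sup>+x. geo_weight Z \<theta> \<kappa> m c J x * g (m * of_int x) \<partial>count_space UNIV)"
    using sstbGeo_nn_integral[OF mu m J(1)] by blast
  obtain Z' where Z': "Z' > 0" "\<And>g. g \<in> borel_measurable borel \<Longrightarrow> (\<integral>\<^sup>+y. g y \<partial>\<nu>) =
      (\<integral>\<^sup>+x. geo_weight Z' \<theta> \<kappa> m c K x * g (m * of_int x) \<partial>count_space UNIV)"
    using sstbGeo_nn_integral[OF nu m K] by blast
  define e where "e = (\<lambda>p :: int \<times> int. (m * of_int (fst p), m * of_int (snd p)))"
  define H where "H p = geo_weight Z \<theta> \<kappa> m c J (fst p) * geo_weight Z' \<theta> \<kappa> m c K (snd p)" for p
  have H: "H p = (if in_rect c J K (e p) then
      ennreal (Z * Z' * \<theta> powi (fst p + snd p) * \<kappa> ^ (iota (fst p) + iota (snd p))) else 0)" for p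
  proof -
    have "Z * \<theta> powi fst p * \<kappa> ^ iota (fst p) * (Z' * \<theta> powi snd p * \<kappa> ^ iota (snd p)) =
        Z * Z' * \<theta> powi (fst p + snd p) * \<kappa> ^ (iota (fst p) + iota (snd p))"
      using \<theta> by (simp add: power_int_add power_add)
    moreover have "0 \<le> Z * \<theta> powi fst p * \<kappa> ^ iota (fst p)" using Z(1) \<theta> \<kappa> by simp
    ultimately have "ennreal (Z * \<theta> powi fst p * \<kappa> ^ iota (fst p)) * ennreal (Z' * \<theta> powi snd p * \<kappa> ^ iota (snd p)) =
        ennreal (Z * Z' * \<theta> powi (fst p + snd p) * \<kappa> ^ (iota (fst p) + iota (snd p)))"
      by (simp only: ennreal_mult'[symmetric])
    then show ?thesis
      by (cases p) (auto simp: H_def geo_weight_def in_rect_def e_def indicator_def)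
  qed
  have "\<forall>p. \<exists>q. F_udK J K (e p) = e q \<and> fst q + snd q = fst p + snd p \<and>
      (in_mZ_inf (2 * m) J \<and> in_mZ_inf (2 * m) K \<longrightarrow> iota (fst q) + iota (snd q) = iota (fst p) + iota (snd p))"
    unfolding e_def using F_udK_lattice[OF m J(2) mZ] by (metis fst_conv snd_conv)
  then obtain T where T: "\<And>p. F_udK J K (e p) = e (T p)" "\<And>p. fst (T p) + snd (T p) = fst p + snd p"
    "\<And>p. in_mZ_inf (2 * m) J \<and> in_mZ_inf (2 * m) K \<longrightarrow> iota (fst (T p)) + iota (snd (T p)) = iota (fst p) + iota (snd p)"
    by metis
  have "inj e" using m by (auto simp: inj_def e_def prod_eq_iff)
  moreover have "e (T (T p)) = e p" for p using T(1)[of "T p"] T(1)[of p] F_udK_involution[of J K "e p"] by simp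
  ultimately have TT: "T (T p) = p" for p by (simp add: inj_eq)
  have bij: "bij_betw T UNIV UNIV" by (rule bij_betw_byWitness[of _ T]) (simp_all add: TT)
  have HT: "H (T p) = H p" for p
  proof -
    have "\<kappa> ^ (iota (fst (T p)) + iota (snd (T p))) = \<kappa> ^ (iota (fst p) + iota (snd p))"
      using par T(3)[of p] by (elim disjE) auto
    then show ?thesis unfolding H T(1)[symmetric] in_rect_F_udK[OF J] T(2) by simp
  qed
  fix G :: "real \<times> real \<Rightarrow> ennreal" assume G[measurable]: "G \<in> borel_measurable (borel \<Otimes>\<^sub>M borel)"
  have dens: "(\<integral>\<^sup>+x. \<integral>\<^sup>+u. g (x, u) \<partial>\<nu> \<partial>\<mu>) = (\<integral>\<^sup>+p. H p * g (e p) \<partial>count_space UNIV)"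
    if [measurable]: "g \<in> borel_measurable (borel \<Otimes>\<^sub>M borel)" for g
  proof -
    have "(\<integral>\<^sup>+x. \<integral>\<^sup>+u. g (x, u) \<partial>\<nu> \<partial>\<mu>) = (\<integral>\<^sup>+x. geo_weight Z \<theta> \<kappa> m c J x *
        (\<integral>\<^sup>+u. g (m * of_int x, u) \<partial>\<nu>) \<partial>count_space UNIV)"
      by (rule Z(2)) measurable
    also have "\<dots> = (\<integral>\<^sup>+x. geo_weight Z \<theta> \<kappa> m c J x *
        (\<integral>\<^sup>+u. geo_weight Z' \<theta> \<kappa> m c K u * g (m * of_int x, m * of_int u) \<partial>count_space UNIV) \<partial>count_space UNIV)"
      by (subst Z'(2)) measurable
    also have "\<dots> = (\<integral>\<^sup>+x. (\<integral>\<^sup>+u. H (x, u) * g (e (x, u)) \<partial>count_space UNIV) \<partial>count_space UNIV)"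
      by (subst nn_integral_cmult[symmetric]) (simp_all add: H_def e_def mult.assoc)
    also have "\<dots> = (\<integral>\<^sup>+p. H p * g (e p) \<partial>count_space UNIV)"
      by (rule nn_integral_fst_count_space[where f = "\<lambda>p. H p * g (e p)"])
    finally show ?thesis .
  qed
  have "(\<integral>\<^sup>+x. \<integral>\<^sup>+u. G (F_udK J K (x, u)) \<partial>\<nu> \<partial>\<mu>) = (\<integral>\<^sup>+p. H p * G (F_udK J K (e p)) \<partial>count_space UNIV)"
    by (rule dens) measurable
  also have "\<dots> = (\<integral>\<^sup>+p. H (T p) * G (e (T p)) \<partial>count_space UNIV)"
    by (simp add: HT T(1))
  also have "\<dots> = (\<integral>\<^sup>+p. H p * G (e p) \<partial>count_space UNIV)"
    by (rule nn_integral_bij_count_space[OF bij])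
  also have "\<dots> = (\<integral>\<^sup>+x. \<integral>\<^sup>+u. G (x, u) \<partial>\<nu> \<partial>\<mu>)"
    by (rule dens[symmetric]) measurable
  finally show "(\<integral>\<^sup>+x. \<integral>\<^sup>+u. G (F_udK J K (x, u)) \<partial>\<nu> \<partial>\<mu>) = (\<integral>\<^sup>+x. \<integral>\<^sup>+u. G (x, u) \<partial>\<nu> \<partial>\<mu>)" .
qed

lemma sstbGeo_moment:
  assumes mu: "is_sstbGeo \<mu> \<theta> (c / m) ((ereal j - ereal c) / ereal m) \<kappa> m" and m: "m > 0" and \<kappa>: "\<kappa> > 0"
    and \<theta>: "0 < \<theta>" and j: "in_mZ_inf m (ereal j)" and par: "\<kappa> = 1 \<or> in_mZ_inf (2 * m) (ereal j)"
  shows "AE y in \<mu>. y \<le> j - c" "(\<integral>\<^sup>+y. ennreal (exp (- ln \<theta> / m * (2 * y - j))) \<partial>\<mu>) = 1"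
proof -
  interpret prob_space \<mu> using mu by (simp add: is_sstbGeo_def)
  have s: "sets \<mu> = sets borel" using mu by (simp add: is_sstbGeo_def)
  obtain a where a: "j = m * of_int a" using j by (auto simp: in_mZ_inf_def)
  have a2: "\<kappa> = 1 \<or> even a"
    using par in_mZ_inf_even[OF m, of a] unfolding a by blast
  obtain Z where Z: "Z > 0" "\<And>g. g \<in> borel_measurable borel \<Longrightarrow> (\<integral>\<^sup>+y. g y \<partial>\<mu>) =
      (\<integral>\<^sup>+x. geo_weight Z \<theta> \<kappa> m c (ereal j) x * g (m * of_int x) \<partial>count_space UNIV)"
    using sstbGeo_nn_integral[OF mu m] by auto
  let ?W = "geo_weight Z \<theta> \<kappa> m c (ereal j)"
  have "emeasure \<mu> {j - c<..} = (\<integral>\<^sup>+y. indicator {j - c<..} y \<partial>\<mu>)" by (simp add: s)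
  also have "\<dots> = (\<integral>\<^sup>+x. ?W x * indicator {j - c<..} (m * of_int x) \<partial>count_space UNIV)"
    by (rule Z(2)) simp
  also have "\<dots> = (\<integral>\<^sup>+x. 0 \<partial>count_space (UNIV :: int set))"
    by (rule nn_integral_cong) (auto simp: geo_weight_def indicator_def)
  finally have "{j - c<..} \<in> null_sets \<mu>" by (intro null_setsI) (simp_all add: s)
  from AE_not_in[OF this] show "AE y in \<mu>. y \<le> j - c" by eventually_elim simp
  have "(\<integral>\<^sup>+y. ennreal (exp (- ln \<theta> / m * (2 * y - j))) \<partial>\<mu>) =
      (\<integral>\<^sup>+x. ?W x * ennreal (exp (- ln \<theta> / m * (2 * (m * of_int x) - j))) \<partial>count_space UNIV)"
    by (rule Z(2)) measurable
  also have "\<dots> = (\<integral>\<^sup>+x. ?W (a - x) \<partial>count_space UNIV)"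
  proof (rule nn_integral_cong)
    fix x :: int
    have "- ln \<theta> / m * (2 * (m * of_int x) - j) = of_int (a - 2 * x) * ln \<theta>"
      using m by (simp add: a field_simps)
    then have "exp (- ln \<theta> / m * (2 * (m * of_int x) - j)) = \<theta> powr of_int (a - 2 * x)"
      using \<theta> by (simp add: powr_def)
    also have "\<dots> = \<theta> powi (a - 2 * x)" using \<theta> by (intro powr_real_of_int') auto
    finally have e: "exp (- ln \<theta> / m * (2 * (m * of_int x) - j)) = \<theta> powi (a - 2 * x)" .
    have "\<theta> powi x * \<theta> powi (a - 2 * x) = \<theta> powi (a - x)" using \<theta> by (simp flip: power_int_add)
    moreover have "\<kappa> ^ iota (a - x) = \<kappa> ^ iota x" using a2 by (auto simp: iota_reflect)
    ultimately have "Z * \<theta> powi x * \<kappa> ^ iota x * \<theta> powi (a - 2 * x) = Z * \<theta> powi (a - x) * \<kappa> ^ iota (a - x)"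
      by (metis mult.assoc mult.commute)
    moreover have "0 \<le> Z * \<theta> powi x * \<kappa> ^ iota x" using Z(1) \<theta> \<kappa> by simp
    ultimately have "ennreal (Z * \<theta> powi x * \<kappa> ^ iota x) * ennreal (\<theta> powi (a - 2 * x)) =
        ennreal (Z * \<theta> powi (a - x) * \<kappa> ^ iota (a - x))"
      by (simp only: ennreal_mult'[symmetric])
    then show "?W x * ennreal (exp (- ln \<theta> / m * (2 * (m * of_int x) - j))) = ?W (a - x)"
      unfolding e geo_weight_def by (auto simp: indicator_def a algebra_simps)
  qed
  also have "\<dots> = (\<integral>\<^sup>+x. ?W x \<partial>count_space UNIV)"
    by (rule nn_integral_bij_count_space, rule bij_betw_byWitness[of _ "\<lambda>x. a - x"]) auto
  also have "\<dots> = (\<integral>\<^sup>+y. 1 \<partial>\<mu>)" using Z(2)[of "\<lambda>_. 1"] by simp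
  finally show "(\<integral>\<^sup>+y. ennreal (exp (- ln \<theta> / m * (2 * y - j))) \<partial>\<mu>) = 1"
    by (simp add: emeasure_space_1)
qed

lemma sstbGeo_infinite:
  assumes nu: "is_sstbGeo \<nu> \<theta> (c / m) ((\<infinity> - ereal c) / ereal m) \<kappa> m" and m: "m > 0" and \<kappa>: "\<kappa> > 0"
  shows "\<theta> < 1"
proof (rule ccontr)
  assume "\<not> \<theta> < 1"
  then have \<theta>: "1 \<le> \<theta>" by simp
  interpret prob_space \<nu> using nu by (simp add: is_sstbGeo_def)
  obtain Z where Z: "Z > 0" "\<And>g. g \<in> borel_measurable borel \<Longrightarrow> (\<integral>\<^sup>+y. g y \<partial>\<nu>) =
      (\<integral>\<^sup>+x. geo_weight Z \<theta> \<kappa> m c \<infinity> x * g (m * of_int x) \<partial>count_space UNIV)"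
    using sstbGeo_nn_integral[OF nu m] by auto
  define A where "A = {max 0 \<lceil>c / m\<rceil> ..}"
  define \<delta> where "\<delta> = Z * min 1 \<kappa>"
  have \<delta>: "\<delta> > 0" using Z(1) \<kappa> by (simp add: \<delta>_def)
  have "ennreal \<delta> * indicator A x \<le> geo_weight Z \<theta> \<kappa> m c \<infinity> x" for x
  proof (cases "x \<in> A")
    case True
    then have x: "0 \<le> x" "c / m \<le> of_int x" by (auto simp: A_def ceiling_le_iff)
    then have "c \<le> m * of_int x" using m by (simp add: field_simps)
    moreover have "1 \<le> \<theta> powi x" using x(1) \<theta> by (simp add: power_int_def)
    moreover have "min 1 \<kappa> \<le> \<kappa> ^ iota x" by (simp add: iota_def)
    moreover from calculation(2,3) have "1 * min 1 \<kappa> \<le> \<theta> powi x * \<kappa> ^ iota x"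
      using \<kappa> by (intro mult_mono) auto
    then have "Z * min 1 \<kappa> \<le> Z * \<theta> powi x * \<kappa> ^ iota x"
      using Z(1) by (simp add: mult.assoc)
    ultimately show ?thesis using True by (simp add: geo_weight_def \<delta>_def ennreal_leI)
  qed simp
  then have "(\<integral>\<^sup>+x. ennreal \<delta> * indicator A x \<partial>count_space UNIV) \<le> (\<integral>\<^sup>+x. geo_weight Z \<theta> \<kappa> m c \<infinity> x \<partial>count_space UNIV)"
    by (intro nn_integral_mono) auto
  also have "\<dots> = 1" using Z(2)[of "\<lambda>_. 1"] by (simp add: emeasure_space_1)
  finally have "ennreal \<delta> * emeasure (count_space UNIV) A \<le> 1"
    by (simp add: nn_integral_cmult_indicator)
  moreover have "infinite A" unfolding A_def by (rule infinite_Ici)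
  ultimately show False using \<delta> by (simp add: emeasure_count_space ennreal_mult_top top_unique)
qed

lemma in_mZ_inf_double:
  assumes "in_mZ m (ereal c)" "in_mZ_inf (2 * m) (B - 2 * ereal c)" "B \<noteq> -\<infinity>"
  shows "in_mZ_inf (2 * m) B"
proof (cases B)
  case (real b)
  obtain k l where "c = m * of_int k" "b - 2 * c = 2 * m * of_int l"
    using assms(1,2) unfolding in_mZ_def in_mZ_inf_def real by auto
  then have "b = 2 * m * of_int (l + k)" by (simp add: algebra_simps)
  then show ?thesis unfolding in_mZ_inf_def real by blast
qed (use assms in \<open>auto simp: in_mZ_inf_def\<close>)

theorem theorem3p7:
  fixes J K :: ereal and \<mu> \<nu> :: "real measure"
  assumes "J \<noteq> -\<infinity>" and "K \<noteq> -\<infinity>" and "J \<le> K"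
    and "admissible_pair J K \<mu> \<nu>"
    and "\<forall>j. J = ereal j \<longrightarrow> \<mu> \<noteq> return borel (j / 2)"
    and "emeasure \<nu> {x. ereal x \<le> J / 2 \<or> K - J / 2 \<le> ereal x} > 0"
  shows "ergodic_under (PiM (UNIV :: int set) (\<lambda>_. \<mu>)) (T_udK J K) (T_defined J K)
       \<and> ergodic_under (PiM (UNIV :: int set) (\<lambda>_. \<nu>)) (T_udK K J) (T_defined K J)"
proof -
  let ?sub = "\<forall>j. J = ereal j \<longrightarrow> K = \<infinity> \<longrightarrow>
      (\<exists>b h. (AE y in \<mu>. y \<le> b) \<and> h > 0 \<and> (\<integral>\<^sup>+y. ennreal (exp (h * (2 * y - j))) \<partial>\<mu>) \<le> 1)"
  have concl: ?thesis if "exchange (F_udK J K) \<mu> \<nu>" ?sub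
    using ergodic_udK_pair[OF assms(1,3) that(1)] assms(5,6) that(2) by blast
  from assms(4)[unfolded admissible_pair_def] show ?thesis
  proof (elim disjE)
    assume "\<exists>lam c. ereal c < J / 2 \<and> (K = \<infinity> \<longrightarrow> lam > 0) \<and>
        is_stExp \<mu> lam c (J - ereal c) \<and> is_stExp \<nu> lam c (K - ereal c)"
    then obtain l c where c: "ereal c < J / 2" "K = \<infinity> \<longrightarrow> l > 0"
      and st: "is_stExp \<mu> l c (J - ereal c)" "is_stExp \<nu> l c (K - ereal c)" by blast
    show ?thesis
    proof (rule concl)
      show "exchange (F_udK J K) \<mu> \<nu>" by (rule exchange_stExp[OF assms(1,3) c(1) st])
      show ?sub
      proof (intro allI impI)
        fix j assume "J = ereal j" "K = \<infinity>"
        then show "\<exists>b h. (AE y in \<mu>. y \<le> b) \<and> h > 0 \<and> (\<integral>\<^sup>+y. ennreal (exp (h * (2 * y - j))) \<partial>\<mu>) \<le> 1"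
          using stExp_moment[of \<mu> l c j] st(1) c(2) by (intro exI[of _ "j - c"] exI[of _ l]) auto
      qed
    qed
  next
    assume "\<exists>theta kappa c m. ereal c < J / 2 \<and> m > 0 \<and> kappa > 0 \<and>
        in_mZ m (ereal c) \<and> in_mZ_inf m J \<and> in_mZ_inf m K \<and>
        ((in_mZ_inf m (J - 2 * ereal c) \<and> in_mZ_inf m (K - 2 * ereal c)
              \<and> 0 < theta \<and> theta < 1 \<and> kappa = 1)
        \<or> (in_mZ_inf (2 * m) (J - 2 * ereal c) \<and> in_mZ_inf (2 * m) (K - 2 * ereal c)
              \<and> 0 < theta \<and> theta < 1 \<and> kappa \<noteq> 1)
        \<or> (in_mZ m (J - 2 * ereal c) \<and> in_mZ m (K - 2 * ereal c)
              \<and> theta \<ge> 1 \<and> kappa = 1)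
        \<or> (in_mZ_inf (2 * m) (J - 2 * ereal c) \<and> in_mZ_inf (2 * m) (K - 2 * ereal c)
              \<and> theta \<ge> 1 \<and> kappa \<noteq> 1)) \<and>
        is_sstbGeo \<mu> theta (c / m) ((J - ereal c) / ereal m) kappa m \<and>
        is_sstbGeo \<nu> theta (c / m) ((K - ereal c) / ereal m) kappa m"
    then obtain \<theta> \<kappa> c m where c: "ereal c < J / 2" and m: "m > 0" and \<kappa>: "\<kappa> > 0"
      and mZ: "in_mZ m (ereal c)" "in_mZ_inf m J" "in_mZ_inf m K"
      and \<theta>: "\<theta> > 0" and par: "\<kappa> = 1 \<or> in_mZ_inf (2 * m) (J - 2 * ereal c) \<and> in_mZ_inf (2 * m) (K - 2 * ereal c)"
      and geo: "is_sstbGeo \<mu> \<theta> (c / m) ((J - ereal c) / ereal m) \<kappa> m"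
        "is_sstbGeo \<nu> \<theta> (c / m) ((K - ereal c) / ereal m) \<kappa> m"
      by (smt (verit))
    have par': "\<kappa> = 1 \<or> in_mZ_inf (2 * m) J \<and> in_mZ_inf (2 * m) K"
      using par in_mZ_inf_double[OF mZ(1)] assms(1,2) by blast
    show ?thesis
    proof (rule concl)
      show "exchange (F_udK J K) \<mu> \<nu>"
        by (rule exchange_sstbGeo[OF assms(1,3) c m \<kappa> \<theta> mZ(2,3) par' geo])
      show ?sub
      proof (intro allI impI)
        fix j assume j: "J = ereal j" and K: "K = \<infinity>"
        have "\<theta> < 1" using sstbGeo_infinite[OF geo(2)[unfolded K] m \<kappa>] .
        then have "- ln \<theta> / m > 0" using \<theta> m by (simp add: divide_neg_pos)
        moreover have "AE y in \<mu>. y \<le> j - c" "(\<integral>\<^sup>+y. ennreal (exp (- ln \<theta> / m * (2 * y - j))) \<partial>\<mu>) \<le> 1"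
          using sstbGeo_moment[OF geo(1)[unfolded j] m \<kappa> \<theta> mZ(2)[unfolded j]] par' j by auto
        ultimately show "\<exists>b h. (AE y in \<mu>. y \<le> b) \<and> h > 0 \<and> (\<integral>\<^sup>+y. ennreal (exp (h * (2 * y - j))) \<partial>\<mu>) \<le> 1"
          by blast
      qed
    qed
  next
    assume a: "J = K \<and> prob_space \<mu> \<and> sets \<mu> = sets borel \<and> \<nu> = \<mu>"
    show ?thesis
    proof (rule concl)
      show "exchange (F_udK J K) \<mu> \<nu>"
        using a exchange_swapping[of \<mu> "\<lambda>_. True" J K] by (simp add: F_udK_eq)
      show ?sub using a by auto
    qed
  next
    assume a: "J < K \<and> prob_space \<mu> \<and> sets \<mu> = sets borel \<and> \<nu> = \<mu> \<and> emeasure \<mu> {x. J / 2 < ereal x} = 0"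
    then obtain j where j: "J = ereal j" using assms(1) by (cases J) auto
    have "{x. j / 2 < x} \<in> null_sets \<mu>"
      using a unfolding j by (intro null_setsI) auto
    from AE_not_in[OF this] have ae: "AE x in \<mu>. x \<le> j / 2" by eventually_elim auto
    show ?thesis
    proof (rule concl)
      have "F_udK J K (x, u) = (u, x)" if "x \<le> j / 2" "u \<le> j / 2" for x u
        using that a by (cases K) (auto simp: F_udK_eq j max_def)
      then show "exchange (F_udK J K) \<mu> \<nu>"
        using a ae exchange_swapping[of \<mu> "\<lambda>x. x \<le> j / 2" J K] by blast
      interpret prob_space \<mu> using a by blast
      have "(\<integral>\<^sup>+y. ennreal (exp (1 * (2 * y - j))) \<partial>\<mu>) \<le> (\<integral>\<^sup>+y. 1 \<partial>\<mu>)"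
      proof (rule nn_integral_mono_AE)
        show "AE y in \<mu>. ennreal (exp (1 * (2 * y - j))) \<le> 1"
          using ae
        proof eventually_elim
          case (elim y)
          then have "2 * y - j \<le> 0" by simp
          then show ?case by simp
        qed
      qed
      then have "(AE y in \<mu>. y \<le> j / 2) \<and> (1 :: real) > 0 \<and> (\<integral>\<^sup>+y. ennreal (exp (1 * (2 * y - j))) \<partial>\<mu>) \<le> 1"
        using ae by (simp add: emeasure_space_1)
      then show ?sub unfolding j ereal.inject by blast
    qed
  next
    assume "J < K \<and> (\<exists>j. J = ereal j \<and> \<mu> = return borel (j / 2)) \<and>
        prob_space \<nu> \<and> sets \<nu> = sets borel \<and>
        emeasure \<nu> {x. \<not> (J / 2 \<le> ereal x \<and> ereal x \<le> K - J / 2)} = 0"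
    then show ?thesis using assms(5) by blast
  next
    assume a: "J < K \<and> K \<noteq> \<infinity> \<and> prob_space \<mu> \<and> sets \<mu> = sets borel \<and>
        emeasure \<mu> {x. ereal x < J / 2} = 0 \<and> \<nu> = distr \<mu> borel (\<lambda>x. x + real_of_ereal (K - J))"
    then obtain j k where j: "J = ereal j" and k: "K = ereal k"
      using assms(1,2) by (cases J; cases K) auto
    have "{x. x < j / 2} \<in> null_sets \<mu>"
      using a unfolding j by (intro null_setsI) auto
    from AE_not_in[OF this] have ae: "AE x in \<mu>. j / 2 \<le> x" by eventually_elim auto
    show ?thesis
    proof (rule concl)
      show "exchange (F_udK J K) \<mu> \<nu>"
        using a exchange_shifted[of \<mu> j k, OF _ _ _ ae] by (auto simp: j k)
      show ?sub using a by auto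
    qed
  qed
qed

end
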